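(* Let $n\in\mathbb{N}$ be a positive integer, let $1<s<\infty$ and $m\in\mathbb{R}$. Define $$ m_s= \begin{cases} -\dfrac{ns}{2}, & \text{if } 1<s\le 2,\\[4pt] -n(s-1), & \text{if } 2<s<\infty . \end{cases} $$ Suppose that for every $\sigma\in S^m_{1,0}(\mathbb{R}^{2n})$ the function $$ e^{i(|\xi|^s+|\eta|^s+|\xi+\eta|^s)}\,\sigma(\xi,\eta),\qquad (\xi,\eta)\in\mathbb{R}^n\times\mathbb{R}^n, $$ is a bilinear Fourier multiplier for $L^\infty\times L^\infty\to bmo$ (spaces on $\mathbb{R}^n$). Then $m\le m_s$.
   Context: Symbol class: for $d\in\mathbb{N}$ and $m\in\mathbb{R}$, $S^m_{1,0}(\mathbb{R}^d)$ is the set of all $\sigma\in C^\infty(\mathbb{R}^d)$ such that for every multi-index $\alpha\in\{0,1,2,\dots\}^d$ there is a constant $C_\alpha$ with $|\partial^\alpha_\zeta\sigma(\zeta)|\le C_\alpha(1+|\zeta|)^{m-|\alpha|}$ for all $\zeta\in\mathbb{R}^d$. Fourier transform: $\widehat f(\xi)=\int_{\mathbb{R}^n}e^{-i\xi\cdot x}f(x)\,dx$. Bilinear Fourier multipliers: for a measurable function $\tau=\tau(\xi,\eta)$ on $\mathbb{R}^n\times\mathbb{R}^n$ with $|\tau(\xi,\eta)|\le c(1+|\xi|+|\eta|)^L$ for some $c>0$, $L\in\mathbb{R}$, define for $f,g$ in the Schwartz class $\mathcal{S}(\mathbb{R}^n)$ $$ T_\tau(f,g)(x)=\frac{1}{(2\pi)^{2n}}\iint_{\mathbb{R}^n\times\mathbb{R}^n}e^{ix\cdot(\xi+\eta)}\tau(\xi,\eta)\widehat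 f(\xi)\widehat g(\eta)\,d\xi\,d\eta . $$ For function spaces $X,Y,Z$ on $\mathbb{R}^n$, $\tau$ is a bilinear Fourier multiplier for $X\times Y\to Z$ if there is a constant $A>0$ such that $\|T_\tau(f,g)\|_Z\le A\|f\|_X\|g\|_Y$ for all $f\in\mathcal{S}\cap X$ and $g\in\mathcal{S}\cap Y$. The space $bmo=bmo(\mathbb{R}^n)$ is Goldberg's local BMO space (the dual of the local Hardy space $h^1$), with norm $$ \|f\|_{bmo}=\sup_{|Q|\le 1}\frac1{|Q|}\int_Q|f(x)-f_Q|\,dx+\sup_{|Q|\ge 1}\frac1{|Q|}\int_Q|f(x)|\,dx, $$ where $Q$ ranges over cubes in $\mathbb{R}^n$ and $f_Q=|Q|^{-1}\int_Q f$. *)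

theory Defs
  imports "HOL-Analysis.Analysis" "HOL-Probability.Essential_Supremum"
begin

definition partial_deriv :: "'a::euclidean_space \<Rightarrow> ('a \<Rightarrow> complex) \<Rightarrow> 'a \<Rightarrow> complex" where
  "partial_deriv b f x = frechet_derivative f (at x) b"

text \<open>
  A multi-index is encoded by a word in the basis vectors, in which each basis vector occurs as
  often as the corresponding entry of the multi-index says; the order of the multi-index is the
  length of the word. Mixed partial derivatives of smooth functions commute, so that different
  words for the same multi-index give the same derivative.
\<close>

fun iter_partial :: "'a::euclidean_space list \<Rightarrow> ('a \<Rightarrow> complex) \<Rightarrow> 'a \<Rightarrow> complex" where
  "iter_partial [] f = f"
| "iter_partial (b # bs) f = partial_deriv b (iter_partial bs f)"

definition smooth :: "('a::euclidean_space \<Rightarrow> complex) \<Rightarrow> bool" where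
  "smooth f \<longleftrightarrow> (\<forall>bs \<in> lists Basis. \<forall>x. iter_partial bs f differentiable (at x))"

definition symbol_class :: "real \<Rightarrow> ('a::euclidean_space \<Rightarrow> complex) set" where
  "symbol_class m = {\<sigma>. smooth \<sigma> \<and>
     (\<forall>bs \<in> lists Basis. \<exists>C. \<forall>\<zeta>.
        norm (iter_partial bs \<sigma> \<zeta>) \<le> C * (1 + norm \<zeta>) powr (m - real (length bs)))}"

definition schwartz :: "('a::euclidean_space \<Rightarrow> complex) set" where
  "schwartz = {f. smooth f \<and>
     (\<forall>bs \<in> lists Basis. \<forall>k::nat. \<exists>C. \<forall>x. (1 + norm x) ^ k * norm (iter_partial bs f x) \<le> C)}"

definition fourier :: "('a::euclidean_space \<Rightarrow> complex) \<Rightarrow> 'a \<Rightarrow> complex" where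
  "fourier f \<xi> = (LINT x|lebesgue. exp (- \<i> * complex_of_real (\<xi> \<bullet> x)) * f x)"

definition bilinear_op ::
  "('a::euclidean_space \<times> 'a \<Rightarrow> complex) \<Rightarrow> ('a \<Rightarrow> complex) \<Rightarrow> ('a \<Rightarrow> complex) \<Rightarrow> 'a \<Rightarrow> complex" where
  "bilinear_op \<tau> f g x =
     complex_of_real (1 / (2 * pi) ^ (2 * DIM('a))) *
     (LINT (\<xi>, \<eta>)|lebesgue.
        exp (\<i> * complex_of_real (x \<bullet> (\<xi> + \<eta>))) * \<tau> (\<xi>, \<eta>) * fourier f \<xi> * fourier g \<eta>)"

text \<open>
  A function space is represented by its norm as a function with values in the extended nonnegative
  reals; the space consists of the functions with finite norm.
\<close>

definition bilinear_multiplier ::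
  "(('a::euclidean_space \<Rightarrow> complex) \<Rightarrow> ennreal) \<Rightarrow> (('a \<Rightarrow> complex) \<Rightarrow> ennreal) \<Rightarrow>
   (('a \<Rightarrow> complex) \<Rightarrow> ennreal) \<Rightarrow> ('a \<times> 'a \<Rightarrow> complex) \<Rightarrow> bool" where
  "bilinear_multiplier X Y Z \<tau> \<longleftrightarrow>
     \<tau> \<in> borel_measurable lebesgue \<and>
     (\<exists>c>0. \<exists>L::real. \<forall>\<xi> \<eta>. norm (\<tau> (\<xi>, \<eta>)) \<le> c * (1 + norm \<xi> + norm \<eta>) powr L) \<and>
     (\<exists>A>0. \<forall>f \<in> schwartz. \<forall>g \<in> schwartz. X f < \<infinity> \<longrightarrow> Y g < \<infinity> \<longrightarrow>
        Z (bilinear_op \<tau> f g) \<le> ennreal A * X f * Y g)"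

definition Linf_norm :: "('a::euclidean_space \<Rightarrow> complex) \<Rightarrow> ennreal" where
  "Linf_norm f =
     (if f \<in> borel_measurable lebesgue then esssup lebesgue (\<lambda>x. ennreal (norm (f x))) else \<infinity>)"

definition cubes :: "'a::euclidean_space set set" where
  "cubes = {cbox a (a + l *\<^sub>R One) | a l. l > 0}"

definition avg :: "'a::euclidean_space set \<Rightarrow> ('a \<Rightarrow> complex) \<Rightarrow> complex" where
  "avg Q f = (LINT x:Q|lebesgue. f x) /\<^sub>R measure lebesgue Q"

text \<open>
  If \<open>f\<close> is not locally integrable, then \<open>avg Q f\<close> can be a junk value, but the second supremum is
  infinite.
\<close>

definition bmo_norm :: "('a::euclidean_space \<Rightarrow> complex) \<Rightarrow> ennreal" where
  "bmo_norm f =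
     (if f \<in> borel_measurable lebesgue then
        (SUP Q \<in> {Q \<in> cubes. measure lebesgue Q \<le> 1}.
           (\<integral>\<^sup>+x\<in>Q. ennreal (norm (f x - avg Q f)) \<partial>lebesgue) / emeasure lebesgue Q) +
        (SUP Q \<in> {Q \<in> cubes. measure lebesgue Q \<ge> 1}.
           (\<integral>\<^sup>+x\<in>Q. ennreal (norm (f x)) \<partial>lebesgue) / emeasure lebesgue Q)
      else \<infinity>)"

definition critical_order :: "nat \<Rightarrow> real \<Rightarrow> real" where
  "critical_order n s = (if s \<le> 2 then - (real n * s / 2) else - (real n * (s - 1)))"

end

theory Submission
  imports Defs "HOL-Probability.Characteristic_Functions" "HOL-Real_Asymp.Real_Asymp"
begin

text \<open>
  The single symbol \<open>(1 + |\<xi>|^2 + |\<eta>|^2)^(m/2)\<close> is tested on two families of functions. Let \<open>f\<close> be a sum of Gaussian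
  packets of width \<open>W = A R^(s/2-1)\<close> whose frequencies \<open>v\<close> form a lattice of spacing \<open>A R^(1-s/2)\<close> in the region
  \<open>|v| \<sim> R\<close>, the packet with frequency \<open>v\<close> being centred at a multiple \<open>c\<close> of the gradient of \<open>|\<xi>|^s\<close> at \<open>v\<close>. The centres are
  \<open>W\<close>-separated, hence \<open>f\<close> is bounded independently of \<open>R\<close>. On the other hand, a Taylor expansion of \<open>|\<xi>|^s\<close> on
  the frequency scale \<open>1/W\<close> shows that the Fourier transform of \<open>f\<close> times \<open>e^(i c |\<xi>|^s)\<close> has almost vanishing
  phase if \<open>A\<close> is large, so that no oscillatory integral has to be estimated: every quantity of interest is
  bounded below by an integral of positive functions.

  For \<open>c = 2\<close> and \<open>g\<close> a very wide Gaussian, the real part of \<open>T(f, g)\<close> is at least a constant times \<open>R^(m + n s / 2)\<close> on a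
  cube of side comparable to \<open>1/R\<close>, whereas the average of a function over such a cube is \<open>O(log R)\<close> times its bmo norm. For
  \<open>s > 2\<close>, \<open>c = 1\<close> and \<open>g(x) = f(-x)\<close>, the integral of \<open>T(f, g)\<close> against a fixed Gaussian is at least a constant times
  \<open>R^(m + n (s - 1))\<close>, whereas it is bounded by the bmo norm.
\<close>

section \<open>Gaussian wave packets\<close>

text \<open>Everything rests on one inequality: for G \<ge> 0 and real \<theta>, the real part of
  the integral of \<open>cis \<theta> * G\<close> is at least the integral of G minus that of
  \<open>dev \<theta> * G\<close>. At distance 1/W from v the second-order Taylor error is about
  R^(s-2) / W^2 = 1 / A^2, so a fixed A makes the loss at most half the gain. With K frequencies per
  coordinate direction the spacing is R/K; separation W of the centres forces R^(s/2) = A K.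

  The linear test adds up K^n packets, each worth R^m. In the bilinear one, frequencies v and -v'
  interact only if |v - v'| stays bounded, which leaves about K^n (K/R)^n of the K^(2n) pairs. A
  uniformly small loss per pair would be too much, because the other pairs are far more numerous;
  hence the loss must decay like a Gaussian in |v - v'|. For s > 2 the spacing R/K tends to 0, so
  that every packet has many partners; and s - 1 > s/2 exactly for s > 2, whence the two branches of
  the exponent. The logarithm is harmless: a positive power of K contradicts it.\<close>

definition gauss :: "real \<Rightarrow> 'a::euclidean_space \<Rightarrow> 'a \<Rightarrow> real" where
  "gauss W p x = exp (- (norm (x - p))\<^sup>2 / (2 * W\<^sup>2))"

lemma gauss_nonneg: "0 \<le> gauss W p x" and gauss_le_1: "gauss W p x \<le> 1"
  by (auto simp: gauss_def)

lemma borel_measurable_gauss [measurable]: "gauss W p \<in> borel_measurable borel"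
  unfolding gauss_def by measurable

lemma borel_measurable_cis [measurable]: "cis \<in> borel_measurable borel"
  by (intro borel_measurable_continuous_onI continuous_intros)

text \<open>The characteristic function of the standard normal law under the substitution of (x - p)
  / W for x; the translation produces the factor \<open>cis (t * p)\<close>.\<close>

lemma has_bochner_integral_gauss_cis_real:
  fixes W p t :: real
  assumes W: "W > 0"
  shows "has_bochner_integral lborel (\<lambda>x. exp (- (x - p)\<^sup>2 / (2 * W\<^sup>2)) *\<^sub>R cis (t * x))
           (complex_of_real (sqrt (2 * pi) * W * exp (- W\<^sup>2 * t\<^sup>2 / 2)) * cis (t * p))"
proof -
  have i0: "integrable lborel (\<lambda>x. std_normal_density x *\<^sub>R cis (u * x))" for u
    by (rule Bochner_Integration.integrable_bound[OF integrable_normal_density[of 1 0]]) auto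
  have "(LINT x|lborel. std_normal_density x *\<^sub>R cis (u * x)) = complex_of_real (exp (- u\<^sup>2 / 2))" for u
  proof -
    have "char std_normal_distribution u = (LINT x|lborel. std_normal_density x *\<^sub>R cis (u * x))"
      unfolding char_def
      by (subst integral_density) (auto simp: cis_conv_exp mult.commute scaleR_conv_of_real)
    then show ?thesis by (simp add: char_std_normal_distribution)
  qed
  then have h0: "has_bochner_integral lborel (\<lambda>x. std_normal_density x *\<^sub>R cis (u * x))
      (complex_of_real (exp (- u\<^sup>2 / 2)))" for u
    using i0[of u] by (simp add: has_bochner_integral_iff)
  have "has_bochner_integral lborel (\<lambda>x. std_normal_density (- p / W + (1 / W) * x) *\<^sub>R
          cis (W * t * (- p / W + (1 / W) * x)))
      (complex_of_real (exp (- (W * t)\<^sup>2 / 2)) /\<^sub>R \<bar>1 / W\<bar>)"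
    by (rule lborel_has_bochner_integral_real_affine_iff[THEN iffD1, OF _ h0]) (use W in auto)
  then have "has_bochner_integral lborel (\<lambda>x. complex_of_real (sqrt (2 * pi)) * cis (t * p) *
        (std_normal_density (- p / W + (1 / W) * x) *\<^sub>R cis (W * t * (- p / W + (1 / W) * x))))
      (complex_of_real (sqrt (2 * pi)) * cis (t * p) *
        (complex_of_real (exp (- (W * t)\<^sup>2 / 2)) /\<^sub>R \<bar>1 / W\<bar>))"
    by (intro has_bochner_integral_mult_right) auto
  also have "(\<lambda>x. complex_of_real (sqrt (2 * pi)) * cis (t * p) *
        (std_normal_density (- p / W + (1 / W) * x) *\<^sub>R cis (W * t * (- p / W + (1 / W) * x))))
     = (\<lambda>x. exp (- (x - p)\<^sup>2 / (2 * W\<^sup>2)) *\<^sub>R cis (t * x))"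
  proof
    fix x
    have e: "- p / W + (1 / W) * x = (x - p) / W" using W by (simp add: field_simps)
    have "cis (t * p) * cis (W * t * ((x - p) / W)) = cis (t * x)"
      using W by (simp add: cis_mult right_diff_distrib mult.commute)
    moreover have "sqrt (2 * pi) * std_normal_density ((x - p) / W) = exp (- (x - p)\<^sup>2 / (2 * W\<^sup>2))"
      by (simp add: normal_density_def power_divide mult.commute)
    ultimately show "complex_of_real (sqrt (2 * pi)) * cis (t * p) *
        (std_normal_density (- p / W + (1 / W) * x) *\<^sub>R cis (W * t * (- p / W + (1 / W) * x)))
        = exp (- (x - p)\<^sup>2 / (2 * W\<^sup>2)) *\<^sub>R cis (t * x)"
      unfolding e scaleR_conv_of_real by (metis of_real_mult mult.assoc mult.left_commute)
  qed
  finally show ?thesis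
    using W by (simp add: scaleR_conv_of_real power_mult_distrib mult_ac)
qed

lemma norm_sq_euclidean: "(norm (x :: 'a::euclidean_space))\<^sup>2 = (\<Sum>b\<in>Basis. (x \<bullet> b)\<^sup>2)"
  by (subst power2_norm_eq_inner, subst euclidean_inner) (simp add: power2_eq_square)

lemma cis_sum: "finite A \<Longrightarrow> cis (\<Sum>a\<in>A. f a) = (\<Prod>a\<in>A. cis (f a))"
  by (induction A rule: finite_induct) (auto simp: cis_mult[symmetric])

text \<open>Lebesgue measure on \<open>'a\<close> is the image of the product measure over
  \<open>Basis\<close>, so Fubini's theorem for finite products applies.\<close>

lemma has_bochner_integral_lborel_prod:
  fixes f :: "'a::euclidean_space \<Rightarrow> real \<Rightarrow> complex"
  assumes f: "\<And>b. b \<in> Basis \<Longrightarrow> has_bochner_integral lborel (f b) (c b)"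
  shows "has_bochner_integral lborel (\<lambda>x::'a. \<Prod>b\<in>Basis. f b (x \<bullet> b)) (\<Prod>b\<in>Basis. c b)"
proof -
  interpret product_sigma_finite "\<lambda>_::'a. lborel :: real measure" ..
  have m[measurable]: "f b \<in> borel_measurable borel" if "b \<in> Basis" for b
    using f[OF that] by (auto simp: has_bochner_integral_iff dest: borel_measurable_integrable)
  have i: "b \<in> Basis \<Longrightarrow> integrable lborel (f b)" for b
    using f by (auto simp: has_bochner_integral_iff)
  have "has_bochner_integral (\<Pi>\<^sub>M b\<in>(Basis::'a set). lborel) (\<lambda>x. \<Prod>b\<in>Basis. f b (x b)) (\<Prod>b\<in>Basis. c b)"
    unfolding has_bochner_integral_iff
    using product_integrable_prod[of "Basis::'a set" f] product_integral_prod[of "Basis::'a set" f] i f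
    by (auto simp: has_bochner_integral_iff intro!: prod.cong)
  also have "?this \<longleftrightarrow> has_bochner_integral (\<Pi>\<^sub>M b\<in>(Basis::'a set). lborel)
     (\<lambda>x. (\<lambda>x::'a. \<Prod>b\<in>Basis. f b (x \<bullet> b)) (\<Sum>b\<in>Basis. x b *\<^sub>R b)) (\<Prod>b\<in>Basis. c b)"
    by (intro has_bochner_integral_cong refl prod.cong) (auto simp: inner_sum_left inner_Basis if_distrib cong: if_cong)
  finally show ?thesis
    unfolding lborel_eq[where 'a='a]
    by (intro has_bochner_integral_distr) auto
qed

lemma has_bochner_integral_gauss_cis:
  fixes p v :: "'a::euclidean_space"
  assumes W: "W > 0"
  shows "has_bochner_integral lborel (\<lambda>x. complex_of_real (gauss W p x) * cis (v \<bullet> x))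
           (complex_of_real ((sqrt (2 * pi) * W) ^ DIM('a) * gauss (1 / W) 0 v) * cis (v \<bullet> p))"
proof -
  have "has_bochner_integral lborel
     (\<lambda>x::'a. \<Prod>b\<in>Basis. exp (- (x \<bullet> b - p \<bullet> b)\<^sup>2 / (2 * W\<^sup>2)) *\<^sub>R cis ((v \<bullet> b) * (x \<bullet> b)))
     (\<Prod>b\<in>Basis. complex_of_real (sqrt (2 * pi) * W * exp (- W\<^sup>2 * (v \<bullet> b)\<^sup>2 / 2)) * cis ((v \<bullet> b) * (p \<bullet> b)))"
    by (intro has_bochner_integral_lborel_prod has_bochner_integral_gauss_cis_real W)
  also have "(\<lambda>x::'a. \<Prod>b\<in>Basis. exp (- (x \<bullet> b - p \<bullet> b)\<^sup>2 / (2 * W\<^sup>2)) *\<^sub>R cis ((v \<bullet> b) * (x \<bullet> b)))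
      = (\<lambda>x. complex_of_real (gauss W p x) * cis (v \<bullet> x))"
  proof
    fix x :: 'a
    have "gauss W p x = (\<Prod>b\<in>Basis. exp (- (x \<bullet> b - p \<bullet> b)\<^sup>2 / (2 * W\<^sup>2)))"
      by (simp add: gauss_def norm_sq_euclidean exp_sum[symmetric] inner_diff_left sum_divide_distrib sum_negf)
    then show "(\<Prod>b\<in>Basis. exp (- (x \<bullet> b - p \<bullet> b)\<^sup>2 / (2 * W\<^sup>2)) *\<^sub>R cis ((v \<bullet> b) * (x \<bullet> b)))
       = complex_of_real (gauss W p x) * cis (v \<bullet> x)"
      by (simp add: scaleR_conv_of_real prod.distrib euclidean_inner[of v x] cis_sum)
  qed
  also have "(\<Prod>b\<in>Basis. complex_of_real (sqrt (2 * pi) * W * exp (- W\<^sup>2 * (v \<bullet> b)\<^sup>2 / 2)) * cis ((v \<bullet> b) * (p \<bullet> b)))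
     = complex_of_real ((sqrt (2 * pi) * W) ^ DIM('a) * gauss (1 / W) 0 v) * cis (v \<bullet> p)"
  proof -
    have "- (norm v)\<^sup>2 / (2 * (1 / W)\<^sup>2) = (\<Sum>b\<in>Basis. - W\<^sup>2 * (v \<bullet> b)\<^sup>2 / 2)"
      unfolding norm_sq_euclidean sum_divide_distrib[symmetric] sum_distrib_left[symmetric]
      using W by (simp add: field_simps)
    then have "gauss (1 / W) 0 v = (\<Prod>b\<in>Basis. exp (- W\<^sup>2 * (v \<bullet> b)\<^sup>2 / 2))"
      unfolding gauss_def by (simp add: exp_sum)
    then show ?thesis
      by (simp add: prod.distrib euclidean_inner[of v p] cis_sum mult.assoc power_mult_distrib)
  qed
  finally show ?thesis .
qed

lemma has_bochner_integral_gauss: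
  fixes p :: "'a::euclidean_space"
  assumes W: "W > 0"
  shows "has_bochner_integral lborel (gauss W p) ((sqrt (2 * pi) * W) ^ DIM('a))"
proof -
  have "has_bochner_integral lborel (\<lambda>x. complex_of_real (gauss W p x))
           (complex_of_real ((sqrt (2 * pi) * W) ^ DIM('a)))"
    using has_bochner_integral_gauss_cis[OF W, of p 0] by (simp add: gauss_def)
  then show ?thesis
    unfolding has_bochner_integral_iff
    by (metis complex_of_real_integrable_eq integral_complex_of_real of_real_eq_iff)
qed

lemma fourier_eq_lborel:
  assumes "f \<in> borel_measurable borel"
  shows "fourier f \<xi> = (LINT x|lborel. cis (- (\<xi> \<bullet> x)) * f x)"
  unfolding fourier_def
  by (subst integral_completion) (use assms in \<open>auto simp: cis_conv_exp\<close>)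

definition packet :: "real \<Rightarrow> 'a::euclidean_space \<Rightarrow> 'a \<Rightarrow> real \<Rightarrow> 'a \<Rightarrow> complex" where
  "packet W p v \<theta> x = complex_of_real (gauss W p x) * cis (v \<bullet> x + \<theta>)"

lemma borel_measurable_packet [measurable]: "packet W p v \<theta> \<in> borel_measurable borel"
  unfolding packet_def by measurable

text \<open>In frequency the packet is a Gaussian of width 1/W about \<open>v\<close>, and the
  position \<open>p\<close> reappears as the slope of its phase. A centre equal to a gradient
  therefore cancels the linear term of a Taylor expansion at \<open>v\<close>.\<close>

lemma has_bochner_integral_packet_fourier:
  fixes p v :: "'a::euclidean_space"
  assumes W: "W > 0"
  shows "has_bochner_integral lborel (\<lambda>x. cis (- (\<xi> \<bullet> x)) * packet W p v \<theta> x)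
     (complex_of_real ((sqrt (2 * pi) * W) ^ DIM('a) * gauss (1 / W) v \<xi>) * cis (\<theta> - (\<xi> - v) \<bullet> p))"
proof -
  have "has_bochner_integral lborel (\<lambda>x. cis \<theta> * (complex_of_real (gauss W p x) * cis ((v - \<xi>) \<bullet> x)))
     (cis \<theta> * (complex_of_real ((sqrt (2 * pi) * W) ^ DIM('a) * gauss (1 / W) 0 (v - \<xi>)) * cis ((v - \<xi>) \<bullet> p)))"
    by (intro has_bochner_integral_mult_right has_bochner_integral_gauss_cis[OF W])
  also have "(\<lambda>x. cis \<theta> * (complex_of_real (gauss W p x) * cis ((v - \<xi>) \<bullet> x))) = (\<lambda>x. cis (- (\<xi> \<bullet> x)) * packet W p v \<theta> x)"
  proof
    fix x
    have "cis \<theta> * cis ((v - \<xi>) \<bullet> x) = cis (- (\<xi> \<bullet> x)) * cis (v \<bullet> x + \<theta>)"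
      by (simp add: cis_mult inner_diff_left algebra_simps)
    then show "cis \<theta> * (complex_of_real (gauss W p x) * cis ((v - \<xi>) \<bullet> x)) = cis (- (\<xi> \<bullet> x)) * packet W p v \<theta> x"
      unfolding packet_def by (metis mult.left_commute)
  qed
  also have "cis \<theta> * (complex_of_real ((sqrt (2 * pi) * W) ^ DIM('a) * gauss (1 / W) 0 (v - \<xi>)) * cis ((v - \<xi>) \<bullet> p))
     = complex_of_real ((sqrt (2 * pi) * W) ^ DIM('a) * gauss (1 / W) v \<xi>) * cis (\<theta> - (\<xi> - v) \<bullet> p)"
  proof -
    have "cis \<theta> * cis ((v - \<xi>) \<bullet> p) = cis (\<theta> - (\<xi> - v) \<bullet> p)"
      by (simp add: cis_mult inner_diff_left algebra_simps)
    moreover have "gauss (1 / W) 0 (v - \<xi>) = gauss (1 / W) v \<xi>"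
      by (simp add: gauss_def norm_minus_commute)
    ultimately show ?thesis by (metis mult.left_commute)
  qed
  finally show ?thesis .
qed

section \<open>Schwartz functions and symbols\<close>

lemma partial_deriv_eqI:
  assumes "\<And>x. (f has_derivative D x) (at x)"
  shows "partial_deriv b f = (\<lambda>x. D x b)"
  unfolding partial_deriv_def using frechet_derivative_at[OF assms] by metis

lemma partial_deriv_has_derivative:
  assumes "\<And>x. f differentiable (at x)"
  shows "(f has_derivative (\<lambda>b. partial_deriv b f x)) (at x)"
  using assms frechet_derivative_works unfolding partial_deriv_def by blast

text \<open>A class that contains the packets and is closed under differentiation: membership in the
  Schwartz space then needs only one decay estimate for the class, and no formula for iterated
  derivatives.\<close>

inductive gauss_poly :: "('a::euclidean_space \<Rightarrow> complex) \<Rightarrow> bool" where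
  packet: "W > 0 \<Longrightarrow> gauss_poly (packet W p v \<theta>)"
| coord: "gauss_poly f \<Longrightarrow> gauss_poly (\<lambda>x. complex_of_real (x \<bullet> b) * f x)"
| cmult: "gauss_poly f \<Longrightarrow> gauss_poly (\<lambda>x. c * f x)"
| add: "gauss_poly f \<Longrightarrow> gauss_poly g \<Longrightarrow> gauss_poly (\<lambda>x. f x + g x)"

lemma packet_has_derivative:
  "(packet W p v \<theta> has_derivative (\<lambda>h. (complex_of_real (- ((x - p) \<bullet> h) / W\<^sup>2) + \<i> * complex_of_real (v \<bullet> h))
       * packet W p v \<theta> x)) (at x)"
proof -
  define E where "E = (\<lambda>x. complex_of_real (- ((x - p) \<bullet> (x - p)) / (2 * W\<^sup>2)) + \<i> * complex_of_real (v \<bullet> x + \<theta>))"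
  have pk: "packet W p v \<theta> = (\<lambda>x. exp (E x))"
    by (auto simp: fun_eq_iff packet_def gauss_def cis_conv_exp power2_norm_eq_inner E_def exp_of_real[symmetric] mult_exp_exp algebra_simps)
  have "((\<lambda>x. (x - p) \<bullet> (x - p)) has_derivative (\<lambda>h. 2 * ((x - p) \<bullet> h))) (at x)"
    by (auto intro!: derivative_eq_intros simp: inner_commute)
  then have "((\<lambda>x. (- 1 / (2 * W\<^sup>2)) * ((x - p) \<bullet> (x - p))) has_derivative
      (\<lambda>h. (- 1 / (2 * W\<^sup>2)) * (2 * ((x - p) \<bullet> h)))) (at x)"
    by (rule has_derivative_mult_right)
  then have "((\<lambda>x. - ((x - p) \<bullet> (x - p)) / (2 * W\<^sup>2)) has_derivative (\<lambda>h. - ((x - p) \<bullet> h) / W\<^sup>2)) (at x)"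
    by simp
  moreover have "((\<lambda>x. v \<bullet> x + \<theta>) has_derivative (\<lambda>h. v \<bullet> h)) (at x)"
    by (auto intro!: derivative_eq_intros)
  ultimately have E: "(E has_derivative (\<lambda>h. complex_of_real (- ((x - p) \<bullet> h) / W\<^sup>2) + \<i> * complex_of_real (v \<bullet> h))) (at x)"
    unfolding E_def
    by (intro has_derivative_add has_derivative_mult_right has_derivative_of_real)
  show ?thesis unfolding pk
    by (rule has_derivative_eq_rhs[OF has_derivative_compose[OF E DERIV_exp[unfolded has_field_derivative_def]]])
       (simp add: fun_eq_iff mult.commute)
qed

lemma gauss_poly_deriv:
  assumes "gauss_poly f"
  shows "(\<forall>x. f differentiable (at x)) \<and> (\<forall>b. gauss_poly (partial_deriv b f))"
  using assms
proof induction
  case (packet W p v \<theta>)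
  have "gauss_poly (partial_deriv b (packet W p v \<theta>))" for b
  proof -
    have "partial_deriv b (packet W p v \<theta>) = (\<lambda>x. complex_of_real (- 1 / W\<^sup>2) * (complex_of_real (x \<bullet> b) * packet W p v \<theta> x)
        + (complex_of_real (p \<bullet> b / W\<^sup>2) + \<i> * complex_of_real (v \<bullet> b)) * packet W p v \<theta> x)"
    proof
      fix x
      have "- ((x - p) \<bullet> b) / W\<^sup>2 = (- 1 / W\<^sup>2) * (x \<bullet> b) + p \<bullet> b / W\<^sup>2"
        by (simp add: inner_diff_left diff_divide_distrib)
      then have "complex_of_real (- ((x - p) \<bullet> b) / W\<^sup>2)
          = complex_of_real (- 1 / W\<^sup>2) * complex_of_real (x \<bullet> b) + complex_of_real (p \<bullet> b / W\<^sup>2)"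
        by (simp only: of_real_add of_real_mult)
      then show "partial_deriv b (packet W p v \<theta>) x = complex_of_real (- 1 / W\<^sup>2) * (complex_of_real (x \<bullet> b) * packet W p v \<theta> x)
        + (complex_of_real (p \<bullet> b / W\<^sup>2) + \<i> * complex_of_real (v \<bullet> b)) * packet W p v \<theta> x"
        unfolding partial_deriv_eqI[OF packet_has_derivative] by (simp only: ring_distribs mult.assoc add.assoc)
    qed
    then show ?thesis
      using packet by (simp only:) (intro gauss_poly.intros)
  qed
  then show ?case using packet_has_derivative differentiableI by blast
next
  case (coord f b)
  have "((\<lambda>x. complex_of_real (x \<bullet> b) * f x) has_derivative
     (\<lambda>h. complex_of_real (h \<bullet> b) * f x + complex_of_real (x \<bullet> b) * partial_deriv h f x)) (at x)" for x
    using partial_deriv_has_derivative[of f x] coord.IH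
    by (auto intro!: derivative_eq_intros simp: fun_eq_iff)
  note d = this
  have "gauss_poly (partial_deriv h (\<lambda>x. complex_of_real (x \<bullet> b) * f x))" for h
    unfolding partial_deriv_eqI[OF d] using coord by (intro gauss_poly.intros) auto
  then show ?case using d differentiableI by blast
next
  case (cmult f c)
  have "((\<lambda>x. c * f x) has_derivative (\<lambda>h. c * partial_deriv h f x)) (at x)" for x
    using partial_deriv_has_derivative[of f x] cmult.IH
    by (auto intro!: derivative_eq_intros simp: fun_eq_iff)
  note d = this
  have "gauss_poly (partial_deriv h (\<lambda>x. c * f x))" for h
    unfolding partial_deriv_eqI[OF d] using cmult by (intro gauss_poly.intros) auto
  then show ?case using d differentiableI by blast
next
  case (add f g)
  have "((\<lambda>x. f x + g x) has_derivative (\<lambda>h. partial_deriv h f x + partial_deriv h g x)) (at x)" for x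
    using partial_deriv_has_derivative[of f x] partial_deriv_has_derivative[of g x] add.IH
    by (auto intro!: derivative_eq_intros simp: fun_eq_iff)
  note d = this
  have "gauss_poly (partial_deriv h (\<lambda>x. f x + g x))" for h
    unfolding partial_deriv_eqI[OF d] using add by (intro gauss_poly.intros) auto
  then show ?case using d differentiableI by blast
qed

lemma power_le_fact_exp: "x \<ge> 0 \<Longrightarrow> x ^ k \<le> fact k * exp (x :: real)"
proof -
  assume x: "x \<ge> 0"
  have "(\<Sum>n\<in>{k}. x ^ n /\<^sub>R fact n) \<le> (\<Sum>n. x ^ n /\<^sub>R fact n)"
    using x by (intro sum_le_suminf summable_exp_generic) auto
  then have "x ^ k / fact k \<le> exp x" unfolding exp_def by (simp add: field_simps)
  then show "x ^ k \<le> fact k * exp x" by (simp add: field_simps)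
qed

text \<open>The polynomial factor is dominated by a multiple of exp (1 + |x|), and completing the
  square shows that the Gaussian beats this linear growth: t - t^2 / (2 W^2) \<le> W^2 / 2.\<close>

lemma packet_decay:
  fixes p :: "'a::euclidean_space"
  assumes W: "W > 0"
  shows "(1 + norm x) ^ k * norm (packet W p v \<theta> x) \<le> fact k * exp (1 + norm p + W\<^sup>2 / 2)"
proof -
  define t where "t = norm (x - p)"
  have "t - t\<^sup>2 / (2 * W\<^sup>2) \<le> W\<^sup>2 / 2"
  proof -
    have "0 \<le> (t - W\<^sup>2)\<^sup>2 / (2 * W\<^sup>2)" by simp
    also have "\<dots> = t\<^sup>2 / (2 * W\<^sup>2) - t + W\<^sup>2 / 2"
      using W by (simp add: power2_eq_square field_simps)
    finally show ?thesis by simp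
  qed
  moreover have "norm x \<le> norm p + t" unfolding t_def using norm_triangle_sub[of x p] by simp
  ultimately have e: "1 + norm x + - t\<^sup>2 / (2 * W\<^sup>2) \<le> 1 + norm p + W\<^sup>2 / 2" by simp
  have "(1 + norm x) ^ k * norm (packet W p v \<theta> x) = (1 + norm x) ^ k * exp (- t\<^sup>2 / (2 * W\<^sup>2))"
    by (simp add: packet_def gauss_def norm_mult t_def)
  also have "\<dots> \<le> (fact k * exp (1 + norm x)) * exp (- t\<^sup>2 / (2 * W\<^sup>2))"
    by (intro mult_right_mono power_le_fact_exp) auto
  also have "\<dots> = fact k * exp (1 + norm x + - t\<^sup>2 / (2 * W\<^sup>2))" by (simp only: exp_add mult.assoc)
  also have "\<dots> \<le> fact k * exp (1 + norm p + W\<^sup>2 / 2)"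
    using e by (intro mult_left_mono) auto
  finally show ?thesis .
qed

lemma gauss_poly_decay:
  assumes "gauss_poly f"
  shows "\<exists>C. \<forall>x. (1 + norm x) ^ k * norm (f x) \<le> C"
  using assms
proof (induction arbitrary: k)
  case (packet W p v \<theta>)
  then show ?case using packet_decay by blast
next
  case (coord f b)
  obtain C where C: "\<And>x. (1 + norm x) ^ Suc k * norm (f x) \<le> C" using coord.IH by blast
  have "(1 + norm x) ^ k * norm (complex_of_real (x \<bullet> b) * f x) \<le> norm b * C" for x
  proof -
    have "\<bar>x \<bullet> b\<bar> \<le> norm b * (1 + norm x)"
      using Cauchy_Schwarz_ineq2[of x b] by (simp add: algebra_simps) (metis add_increasing norm_ge_zero mult.commute)
    then have "(1 + norm x) ^ k * norm (complex_of_real (x \<bullet> b) * f x) \<le> (1 + norm x) ^ k * ((norm b * (1 + norm x)) * norm (f x))"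
      by (auto simp: norm_mult intro!: mult_left_mono mult_right_mono)
    also have "\<dots> = norm b * ((1 + norm x) ^ Suc k * norm (f x))" by simp
    also have "\<dots> \<le> norm b * C" using C by (intro mult_left_mono) auto
    finally show ?thesis .
  qed
  then show ?case by blast
next
  case (cmult f c)
  obtain C where C: "\<And>x. (1 + norm x) ^ k * norm (f x) \<le> C" using cmult.IH by blast
  have "(1 + norm x) ^ k * norm (c * f x) \<le> norm c * C" for x
    using mult_left_mono[OF C[of x], of "norm c"] by (simp add: norm_mult algebra_simps)
  then show ?case by blast
next
  case (add f g)
  obtain C where C: "\<And>x. (1 + norm x) ^ k * norm (f x) \<le> C" using add.IH by blast
  obtain D where D: "\<And>x. (1 + norm x) ^ k * norm (g x) \<le> D" using add.IH by blast
  have "(1 + norm x) ^ k * norm (f x + g x) \<le> C + D" for x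
  proof -
    have "(1 + norm x) ^ k * norm (f x + g x) \<le> (1 + norm x) ^ k * (norm (f x) + norm (g x))"
      by (intro mult_left_mono norm_triangle_ineq) auto
    then show ?thesis using C[of x] D[of x] by (simp add: algebra_simps)
  qed
  then show ?case by blast
qed

lemma gauss_poly_schwartz:
  assumes "gauss_poly f" shows "f \<in> schwartz"
proof -
  have "gauss_poly (iter_partial bs f)" for bs
    using assms by (induction bs) (auto simp: gauss_poly_deriv)
  then show ?thesis
    unfolding schwartz_def smooth_def using gauss_poly_deriv gauss_poly_decay by blast
qed

lemma gauss_poly_sum:
  assumes "finite I" "I \<noteq> {}" "\<And>i. i \<in> I \<Longrightarrow> gauss_poly (f i)"
  shows "gauss_poly (\<lambda>x. \<Sum>i\<in>I. f i x)"
  using assms by (induction rule: finite_ne_induct) (auto intro: gauss_poly.add)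

text \<open>The index is the order. Differentiating the bracket of order d gives a coordinate times
  the bracket of order d - 2, hence order d - 1; the grading makes every derivative lower the order
  by one, as a symbol estimate demands.\<close>

inductive sym_poly :: "real \<Rightarrow> ('a::euclidean_space \<Rightarrow> complex) \<Rightarrow> bool" where
  bracket: "sym_poly d (\<lambda>x. complex_of_real ((1 + (norm x)\<^sup>2) powr (d / 2)))"
| coord: "sym_poly d f \<Longrightarrow> sym_poly (d + 1) (\<lambda>x. complex_of_real (x \<bullet> b) * f x)"
| cmult: "sym_poly d f \<Longrightarrow> sym_poly d (\<lambda>x. c * f x)"
| add: "sym_poly d f \<Longrightarrow> sym_poly d g \<Longrightarrow> sym_poly d (\<lambda>x. f x + g x)"

lemma sym_poly_deriv:
  assumes "sym_poly d f"
  shows "(\<forall>x. f differentiable (at x)) \<and> (\<forall>b. sym_poly (d - 1) (partial_deriv b f))"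
  using assms
proof induction
  case (bracket d)
  have pos: "1 + x \<bullet> x > 0" for x :: 'a by (simp add: add_pos_nonneg)
  have "((\<lambda>x. complex_of_real ((1 + x \<bullet> x) powr (d / 2))) has_derivative
     (\<lambda>h. complex_of_real d * (complex_of_real (x \<bullet> h) * complex_of_real ((1 + x \<bullet> x) powr ((d - 2) / 2))))) (at x)" for x :: 'a
    using pos[of x]
    by (auto intro!: derivative_eq_intros simp: fun_eq_iff inner_commute powr_diff powr_add field_simps)
      (simp add: diff_divide_distrib powr_diff)
  note d = this[folded power2_norm_eq_inner]
  have "sym_poly (d - 2 + 1) (\<lambda>x. complex_of_real (x \<bullet> h) * complex_of_real ((1 + (norm x)\<^sup>2) powr ((d - 2) / 2)))" for h :: 'a
    by (intro sym_poly.intros)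
  then have "sym_poly (d - 1) (\<lambda>x. complex_of_real (x \<bullet> h) * complex_of_real ((1 + (norm x)\<^sup>2) powr ((d - 2) / 2)))" for h :: 'a
    by simp
  then have "sym_poly (d - 1) (partial_deriv h (\<lambda>x. complex_of_real ((1 + (norm x)\<^sup>2) powr (d / 2))))" for h :: 'a
    unfolding partial_deriv_eqI[OF d] by (intro sym_poly.cmult)
  then show ?case using d differentiableI by blast
next
  case (coord d f b)
  have "((\<lambda>x. complex_of_real (x \<bullet> b) * f x) has_derivative
     (\<lambda>h. complex_of_real (h \<bullet> b) * f x + complex_of_real (x \<bullet> b) * partial_deriv h f x)) (at x)" for x
    using partial_deriv_has_derivative[of f x] coord.IH
    by (auto intro!: derivative_eq_intros simp: fun_eq_iff)
  note d = this
  have "sym_poly (d - 1 + 1) (\<lambda>x. complex_of_real (x \<bullet> b) * partial_deriv h f x)" for h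
    using coord by (intro sym_poly.intros) auto
  then have "sym_poly d (\<lambda>x. complex_of_real (x \<bullet> b) * partial_deriv h f x)" for h
    by simp
  then have "sym_poly d (partial_deriv h (\<lambda>x. complex_of_real (x \<bullet> b) * f x))" for h
    unfolding partial_deriv_eqI[OF d] using coord by (intro sym_poly.add sym_poly.cmult) auto
  then show ?case using d differentiableI by force
next
  case (cmult d f c)
  have "((\<lambda>x. c * f x) has_derivative (\<lambda>h. c * partial_deriv h f x)) (at x)" for x
    using partial_deriv_has_derivative[of f x] cmult.IH
    by (auto intro!: derivative_eq_intros simp: fun_eq_iff)
  note d = this
  have "sym_poly (d - 1) (partial_deriv h (\<lambda>x. c * f x))" for h
    unfolding partial_deriv_eqI[OF d] using cmult by (intro sym_poly.intros) auto
  then show ?case using d differentiableI by blast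
next
  case (add d f g)
  have "((\<lambda>x. f x + g x) has_derivative (\<lambda>h. partial_deriv h f x + partial_deriv h g x)) (at x)" for x
    using partial_deriv_has_derivative[of f x] partial_deriv_has_derivative[of g x] add.IH
    by (auto intro!: derivative_eq_intros simp: fun_eq_iff)
  note d = this
  have "sym_poly (d - 1) (partial_deriv h (\<lambda>x. f x + g x))" for h
    unfolding partial_deriv_eqI[OF d] using add by (intro sym_poly.intros) auto
  then show ?case using d differentiableI by blast
qed

text \<open>Up to a factor 2 the two brackets agree: ((1 + r) / 2)^2 \<le> 1 + r^2 \<le> (1 + r)^2.
  The right inequality serves d \<ge> 0, the left one d < 0.\<close>

lemma bracket_bound:
  fixes x :: "'a::real_normed_vector"
  shows "(1 + (norm x)\<^sup>2) powr (d / 2) \<le> 2 powr \<bar>d\<bar> * (1 + norm x) powr d"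
proof (cases "d \<ge> 0")
  case True
  have "1 + (norm x)\<^sup>2 \<le> (1 + norm x)\<^sup>2" by (simp add: power2_sum)
  then have "(1 + (norm x)\<^sup>2) powr (d / 2) \<le> ((1 + norm x)\<^sup>2) powr (d / 2)"
    using True by (intro powr_mono2) (auto simp: add_nonneg_nonneg)
  also have "\<dots> = 1 * (1 + norm x) powr d"
    by (simp add: powr_powr flip: powr_numeral)
  also have "\<dots> \<le> 2 powr \<bar>d\<bar> * (1 + norm x) powr d"
    by (intro mult_right_mono) (auto simp: ge_one_powr_ge_zero)
  finally show ?thesis .
next
  case False
  have p: "0 < 1 + norm x" using norm_ge_zero[of x] by linarith
  have "0 \<le> (1 - norm x)\<^sup>2" by simp
  moreover have "((1 + norm x) / 2)\<^sup>2 = 1 + (norm x)\<^sup>2 - (2 + 2 * (norm x)\<^sup>2 + (1 - norm x)\<^sup>2) / 4"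
    by (simp add: power2_eq_square field_simps)
  ultimately have "((1 + norm x) / 2)\<^sup>2 \<le> 1 + (norm x)\<^sup>2"
    using zero_le_power2[of "norm x"] by (simp add: divide_nonneg_nonneg)
  then have "(1 + (norm x)\<^sup>2) powr (d / 2) \<le> (((1 + norm x) / 2)\<^sup>2) powr (d / 2)"
    using False p by (intro powr_mono2') auto
  also have "\<dots> = ((1 + norm x) / 2) powr d"
    by (simp add: powr_powr flip: powr_numeral)
  also have "\<dots> \<le> 2 powr \<bar>d\<bar> * (1 + norm x) powr d"
  proof -
    have "((1 + norm x) / 2) powr d = (1 + norm x) powr d / 2 powr d" by (simp add: powr_divide add_nonneg_nonneg)
    moreover have "2 powr \<bar>d\<bar> = 1 / 2 powr d" using False by (simp add: powr_minus_divide)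
    ultimately show ?thesis by simp
  qed
  finally show ?thesis .
qed

lemma sym_poly_bound:
  assumes "sym_poly d f"
  shows "\<exists>C. \<forall>x. norm (f x) \<le> C * (1 + norm x) powr d"
  using assms
proof induction
  case (bracket d)
  then show ?case using bracket_bound by (metis abs_of_nonneg norm_of_real powr_ge_zero)
next
  case (coord d f b)
  obtain C where C: "\<And>x. norm (f x) \<le> C * (1 + norm x) powr d" using coord.IH by blast
  have "norm (complex_of_real (x \<bullet> b) * f x) \<le> (norm b * C) * (1 + norm x) powr (d + 1)" for x
  proof -
    have "\<bar>x \<bullet> b\<bar> \<le> norm b * (1 + norm x)"
      using Cauchy_Schwarz_ineq2[of x b] by (simp add: algebra_simps) (metis add_increasing norm_ge_zero mult.commute)
    then have "norm (complex_of_real (x \<bullet> b) * f x) \<le> (norm b * (1 + norm x)) * (C * (1 + norm x) powr d)"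
      using C[of x] by (auto simp: norm_mult intro!: mult_mono)
    also have "\<dots> = (norm b * C) * (1 + norm x) powr (d + 1)"
      by (simp add: powr_add add_nonneg_nonneg)
    finally show ?thesis .
  qed
  then show ?case by blast
next
  case (cmult d f c)
  obtain C where C: "\<And>x. norm (f x) \<le> C * (1 + norm x) powr d" using cmult.IH by blast
  have "norm (c * f x) \<le> (norm c * C) * (1 + norm x) powr d" for x
    using mult_left_mono[OF C[of x], of "norm c"] by (simp add: norm_mult algebra_simps)
  then show ?case by blast
next
  case (add d f g)
  obtain C where C: "\<And>x. norm (f x) \<le> C * (1 + norm x) powr d" using add.IH by blast
  obtain D where D: "\<And>x. norm (g x) \<le> D * (1 + norm x) powr d" using add.IH by blast
  have "norm (f x + g x) \<le> (C + D) * (1 + norm x) powr d" for x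
    using C[of x] D[of x] norm_triangle_ineq[of "f x" "g x"] by (simp add: algebra_simps)
  then show ?case by blast
qed

lemma bracket_symbol_class:
  "(\<lambda>x::'a::euclidean_space. complex_of_real ((1 + (norm x)\<^sup>2) powr (d / 2))) \<in> symbol_class d" (is "?f \<in> _")
proof -
  have s: "sym_poly (d - real (length bs)) (iter_partial bs ?f)" for bs
  proof (induction bs)
    case Nil
    show ?case using sym_poly.bracket[of d] by simp
  next
    case (Cons b bs)
    have "sym_poly (d - real (length bs) - 1) (partial_deriv b (iter_partial bs ?f))"
      using sym_poly_deriv[OF Cons.IH] by blast
    then show ?case by (simp add: algebra_simps)
  qed
  show ?thesis
    unfolding symbol_class_def smooth_def using sym_poly_deriv[OF s] sym_poly_bound[OF s] by blast
qed

section \<open>Consequences of a bound on the bmo norm\<close>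

lemma bmo_normD:
  fixes h :: "'a::euclidean_space \<Rightarrow> complex"
  assumes "bmo_norm h \<le> ennreal B"
  shows "h \<in> borel_measurable lebesgue"
    and "\<And>Q. Q \<in> cubes \<Longrightarrow> measure lebesgue Q \<le> 1 \<Longrightarrow>
           (\<integral>\<^sup>+x\<in>Q. ennreal (norm (h x - avg Q h)) \<partial>lebesgue) / emeasure lebesgue Q \<le> ennreal B"
    and "\<And>Q. Q \<in> cubes \<Longrightarrow> measure lebesgue Q \<ge> 1 \<Longrightarrow>
           (\<integral>\<^sup>+x\<in>Q. ennreal (norm (h x)) \<partial>lebesgue) / emeasure lebesgue Q \<le> ennreal B"
proof -
  show m: "h \<in> borel_measurable lebesgue"
    using assms unfolding bmo_norm_def by (auto simp: top_unique split: if_splits)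
  have le: "(SUP Q \<in> {Q \<in> cubes. measure lebesgue Q \<le> 1}.
           (\<integral>\<^sup>+x\<in>Q. ennreal (norm (h x - avg Q h)) \<partial>lebesgue) / emeasure lebesgue Q) \<le> ennreal B"
    "(SUP Q \<in> {Q \<in> cubes. measure lebesgue Q \<ge> 1}.
           (\<integral>\<^sup>+x\<in>Q. ennreal (norm (h x)) \<partial>lebesgue) / emeasure lebesgue Q) \<le> ennreal B"
    using assms m unfolding bmo_norm_def by (auto intro: order_trans[rotated])
  show "\<And>Q. Q \<in> cubes \<Longrightarrow> measure lebesgue Q \<le> 1 \<Longrightarrow>
           (\<integral>\<^sup>+x\<in>Q. ennreal (norm (h x - avg Q h)) \<partial>lebesgue) / emeasure lebesgue Q \<le> ennreal B"
    using le(1) by (auto simp: SUP_le_iff)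
  show "\<And>Q. Q \<in> cubes \<Longrightarrow> measure lebesgue Q \<ge> 1 \<Longrightarrow>
           (\<integral>\<^sup>+x\<in>Q. ennreal (norm (h x)) \<partial>lebesgue) / emeasure lebesgue Q \<le> ennreal B"
    using le(2) by (auto simp: SUP_le_iff)
qed

lemma measure_cube:
  assumes "l \<ge> 0"
  shows "measure lebesgue (cbox (a::'a::euclidean_space) (a + l *\<^sub>R One)) = l ^ DIM('a)"
    and "emeasure lebesgue (cbox (a::'a::euclidean_space) (a + l *\<^sub>R One)) = ennreal (l ^ DIM('a))"
proof -
  have e: "emeasure lborel (cbox a (a + l *\<^sub>R One)) = ennreal (l ^ DIM('a))"
    by (subst emeasure_lborel_cbox) (use assms in \<open>auto simp: inner_add_left\<close>)
  then show "emeasure lebesgue (cbox a (a + l *\<^sub>R One)) = ennreal (l ^ DIM('a))"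
    by simp
  then show "measure lebesgue (cbox a (a + l *\<^sub>R One)) = l ^ DIM('a)"
    using assms unfolding measure_def by simp
qed

lemma ennreal_divide_leD:
  assumes "x / ennreal c \<le> ennreal B" "c > 0" "B \<ge> 0"
  shows "x \<le> ennreal (B * c)"
proof -
  have "x = x / ennreal c * ennreal c"
    using assms by (simp add: ennreal_divide_times ennreal_times_divide mult_divide_eq_ennreal)
  also have "\<dots> \<le> ennreal B * ennreal c" using assms by (intro mult_right_mono) auto
  finally show ?thesis using assms by (simp add: ennreal_mult)
qed

lemma bmo_norm_large_cube:
  fixes h :: "'a::euclidean_space \<Rightarrow> complex"
  assumes "bmo_norm h \<le> ennreal B" "B \<ge> 0" "l \<ge> 1"
  shows "(\<integral>\<^sup>+x\<in>cbox a (a + l *\<^sub>R One). ennreal (norm (h x)) \<partial>lebesgue) \<le> ennreal (B * l ^ DIM('a))"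
proof -
  have "cbox a (a + l *\<^sub>R One) \<in> cubes" using assms by (force simp: cubes_def)
  moreover have "measure lebesgue (cbox a (a + l *\<^sub>R One)) \<ge> 1"
    using assms by (subst measure_cube(1)) (auto simp: one_le_power)
  ultimately have "(\<integral>\<^sup>+x\<in>cbox a (a + l *\<^sub>R One). ennreal (norm (h x)) \<partial>lebesgue) /
      emeasure lebesgue (cbox a (a + l *\<^sub>R One)) \<le> ennreal B"
    using bmo_normD(3)[OF assms(1)] by blast
  then show ?thesis
    using assms by (subst (asm) measure_cube) (auto intro!: ennreal_divide_leD)
qed

lemma bmo_norm_small_cube:
  fixes h :: "'a::euclidean_space \<Rightarrow> complex" and a :: 'a
  assumes "bmo_norm h \<le> ennreal B" "B \<ge> 0" "0 < l" "l \<le> 1"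
  defines "Q \<equiv> cbox a (a + l *\<^sub>R One)"
  shows "(\<integral>\<^sup>+x\<in>Q. ennreal (norm (h x - avg Q h)) \<partial>lebesgue) \<le> ennreal (B * l ^ DIM('a))"
proof -
  have "Q \<in> cubes" using assms by (force simp: cubes_def)
  moreover have "measure lebesgue Q \<le> 1"
    using assms unfolding Q_def by (subst measure_cube(1)) (auto simp: power_le_one)
  ultimately have "(\<integral>\<^sup>+x\<in>Q. ennreal (norm (h x - avg Q h)) \<partial>lebesgue) / emeasure lebesgue Q \<le> ennreal B"
    using bmo_normD(2)[OF assms(1)] by blast
  moreover have "emeasure lebesgue Q = ennreal (l ^ DIM('a))"
    using assms unfolding Q_def by (subst measure_cube(2)) auto
  ultimately show ?thesis
    using assms by (auto intro!: ennreal_divide_leD)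
qed

text \<open>The triangle inequality for the integral. \<open>c\<close> is arbitrary because of two
  uses: 0 on the unit cube, and the average over the next larger cube in the telescoping.\<close>

lemma norm_avg_diff_le:
  fixes h :: "'a::euclidean_space \<Rightarrow> complex"
  assumes h: "set_integrable lebesgue (cbox a (a + l *\<^sub>R One)) h" and l: "l > 0"
    and D: "(\<integral>\<^sup>+x\<in>cbox a (a + l *\<^sub>R One). ennreal (norm (h x - c)) \<partial>lebesgue) \<le> ennreal (D * l ^ DIM('a))"
    and "D \<ge> 0"
  shows "norm (avg (cbox a (a + l *\<^sub>R One)) h - c) \<le> D"
proof -
  define Q where "Q = cbox a (a + l *\<^sub>R One)"
  define M where "M = l ^ DIM('a)"
  have M: "M > 0" using l by (simp add: M_def)
  have Q: "Q \<in> sets lebesgue" "emeasure lebesgue Q < \<infinity>" "measure lebesgue Q = M"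
    using l measure_cube[of l a] unfolding Q_def M_def by auto
  have ic: "set_integrable lebesgue Q (\<lambda>x. c)"
    using Q by (simp add: set_integrable_def)
  have i: "set_integrable lebesgue Q (\<lambda>x. h x - c)"
    by (intro set_integral_diff ic h[folded Q_def])
  have "(LINT x:Q|lebesgue. h x - c) = (LINT x:Q|lebesgue. h x) - M *\<^sub>R c"
    using h ic Q by (simp add: set_integral_diff Q_def[symmetric] set_integral_const)
  then have "avg Q h - c = (LINT x:Q|lebesgue. h x - c) /\<^sub>R M"
    using M by (simp add: avg_def Q scaleR_diff_right)
  moreover have "norm (LINT x:Q|lebesgue. h x - c) \<le> D * M"
  proof -
    have "ennreal (norm (LINT x:Q|lebesgue. h x - c)) \<le> (\<integral>\<^sup>+x. norm (indicator Q x *\<^sub>R (h x - c)) \<partial>lebesgue)"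
      unfolding set_lebesgue_integral_def
      by (intro integral_norm_bound_ennreal) (use i in \<open>auto simp: set_integrable_def\<close>)
    also have "\<dots> = (\<integral>\<^sup>+x\<in>Q. ennreal (norm (h x - c)) \<partial>lebesgue)"
      by (intro nn_integral_cong) (auto split: split_indicator)
    also have "\<dots> \<le> ennreal (D * M)" using D by (simp add: Q_def M_def)
    finally show ?thesis using M \<open>D \<ge> 0\<close> by simp
  qed
  ultimately show ?thesis using M by (simp add: Q_def field_simps)
qed

text \<open>Telescoping over the dyadic cubes with corner \<open>0\<close>, up to the unit cube.\<close>

lemma bmo_norm_dyadic_avg:
  fixes h :: "'a::euclidean_space \<Rightarrow> complex"
  assumes h: "bmo_norm h \<le> ennreal B" and B: "B \<ge> 0"
  shows "norm (avg (cbox 0 ((1 / 2 ^ N) *\<^sub>R One)) h) \<le> (1 + 2 ^ DIM('a) * real N) * B"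
proof -
  define Q :: "nat \<Rightarrow> 'a set" where "Q j = cbox 0 ((1 / 2 ^ j) *\<^sub>R One)" for j
  note [measurable] = bmo_normD(1)[OF h]
  have mQ [measurable]: "Q j \<in> sets lebesgue" for j by (simp add: Q_def)
  have sub: "Q (Suc j) \<subseteq> Q j" for j
    unfolding Q_def by (intro subset_box_imp) (auto simp: field_simps)
  have "Q j \<subseteq> Q 0" for j by (induction j) (use sub in blast)+
  have f0: "(\<integral>\<^sup>+x\<in>Q 0. ennreal (norm (h x)) \<partial>lebesgue) \<le> ennreal B"
    using bmo_norm_large_cube[OF h B, of 1 0] by (simp add: Q_def)
  have int: "set_integrable lebesgue (Q j) h" for j
  proof -
    have "(\<integral>\<^sup>+x. norm (indicator (Q j) x *\<^sub>R h x) \<partial>lebesgue) \<le> (\<integral>\<^sup>+x\<in>Q 0. ennreal (norm (h x)) \<partial>lebesgue)"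
      using \<open>Q j \<subseteq> Q 0\<close> by (intro nn_integral_mono) (auto split: split_indicator)
    also have "\<dots> < \<infinity>" using f0 by (simp add: ennreal_less_top le_less_trans top.not_eq_extremum)
    finally show ?thesis
      unfolding set_integrable_def by (intro integrableI_bounded) auto
  qed
  show ?thesis
    unfolding Q_def[symmetric]
  proof (induction N)
    case 0
    show ?case
      using norm_avg_diff_le[of 0 1 h 0 B] int[of 0] f0 B by (simp add: Q_def)
  next
    case (Suc N)
    have "(\<integral>\<^sup>+x\<in>Q (Suc N). ennreal (norm (h x - avg (Q N) h)) \<partial>lebesgue)
        \<le> (\<integral>\<^sup>+x\<in>Q N. ennreal (norm (h x - avg (Q N) h)) \<partial>lebesgue)"
      using sub[of N] by (intro nn_integral_mono) (auto split: split_indicator)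
    also have "\<dots> \<le> ennreal (B * (1 / 2 ^ N) ^ DIM('a))"
      using bmo_norm_small_cube[OF h B, of "1 / 2 ^ N" 0] by (simp add: Q_def)
    \<comment> \<open>Averaging over the smaller cube costs the ratio \<open>2 ^ DIM('a)\<close> of
      the volumes; this is the loss per generation.\<close>
    also have "\<dots> = ennreal ((2 ^ DIM('a) * B) * (1 / 2 ^ Suc N) ^ DIM('a))"
      by (simp add: power_divide power_mult_distrib)
    finally have "norm (avg (Q (Suc N)) h - avg (Q N) h) \<le> 2 ^ DIM('a) * B"
      using norm_avg_diff_le[of 0 "1 / 2 ^ Suc N" h "avg (Q N) h" "2 ^ DIM('a) * B"] int[of "Suc N"] B
      by (simp add: Q_def)
    then have "norm (avg (Q (Suc N)) h) \<le> norm (avg (Q N) h) + 2 ^ DIM('a) * B"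
      using norm_triangle_sub[of "avg (Q (Suc N)) h" "avg (Q N) h"] by simp
    then show ?case using Suc by (simp add: algebra_simps)
  qed
qed

text \<open>A real part bounded below cannot cancel in the average, so a pointwise bound on a cube
  of side 2^(-N) is enough. With 2^N comparable to R, the factor on the right is the logarithmic
  loss of the linear test.\<close>

lemma bmo_norm_dyadic_lower:
  fixes h :: "'a::euclidean_space \<Rightarrow> complex"
  assumes h: "bmo_norm h \<le> ennreal B" and B: "B \<ge> 0"
    and b: "\<And>x. x \<in> cbox 0 ((1 / 2 ^ N) *\<^sub>R One) \<Longrightarrow> b \<le> Re (h x)"
  shows "b \<le> (1 + 2 ^ DIM('a) * real N) * B"
proof -
  define Q :: "'a set" where "Q = cbox 0 ((1 / 2 ^ N) *\<^sub>R One)"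
  define M :: real where "M = (1 / 2 ^ N) ^ DIM('a)"
  note [measurable] = bmo_normD(1)[OF h]
  have Q: "Q \<in> sets lebesgue" "emeasure lebesgue Q < \<infinity>" "measure lebesgue Q = M" "M > 0"
    using measure_cube[of "1 / 2 ^ N" "0::'a"] unfolding Q_def M_def by auto
  have f0: "(\<integral>\<^sup>+x\<in>cbox 0 One. ennreal (norm (h x)) \<partial>lebesgue) \<le> ennreal B"
    using bmo_norm_large_cube[OF h B, of 1 0] by simp
  have "Q \<subseteq> cbox 0 One" unfolding Q_def by (intro subset_box_imp) (auto simp: field_simps)
  have int: "integrable lebesgue (\<lambda>x. indicator Q x *\<^sub>R h x)"
  proof (rule integrableI_bounded)
    have "(\<integral>\<^sup>+x. norm (indicator Q x *\<^sub>R h x) \<partial>lebesgue) \<le> (\<integral>\<^sup>+x\<in>cbox 0 One. ennreal (norm (h x)) \<partial>lebesgue)"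
      using \<open>Q \<subseteq> cbox 0 One\<close> by (intro nn_integral_mono) (auto split: split_indicator)
    also have "\<dots> < \<infinity>" using f0 by (simp add: ennreal_less_top le_less_trans top.not_eq_extremum)
    finally show "(\<integral>\<^sup>+x. norm (indicator Q x *\<^sub>R h x) \<partial>lebesgue) < \<infinity>" .
  qed (use Q in measurable)
  have "b * M = (LINT x|lebesgue. indicator Q x * b)"
    using Q by simp
  also have "\<dots> \<le> (LINT x|lebesgue. Re (indicator Q x *\<^sub>R h x))"
    using Q b by (intro integral_mono integrable_Re int) (auto split: split_indicator simp: Q_def[symmetric])
  also have "\<dots> = Re (LINT x|lebesgue. indicator Q x *\<^sub>R h x)" by (rule integral_Re[OF int])
  also have "\<dots> = Re (avg Q h) * M"
    using Q by (simp add: avg_def set_lebesgue_integral_def)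
  finally have "b \<le> Re (avg Q h)" using Q by simp
  also have "\<dots> \<le> norm (avg Q h)" by (rule complex_Re_le_cmod)
  also have "\<dots> \<le> (1 + 2 ^ DIM('a) * real N) * B"
    using bmo_norm_dyadic_avg[OF h B, of N] by (simp add: Q_def)
  finally show ?thesis .
qed

text \<open>The Gaussian is dominated by a weighted sum of indicators of the cubes \<open>[-j-1, j+1]\<^sup>n\<close>.\<close>

lemma bmo_norm_gauss_pairing:
  fixes L :: real
  assumes L: "L > 0"
  obtains C where "C > 0" "\<And>(h :: 'a::euclidean_space \<Rightarrow> complex) B. bmo_norm h \<le> ennreal B \<Longrightarrow> B \<ge> 0 \<Longrightarrow>
     (\<integral>\<^sup>+x. ennreal (norm (h x) * gauss L 0 x) \<partial>lebesgue) \<le> ennreal (C * B)"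
proof -
  define n where "n = DIM('a)"
  define a where "a = (\<lambda>j::nat. exp (- (real j)\<^sup>2 / (2 * L\<^sup>2)))"
  define Q :: "nat \<Rightarrow> 'a set" where "Q = (\<lambda>j. cbox (- (real j + 1) *\<^sub>R One) (- (real j + 1) *\<^sub>R One + (2 * (real j + 1)) *\<^sub>R One))"
  define c where "c = (\<lambda>j. a j * (2 * (real j + 1)) ^ n)"
  have Q_iff: "x \<in> Q j \<longleftrightarrow> (\<forall>b\<in>Basis. \<bar>x \<bullet> b\<bar> \<le> real j + 1)" for x j
    unfolding Q_def mem_box by (auto simp: inner_diff_left inner_add_left abs_le_iff algebra_simps)
  have c_le: "c j \<le> fact n * exp (2 + 9 * L\<^sup>2 / 2) * exp (- 1) ^ j" for j
  proof -
    \<comment> \<open>The 3 is the 2 of \<open>exp (2 * (real j + 1))\<close>, which up to a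
      factorial bounds the volume of the cube, plus 1 to leave the summable
      \<open>exp (- 1) ^ j\<close>.\<close>
    have "0 \<le> (real j - 3 * L\<^sup>2)\<^sup>2 / (2 * L\<^sup>2)" by simp
    also have "\<dots> = (real j)\<^sup>2 / (2 * L\<^sup>2) - 3 * real j + 9 * L\<^sup>2 / 2"
      using L by (simp add: power2_eq_square field_simps)
    finally have le: "2 * (real j + 1) + - (real j)\<^sup>2 / (2 * L\<^sup>2) \<le> 2 + 9 * L\<^sup>2 / 2 + real j * (- 1)" by simp
    have "c j \<le> a j * (fact n * exp (2 * (real j + 1)))"
      unfolding c_def a_def by (intro mult_left_mono power_le_fact_exp) auto
    also have "\<dots> = fact n * exp (2 * (real j + 1) + - (real j)\<^sup>2 / (2 * L\<^sup>2))"
      by (simp only: a_def exp_add mult_ac)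
    also have "\<dots> \<le> fact n * exp (2 + 9 * L\<^sup>2 / 2 + real j * (- 1))"
      using le by (intro mult_left_mono) auto
    also have "\<dots> = fact n * exp (2 + 9 * L\<^sup>2 / 2) * exp (- 1) ^ j"
      by (simp only: exp_add exp_of_nat_mult mult.assoc)
    finally show ?thesis .
  qed
  have c_nonneg: "0 \<le> c j" for j by (simp add: c_def a_def)
  have sc: "summable c"
  proof (rule summable_comparison_test')
    show "summable (\<lambda>j. fact n * exp (2 + 9 * L\<^sup>2 / 2) * exp (- 1) ^ j)"
      by (intro summable_mult summable_geometric) simp
    show "norm (c j) \<le> fact n * exp (2 + 9 * L\<^sup>2 / 2) * exp (- 1) ^ j" for j
      using c_le[of j] c_nonneg[of j] by simp
  qed
  show thesis
  proof (rule that[of "suminf c + 1"])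
    show "suminf c + 1 > 0" using suminf_nonneg[OF sc c_nonneg] by simp
    fix h :: "'a \<Rightarrow> complex" and B
    assume h: "bmo_norm h \<le> ennreal B" and B: "B \<ge> 0"
    note [measurable] = bmo_normD(1)[OF h]
    have [measurable]: "Q j \<in> sets lebesgue" for j by (simp add: Q_def)
    have dom: "ennreal (norm (h x) * gauss L 0 x) \<le> (\<Sum>j. ennreal (a j) * (ennreal (norm (h x)) * indicator (Q j) x))" for x
    proof -
      obtain m :: nat where "norm x \<le> real m" using real_arch_simple by blast
      then have "x \<in> Q m" unfolding Q_iff using Basis_le_norm[of _ x] by fastforce
      \<comment> \<open>Minimality puts \<open>x\<close> outside the preceding cube, so some
        coordinate exceeds \<open>j\<close> in absolute value and the Gaussian is at most
        \<open>a j\<close>. For \<open>j = 0\<close> this is trivial, as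
        \<open>a 0 = 1\<close>.\<close>
      define j where "j = (LEAST j. x \<in> Q j)"
      have j: "x \<in> Q j" unfolding j_def using \<open>x \<in> Q m\<close> by (rule LeastI)
      have "real j \<le> norm x"
      proof (cases j)
        case (Suc i)
        then have "x \<notin> Q i" using not_less_Least[of i "\<lambda>j. x \<in> Q j"] by (simp add: j_def)
        then obtain b where "b \<in> Basis" "real i + 1 < \<bar>x \<bullet> b\<bar>" unfolding Q_iff by force
        then show ?thesis using Basis_le_norm[of b x] Suc by simp
      qed auto
      then have "gauss L 0 x \<le> a j"
        unfolding gauss_def a_def using L by (auto intro!: divide_right_mono power_mono)
      then have "ennreal (norm (h x) * gauss L 0 x) \<le> ennreal (a j) * (ennreal (norm (h x)) * indicator (Q j) x)"
        using j mult_left_mono[of "gauss L 0 x" "a j" "norm (h x)"]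
        by (simp add: mult.commute a_def flip: ennreal_mult)
      also have "\<dots> \<le> (\<Sum>j. ennreal (a j) * (ennreal (norm (h x)) * indicator (Q j) x))"
        using sum_le_suminf[of "\<lambda>j. ennreal (a j) * (ennreal (norm (h x)) * indicator (Q j) x)" "{j}"] by auto
      finally show ?thesis .
    qed
    have "(\<integral>\<^sup>+x. ennreal (norm (h x) * gauss L 0 x) \<partial>lebesgue)
        \<le> (\<integral>\<^sup>+x. (\<Sum>j. ennreal (a j) * (ennreal (norm (h x)) * indicator (Q j) x)) \<partial>lebesgue)"
      by (intro nn_integral_mono dom)
    also have "\<dots> = (\<Sum>j. ennreal (a j) * (\<integral>\<^sup>+x\<in>Q j. ennreal (norm (h x)) \<partial>lebesgue))"
      by (subst nn_integral_suminf) (auto simp: nn_integral_cmult)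
    also have "\<dots> \<le> (\<Sum>j. ennreal (B * c j))"
    proof (intro suminf_le)
      fix j
      have "ennreal (a j) * (\<integral>\<^sup>+x\<in>Q j. ennreal (norm (h x)) \<partial>lebesgue) \<le> ennreal (a j) * ennreal (B * (2 * (real j + 1)) ^ n)"
        unfolding Q_def n_def by (intro mult_left_mono bmo_norm_large_cube[OF h B]) auto
      also have "\<dots> = ennreal (B * c j)"
        using B by (simp add: c_def a_def mult_ac flip: ennreal_mult)
      finally show "ennreal (a j) * (\<integral>\<^sup>+x\<in>Q j. ennreal (norm (h x)) \<partial>lebesgue) \<le> ennreal (B * c j)" .
    qed auto
    also have "\<dots> = ennreal (\<Sum>j. B * c j)"
      using B c_nonneg sc by (intro suminf_ennreal2) (auto intro: summable_mult)
    also have "(\<Sum>j. B * c j) = B * suminf c" using sc by (rule suminf_mult)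
    also have "ennreal (B * suminf c) \<le> ennreal ((suminf c + 1) * B)"
      using B by (intro ennreal_leI) (simp add: algebra_simps)
    finally show "(\<integral>\<^sup>+x. ennreal (norm (h x) * gauss L 0 x) \<partial>lebesgue) \<le> ennreal ((suminf c + 1) * B)" .
  qed
qed

section \<open>Lattices of frequencies\<close>

lemma geometric_sum_bound:
  fixes b :: real
  assumes "b > 0"
  shows "(\<Sum>l<N. exp (- b * real l)) \<le> 1 + 1 / b"
proof -
  have e: "exp (- b) < 1" using assms by simp
  have "(\<Sum>l<N. exp (- b * real l)) = (\<Sum>l<N. exp (- b) ^ l)"
    by (simp add: exp_of_nat_mult[symmetric] mult.commute)
  also have "\<dots> \<le> (\<Sum>l. exp (- b) ^ l)"
    using e by (intro sum_le_suminf summable_geometric) auto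
  also have "\<dots> = 1 / (1 - exp (- b))" using e by (intro suminf_geometric) simp
  also have "\<dots> \<le> 1 + 1 / b"
  proof -
    have "exp (- b) \<le> 1 / (1 + b)"
      using exp_ge_add_one_self[of b] assms by (simp add: exp_minus field_simps)
    then have "b / (1 + b) \<le> 1 - exp (- b)" using assms by (simp add: field_simps)
    then have "1 / (1 - exp (- b)) \<le> 1 / (b / (1 + b))" using assms by (intro divide_left_mono) auto
    also have "\<dots> = 1 + 1 / b" using assms by (simp add: field_simps)
    finally show ?thesis .
  qed
  finally show ?thesis .
qed

text \<open>After exp (- u^2) \<le> 2 exp (- |u|) the two sides of \<open>k\<close> are geometric
  series. The bound is uniform in \<open>K\<close> and \<open>k\<close> and of order 1/b for small
  b, which is the number of points at distance up to 1/b; both features are used.\<close>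

lemma gauss_sum_bound:
  fixes b :: real
  assumes b: "b > 0"
  shows "(\<Sum>l<K. exp (- (b * (real l - real k))\<^sup>2)) \<le> 4 * (1 + 1 / b)"
proof -
  have e4: "exp (1 / 4 :: real) \<le> 2"
  proof -
    have "exp (1 / 4 :: real) \<le> 1 + 1 / 4 + (1 / 4)\<^sup>2" by (rule exp_bound) auto
    then show ?thesis by (simp add: power2_eq_square)
  qed
  have u: "exp (- u\<^sup>2) \<le> 2 * exp (- \<bar>u\<bar>)" for u :: real
  proof -
    have "0 \<le> (\<bar>u\<bar> - 1 / 2)\<^sup>2" by simp
    then have "- u\<^sup>2 \<le> 1 / 4 + - \<bar>u\<bar>" by (simp add: power2_eq_square algebra_simps)
    then have "exp (- u\<^sup>2) \<le> exp (1 / 4) * exp (- \<bar>u\<bar>)" by (simp flip: exp_add)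
    also have "\<dots> \<le> 2 * exp (- \<bar>u\<bar>)" using e4 by (intro mult_right_mono) auto
    finally show ?thesis .
  qed
  have "(\<Sum>l<K. exp (- (b * (real l - real k))\<^sup>2)) \<le> (\<Sum>l<K. 2 * exp (- \<bar>b * (real l - real k)\<bar>))"
    by (intro sum_mono u)
  also have "\<dots> = 2 * (\<Sum>l<K. exp (- b * \<bar>real l - real k\<bar>))"
    using b by (simp add: sum_distrib_left abs_mult)
  also have "(\<Sum>l<K. exp (- b * \<bar>real l - real k\<bar>)) \<le> (\<Sum>l\<in>{..<k} \<union> {k..<k+K}. exp (- b * \<bar>real l - real k\<bar>))"
    by (intro sum_mono2) auto
  also have "\<dots> = (\<Sum>l\<in>{..<k}. exp (- b * \<bar>real l - real k\<bar>)) + (\<Sum>l\<in>{k..<k+K}. exp (- b * \<bar>real l - real k\<bar>))"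
    by (intro sum.union_disjoint) auto
  also have "(\<Sum>l\<in>{k..<k+K}. exp (- b * \<bar>real l - real k\<bar>)) = (\<Sum>l<K. exp (- b * real l))"
    by (intro sum.reindex_bij_witness[of _ "\<lambda>l. l + k" "\<lambda>l. l - k"]) auto
  also have "(\<Sum>l\<in>{..<k}. exp (- b * \<bar>real l - real k\<bar>)) \<le> (\<Sum>l<Suc k. exp (- b * real l))"
  proof -
    have "(\<Sum>l\<in>{..<k}. exp (- b * \<bar>real l - real k\<bar>)) = (\<Sum>l\<in>{1..k}. exp (- b * real l))"
      by (intro sum.reindex_bij_witness[of _ "\<lambda>l. k - l" "\<lambda>l. k - l"]) (auto simp: of_nat_diff)
    also have "\<dots> \<le> (\<Sum>l<Suc k. exp (- b * real l))" by (intro sum_mono2) auto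
    finally show ?thesis .
  qed
  also have "2 * ((\<Sum>l<Suc k. exp (- b * real l)) + (\<Sum>l<K. exp (- b * real l))) \<le> 2 * ((1 + 1 / b) + (1 + 1 / b))"
    by (intro mult_left_mono add_mono geometric_sum_bound b) auto
  finally show ?thesis by (simp add: algebra_simps)
qed

text \<open>Extensional functions, so that the lattice is finite and a sum over it of a product over
  the coordinates factors.\<close>

definition lattice :: "nat \<Rightarrow> ('a::euclidean_space \<Rightarrow> nat) set" where
  "lattice K = (\<Pi>\<^sub>E b\<in>Basis. {..<K})"

lemma finite_lattice [simp]: "finite (lattice K)"
  unfolding lattice_def by (intro finite_PiE) auto

lemma card_lattice: "card (lattice K :: ('a::euclidean_space \<Rightarrow> nat) set) = K ^ DIM('a)"
  unfolding lattice_def by (simp add: card_PiE)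

lemma lattice_lt: "k \<in> lattice K \<Longrightarrow> b \<in> Basis \<Longrightarrow> k b < K"
  unfolding lattice_def by auto

lemma lattice_gauss_sum_bound:
  fixes k :: "'a::euclidean_space \<Rightarrow> nat"
  assumes b: "b > 0"
  shows "(\<Sum>l\<in>lattice K. exp (- b\<^sup>2 * (\<Sum>i\<in>(Basis::'a set). (real (l i) - real (k i))\<^sup>2))) \<le> (4 * (1 + 1 / b)) ^ DIM('a)"
proof -
  have "(\<Sum>l\<in>lattice K. exp (- b\<^sup>2 * (\<Sum>i\<in>(Basis::'a set). (real (l i) - real (k i))\<^sup>2)))
     = (\<Sum>l\<in>lattice K. \<Prod>i\<in>(Basis::'a set). exp (- (b * (real (l i) - real (k i)))\<^sup>2))"
    by (simp add: exp_sum[symmetric] sum_distrib_left power_mult_distrib sum_negf)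
  also have "\<dots> = (\<Prod>i\<in>(Basis::'a set). \<Sum>l<K. exp (- (b * (real l - real (k i)))\<^sup>2))"
    unfolding lattice_def by (rule prod_sum_PiE[symmetric]) auto
  also have "\<dots> \<le> (\<Prod>i\<in>(Basis::'a set). 4 * (1 + 1 / b))"
    by (intro prod_mono conjI gauss_sum_bound b sum_nonneg) auto
  finally show ?thesis by simp
qed

text \<open>Near the ends of the interval one side of \<open>k\<close> may have too few points. The
  window to the right of \<open>k\<close> is taken if it fits, and otherwise the last
  \<open>J\<close> points, which still lie at distance less than \<open>J\<close> from
  \<open>k\<close>.\<close>

lemma card_interval_nat:
  assumes "J \<le> K" "k < K"
  shows "J \<le> card {l. l < K \<and> \<bar>real l - real k\<bar> < real J}"
proof (cases "k + J \<le> K")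
  case True
  have "card {k..<k+J} \<le> card {l. l < K \<and> \<bar>real l - real k\<bar> < real J}"
    using True by (intro card_mono) auto
  then show ?thesis by simp
next
  case False
  have "card {K - J..<K} \<le> card {l. l < K \<and> \<bar>real l - real k\<bar> < real J}"
    using False assms by (intro card_mono) auto
  then show ?thesis using assms by simp
qed

lemma card_lattice_near:
  fixes k :: "'a::euclidean_space \<Rightarrow> nat"
  assumes "J \<le> K" "k \<in> lattice K"
  shows "J ^ DIM('a) \<le> card {l \<in> lattice K. \<forall>i\<in>Basis. \<bar>real (l i) - real (k i)\<bar> < real J}"
proof -
  have "J ^ DIM('a) = (\<Prod>i\<in>(Basis::'a set). J)" by simp
  also have "\<dots> \<le> (\<Prod>i\<in>(Basis::'a set). card {l. l < K \<and> \<bar>real l - real (k i)\<bar> < real J})"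
    using assms lattice_lt by (intro prod_mono conjI card_interval_nat) auto
  also have "\<dots> = card (\<Pi>\<^sub>E i\<in>(Basis::'a set). {l. l < K \<and> \<bar>real l - real (k i)\<bar> < real J})"
    by (simp add: card_PiE)
  also have "\<dots> \<le> card {l \<in> lattice K. \<forall>i\<in>Basis. \<bar>real (l i) - real (k i)\<bar> < real J}"
    by (intro card_mono finite_subset[OF _ finite_lattice[of K]]) (auto simp: lattice_def PiE_iff extensional_def)
  finally show ?thesis .
qed

text \<open>The frequencies lie in the cube [R, 2R)^n: away from the origin, where |\<xi>|^s may
  fail to be smooth, and with norms comparable to R.\<close>

definition freq :: "real \<Rightarrow> nat \<Rightarrow> ('a::euclidean_space \<Rightarrow> nat) \<Rightarrow> 'a" where
  "freq R K k = (\<Sum>b\<in>Basis. (R + R / real K * real (k b)) *\<^sub>R b)"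

lemma freq_inner: "b \<in> Basis \<Longrightarrow> freq R K k \<bullet> b = R + R / real K * real (k b)"
  unfolding freq_def by (simp add: inner_sum_left inner_Basis if_distrib cong: if_cong)

lemma norm_freq_diff:
  "(norm (freq R K k - freq R K (l :: 'a::euclidean_space \<Rightarrow> nat)))\<^sup>2
    = (R / real K)\<^sup>2 * (\<Sum>i\<in>Basis. (real (k i) - real (l i))\<^sup>2)"
proof -
  have "(freq R K k - freq R K l) \<bullet> b = R / real K * (real (k b) - real (l b))" if "b \<in> Basis" for b :: 'a
    using that by (simp add: inner_diff_left freq_inner right_diff_distrib)
  then show ?thesis
    unfolding norm_sq_euclidean sum_distrib_left by (intro sum.cong) (auto simp: power_mult_distrib power_divide)
qed

lemma norm_freq:
  fixes k :: "'a::euclidean_space \<Rightarrow> nat"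
  assumes k: "k \<in> lattice K" and R: "R > 0"
  shows "R \<le> norm (freq R K k)" "norm (freq R K k) \<le> 2 * real DIM('a) * R"
proof -
  have c: "R \<le> freq R K k \<bullet> b \<and> freq R K k \<bullet> b \<le> 2 * R" if "b \<in> Basis" for b :: 'a
  proof -
    have "k b < K" using lattice_lt[OF k that] .
    then have "R / real K * real (k b) \<le> R" "0 \<le> R / real K * real (k b)"
      using R by (auto simp: field_simps)
    then show ?thesis using that by (simp add: freq_inner)
  qed
  obtain b :: 'a where b: "b \<in> Basis" using nonempty_Basis by blast
  have "R \<le> \<bar>freq R K k \<bullet> b\<bar>" using c[OF b] by simp
  also have "\<dots> \<le> norm (freq R K k)" using b by (rule Basis_le_norm)
  finally show "R \<le> norm (freq R K k)" .
  have "norm (freq R K k) \<le> (\<Sum>b\<in>Basis. \<bar>freq R K k \<bullet> b\<bar>)" by (rule norm_le_l1)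
  also have "\<dots> \<le> (\<Sum>b\<in>(Basis::'a set). 2 * R)" using c R by (intro sum_mono) (force simp: abs_le_iff)
  also have "\<dots> = 2 * real DIM('a) * R" by simp
  finally show "norm (freq R K k) \<le> 2 * real DIM('a) * R" .
qed

section \<open>The phase function\<close>

text \<open>Stated with the absolute value of the exponent, so that s - 2 may have either
  sign.\<close>

lemma powr_bounds:
  fixes t M :: real
  assumes "1 / M \<le> t" "t \<le> M" "M \<ge> 1"
  shows "M powr (- \<bar>e\<bar>) \<le> t powr e" "t powr e \<le> M powr \<bar>e\<bar>"
proof -
  have t: "t > 0" using assms by (meson less_le_trans divide_pos_pos zero_less_one)
  have "ln t \<le> ln M" using assms t by (subst ln_le_cancel_iff) auto
  moreover have "ln (1 / M) \<le> ln t" using assms t by (subst ln_le_cancel_iff) auto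
  then have "- ln M \<le> ln t" using assms by (simp add: ln_div)
  ultimately have "\<bar>e * ln t\<bar> \<le> \<bar>e\<bar> * ln M"
    by (simp add: abs_mult mult_left_mono)
  then show "M powr (- \<bar>e\<bar>) \<le> t powr e" "t powr e \<le> M powr \<bar>e\<bar>"
    using t assms by (auto simp: powr_def abs_le_iff)
qed

text \<open>Second-order Taylor expansion at 1. The interval [1/4, 4] contains |\<xi>|^2 / |v|^2
  whenever |\<xi> - v| \<le> |v| / 2.\<close>

lemma powr_taylor_unit:
  fixes a t :: real
  assumes "1 / 4 \<le> t" "t \<le> 4"
  shows "\<bar>t powr a - 1 - a * (t - 1)\<bar> \<le> \<bar>a * (a - 1)\<bar> * 4 powr \<bar>a - 2\<bar> * (t - 1)\<^sup>2"
proof (cases "t = 1")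
  case False
  define diff where "diff = (\<lambda>m::nat. if m = 0 then (\<lambda>t. t powr a) else if m = 1 then (\<lambda>t. a * t powr (a - 1))
     else (\<lambda>t. a * ((a - 1) * t powr (a - 2)) :: real))"
  have "\<exists>u. (if t < 1 then t < u \<and> u < 1 else 1 < u \<and> u < t) \<and>
      t powr a = (\<Sum>m<2. (diff m 1 / fact m) * (t - 1) ^ m) + (diff 2 u / fact 2) * (t - 1) ^ 2"
  proof (rule Taylor[where a = "1 / 4" and b = 4])
    show "\<forall>m u. m < 2 \<and> 1 / 4 \<le> u \<and> u \<le> 4 \<longrightarrow> (diff m has_real_derivative diff (Suc m) u) (at u)"
    proof (intro allI impI)
      fix m :: nat and u :: real
      assume m: "m < 2 \<and> 1 / 4 \<le> u \<and> u \<le> 4"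
      then consider "m = 0" | "m = 1" by linarith
      then show "(diff m has_real_derivative diff (Suc m) u) (at u)"
      proof cases
        case 1
        then show ?thesis using m has_real_derivative_powr[of u a] by (simp add: diff_def)
      next
        case 2
        have "((\<lambda>t. a * t powr (a - 1)) has_real_derivative a * ((a - 1) * u powr (a - 1 - 1))) (at u)"
          using m by (intro DERIV_cmult has_real_derivative_powr) auto
        then show ?thesis using 2 by (simp add: diff_def)
      qed
    qed
  qed (use assms False in \<open>auto simp: diff_def\<close>)
  then obtain u where u: "if t < 1 then t < u \<and> u < 1 else 1 < u \<and> u < t"
    and eq: "t powr a = (\<Sum>m<2. (diff m 1 / fact m) * (t - 1) ^ m) + (diff 2 u / fact 2) * (t - 1) ^ 2" by blast
  have "1 / 4 \<le> u" "u \<le> 4" using u assms by (auto split: if_splits)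
  then have ub: "u powr (a - 2) \<le> 4 powr \<bar>a - 2\<bar>" by (intro powr_bounds) auto
  have "t powr a - 1 - a * (t - 1) = a * (a - 1) * u powr (a - 2) / 2 * (t - 1)\<^sup>2"
    using eq by (simp add: diff_def numeral_2_eq_2)
  then have "\<bar>t powr a - 1 - a * (t - 1)\<bar> = \<bar>a * (a - 1)\<bar> * (u powr (a - 2) / 2) * (t - 1)\<^sup>2"
    by (simp only: abs_mult abs_divide abs_power2) simp
  also have "\<dots> \<le> \<bar>a * (a - 1)\<bar> * 4 powr \<bar>a - 2\<bar> * (t - 1)\<^sup>2"
    using order_trans[OF _ ub, of "u powr (a - 2) / 2"] by (intro mult_right_mono mult_left_mono) auto
  finally show ?thesis .
qed simp

definition phase :: "real \<Rightarrow> 'a::euclidean_space \<Rightarrow> real" where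
  "phase s x = norm x powr s"

definition grad_phase :: "real \<Rightarrow> 'a::euclidean_space \<Rightarrow> 'a" where
  "grad_phase s v = (s * norm v powr (s - 2)) *\<^sub>R v"

text \<open>With r = |v| and t = |\<xi>|^2 / r^2 one has |\<xi>|^s = r^s t^(s/2), and t is a
  quadratic polynomial in \<xi>. A one-variable expansion at t = 1 therefore replaces the Hessian;
  the quadratic part of t - 1 accounts for the difference between r^s (s/2) (t - 1) and the gradient
  term.\<close>

lemma phase_taylor_near:
  fixes v \<xi> :: "'a::euclidean_space"
  assumes v: "v \<noteq> 0" and h: "norm (\<xi> - v) \<le> norm v / 2" and s: "s > 0"
  shows "\<bar>phase s \<xi> - phase s v - grad_phase s v \<bullet> (\<xi> - v)\<bar>
    \<le> (7 * (\<bar>s / 2 * (s / 2 - 1)\<bar> * 4 powr \<bar>s / 2 - 2\<bar>) + s) * (norm v powr (s - 2) * (norm (\<xi> - v))\<^sup>2)"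
proof -
  define r where "r = norm v"
  define d where "d = norm (\<xi> - v)"
  define C where "C = \<bar>s / 2 * (s / 2 - 1)\<bar> * 4 powr \<bar>s / 2 - 2\<bar>"
  define t where "t = (norm \<xi>)\<^sup>2 / r\<^sup>2"
  have r: "r > 0" using v by (simp add: r_def)
  have d: "d \<le> r / 2" "d \<ge> 0" using h by (auto simp: r_def d_def)
  have C: "C \<ge> 0" by (simp add: C_def)
  have "norm v \<le> norm \<xi> + norm (\<xi> - v)" using norm_triangle_sub[of v \<xi>] by (simp add: norm_minus_commute)
  then have lo: "r / 2 \<le> norm \<xi>" using d by (simp add: r_def d_def)
  have "norm \<xi> \<le> norm v + norm (\<xi> - v)" by (rule norm_triangle_sub)
  then have hi: "norm \<xi> \<le> 2 * r" using d r unfolding r_def d_def by linarith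
  have "(r / 2)\<^sup>2 \<le> (norm \<xi>)\<^sup>2" "(norm \<xi>)\<^sup>2 \<le> (2 * r)\<^sup>2"
    using lo hi r by (intro power_mono; simp)+
  then have t: "1 / 4 \<le> t" "t \<le> 4" using r by (auto simp: t_def field_simps power2_eq_square)
  have xi: "(norm \<xi>)\<^sup>2 = r\<^sup>2 + 2 * (v \<bullet> (\<xi> - v)) + d\<^sup>2"
    by (simp add: r_def d_def power2_norm_eq_inner inner_diff_left inner_diff_right inner_commute)
  have r2: "r powr s = r powr (s - 2) * r\<^sup>2"
    using r by (simp add: powr_diff powr_numeral)
  have "phase s \<xi> = (r\<^sup>2 * t) powr (s / 2)"
    using r lo by (simp add: phase_def t_def powr_powr flip: powr_numeral)
  also have "\<dots> = r powr s * t powr (s / 2)"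
    using r t by (simp add: powr_mult powr_powr flip: powr_numeral)
  finally have p1: "phase s \<xi> = r powr s * t powr (s / 2)" .
  have tm: "t - 1 = (2 * (v \<bullet> (\<xi> - v)) + d\<^sup>2) / r\<^sup>2"
    unfolding t_def xi using r by (simp add: field_simps)
  have "r powr s * (s / 2 * (t - 1)) = s / 2 * r powr (s - 2) * (2 * (v \<bullet> (\<xi> - v)) + d\<^sup>2)"
    unfolding tm r2 using r by (simp add: field_simps)
  moreover have "grad_phase s v \<bullet> (\<xi> - v) = s * r powr (s - 2) * (v \<bullet> (\<xi> - v))"
    by (simp add: grad_phase_def r_def)
  ultimately have p2: "grad_phase s v \<bullet> (\<xi> - v) = r powr s * (s / 2 * (t - 1)) - s / 2 * r powr (s - 2) * d\<^sup>2"
    by (simp only: distrib_left)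
  have "phase s \<xi> - phase s v - grad_phase s v \<bullet> (\<xi> - v)
      = r powr s * (t powr (s / 2) - 1 - s / 2 * (t - 1)) + s / 2 * r powr (s - 2) * d\<^sup>2"
    unfolding p1 p2 by (simp add: phase_def r_def algebra_simps)
  also have "\<bar>\<dots>\<bar> \<le> r powr s * \<bar>t powr (s / 2) - 1 - s / 2 * (t - 1)\<bar> + s / 2 * r powr (s - 2) * d\<^sup>2"
    by (rule order_trans[OF abs_triangle_ineq]) (use s in \<open>simp add: abs_mult\<close>)
  also have "\<dots> \<le> r powr s * (C * (t - 1)\<^sup>2) + s / 2 * r powr (s - 2) * d\<^sup>2"
    unfolding C_def by (intro add_right_mono mult_left_mono powr_taylor_unit t) auto
  \<comment> \<open>Cauchy-Schwarz and d \<le> r/2 bound the numerator of t - 1 by 5/2 r d; its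
    square has the constant 25/4, rounded up to 7.\<close>
  also have "(t - 1)\<^sup>2 \<le> 7 * d\<^sup>2 / r\<^sup>2"
  proof -
    have "\<bar>v \<bullet> (\<xi> - v)\<bar> \<le> r * d" unfolding r_def d_def by (rule Cauchy_Schwarz_ineq2)
    moreover have "d\<^sup>2 \<le> r / 2 * d" unfolding power2_eq_square using d by (intro mult_right_mono)
    ultimately have "\<bar>2 * (v \<bullet> (\<xi> - v)) + d\<^sup>2\<bar> \<le> 5 / 2 * (r * d)"
      using zero_le_power2[of d] mult_nonneg_nonneg[of r d] r d(2)
      unfolding abs_le_iff by linarith
    then have "(2 * (v \<bullet> (\<xi> - v)) + d\<^sup>2)\<^sup>2 \<le> (5 / 2 * (r * d))\<^sup>2"
      by (metis abs_ge_zero power2_abs power_mono)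
    also have "\<dots> = 25 / 4 * (d\<^sup>2 * r\<^sup>2)" by (simp add: power_mult_distrib power2_eq_square)
    also have "\<dots> \<le> 7 * d\<^sup>2 * r\<^sup>2"
      using mult_nonneg_nonneg[OF zero_le_power2[of d] zero_le_power2[of r]] by linarith
    finally have "(2 * (v \<bullet> (\<xi> - v)) + d\<^sup>2)\<^sup>2 / (r\<^sup>2)\<^sup>2 \<le> 7 * d\<^sup>2 * r\<^sup>2 / (r\<^sup>2)\<^sup>2"
      by (intro divide_right_mono) auto
    then show ?thesis using r by (simp add: tm power_divide power2_eq_square)
  qed
  also have "r powr s * (C * (7 * d\<^sup>2 / r\<^sup>2)) + s / 2 * r powr (s - 2) * d\<^sup>2 = (7 * C + s / 2) * (r powr (s - 2) * d\<^sup>2)"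
    unfolding r2 using r by (simp add: field_simps)
  also have "\<dots> \<le> (7 * C + s) * (r powr (s - 2) * d\<^sup>2)"
    using s by (intro mult_right_mono) auto
  finally show ?thesis
    using C by (simp add: C_def r_def d_def mult_left_mono)
qed

text \<open>Measuring a phase error by the chord makes it subadditive and at most 2, even where a
  Taylor bound is useless; and \<open>1 - dev \<theta>\<close> is a lower bound for cos \<theta>,
  which is how it enters the lower estimates.\<close>

definition dev :: "real \<Rightarrow> real" where
  "dev \<theta> = norm (1 - cis \<theta>)"

lemma dev_nonneg: "0 \<le> dev \<theta>" by (simp add: dev_def)

lemma dev_le_2: "dev \<theta> \<le> 2"
  unfolding dev_def using norm_triangle_ineq4[of 1 "cis \<theta>"] by simp

lemma dev_le_abs: "dev \<theta> \<le> \<bar>\<theta>\<bar>"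
proof -
  have "(dev \<theta>)\<^sup>2 = 2 - 2 * cos \<theta>"
    unfolding dev_def cmod_power2 using sin_cos_squared_add[of \<theta>]
    by (simp add: power2_eq_square algebra_simps)
  also have "\<dots> \<le> \<theta>\<^sup>2"
  proof -
    have "cos \<theta> = 1 - 2 * (sin (\<theta> / 2))\<^sup>2" using cos_double_sin[of "\<theta> / 2"] by simp
    moreover have "(sin (\<theta> / 2))\<^sup>2 \<le> (\<theta> / 2)\<^sup>2"
      using abs_sin_x_le_abs_x[of "\<theta> / 2"] by (simp only: abs_le_square_iff)
    ultimately show ?thesis by (simp add: power_divide)
  qed
  finally show ?thesis using dev_nonneg by (metis abs_le_square_iff abs_of_nonneg)
qed

lemma dev_add: "dev (a + b) \<le> dev a + dev b"
proof -
  have "1 - cis (a + b) = (1 - cis a) + cis a * (1 - cis b)"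
    by (simp add: cis_mult algebra_simps)
  then show ?thesis unfolding dev_def
    by (metis norm_triangle_ineq norm_mult norm_cis mult_1)
qed

lemma Re_cis_ge: "1 - dev \<theta> \<le> Re (cis \<theta>)"
  using complex_Re_le_cmod[of "1 - cis \<theta>"] by (simp add: dev_def)

text \<open>For t \<le> 1 use t^s \<le> t, for t > 1 the trivial bound 2. This controls the phase
  near frequency 0, where no packet cancels it.\<close>

lemma dev_powr_le: "t \<ge> 0 \<Longrightarrow> s \<ge> 1 \<Longrightarrow> dev (t powr s) \<le> 2 * t"
proof (cases "t \<le> 1")
  case True
  assume "t \<ge> 0" "s \<ge> 1"
  then have "t powr s \<le> t" using True powr_mono'[of 1 s t] by (cases "t = 0") auto
  then show ?thesis using dev_le_abs[of "t powr s"] \<open>t \<ge> 0\<close> by simp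
next
  case False
  then show ?thesis using dev_le_2[of "t powr s"] by simp
qed

text \<open>For |\<xi> - v| \<le> |v| / 2 this is the Taylor estimate. Otherwise |v|^(s-2) |\<xi> -
  v|^2 \<ge> |v|^s / 4 \<ge> 1/4, so that 8 times this quantity is at least the trivial bound 2.
  Hence the Gaussian tails need no separate treatment.\<close>

lemma dev_phase_taylor:
  fixes M s :: real
  assumes s: "s > 0" and M: "M \<ge> 1"
  obtains C where "C > 0"
    "\<And>R (v::'a::euclidean_space) \<xi>. 1 \<le> R \<Longrightarrow> R \<le> norm v \<Longrightarrow> norm v \<le> M * R \<Longrightarrow>
       dev (phase s \<xi> - phase s v - grad_phase s v \<bullet> (\<xi> - v)) \<le> C * (R powr (s - 2) * (norm (\<xi> - v))\<^sup>2)"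
proof -
  define C0 where "C0 = (7 * (\<bar>s / 2 * (s / 2 - 1)\<bar> * 4 powr \<bar>s / 2 - 2\<bar>) + s) + 8"
  have C0: "C0 \<ge> 8" using s by (simp add: C0_def)
  show thesis
  proof (rule that[of "C0 * M powr \<bar>s - 2\<bar>"])
    show "C0 * M powr \<bar>s - 2\<bar> > 0" using C0 M by auto
    fix R :: real and v \<xi> :: 'a
    assume R: "1 \<le> R" "R \<le> norm v" "norm v \<le> M * R"
    define r where "r = norm v"
    define d where "d = norm (\<xi> - v)"
    have r: "1 \<le> r" using R by (simp add: r_def)
    have 1: "dev (phase s \<xi> - phase s v - grad_phase s v \<bullet> (\<xi> - v)) \<le> C0 * (r powr (s - 2) * d\<^sup>2)"
    proof (cases "d \<le> r / 2")
      case True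
      have "dev (phase s \<xi> - phase s v - grad_phase s v \<bullet> (\<xi> - v))
         \<le> (7 * (\<bar>s / 2 * (s / 2 - 1)\<bar> * 4 powr \<bar>s / 2 - 2\<bar>) + s) * (r powr (s - 2) * d\<^sup>2)"
        unfolding r_def d_def
        by (rule order_trans[OF dev_le_abs phase_taylor_near]) (use True r s in \<open>auto simp: r_def d_def\<close>)
      also have "\<dots> \<le> C0 * (r powr (s - 2) * d\<^sup>2)"
        by (intro mult_right_mono) (auto simp: C0_def)
      finally show ?thesis .
    next
      case False
      have "r\<^sup>2 \<le> (2 * d)\<^sup>2" using False r by (intro power_mono) auto
      moreover have "1 \<le> r powr s" using r s by (simp add: ge_one_powr_ge_zero)
      ultimately have "2 * r\<^sup>2 \<le> 8 * d\<^sup>2 * r powr s"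
        using mult_mono[of "2 * r\<^sup>2" "8 * d\<^sup>2" 1 "r powr s"] by simp
      then have "2 \<le> 8 * (r powr (s - 2) * d\<^sup>2)"
        using r by (simp add: powr_diff powr_numeral field_simps)
      also have "\<dots> \<le> C0 * (r powr (s - 2) * d\<^sup>2)" using C0 by (intro mult_right_mono) auto
      finally show ?thesis using dev_le_2 order_trans by blast
    qed
    have "(r / R) powr (s - 2) \<le> M powr \<bar>s - 2\<bar>"
    proof (rule powr_bounds)
      show "1 / M \<le> r / R" using R M by (auto simp: r_def field_simps intro: order_trans[of R "M * R"])
    qed (use R M in \<open>auto simp: r_def field_simps\<close>)
    then have "r powr (s - 2) \<le> M powr \<bar>s - 2\<bar> * R powr (s - 2)"
      using R r by (simp add: powr_divide field_simps)
    then have "C0 * (r powr (s - 2) * d\<^sup>2) \<le> C0 * ((M powr \<bar>s - 2\<bar> * R powr (s - 2)) * d\<^sup>2)"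
      using C0 by (intro mult_left_mono mult_right_mono) auto
    with 1 show "dev (phase s \<xi> - phase s v - grad_phase s v \<bullet> (\<xi> - v)) \<le> C0 * M powr \<bar>s - 2\<bar> * (R powr (s - 2) * (norm (\<xi> - v))\<^sup>2)"
      by (simp add: d_def mult_ac)
  qed
qed

text \<open>In polar coordinates, \<open>|F a - F b|\<^sup>2 = (|a|\<^sup>p - |b|\<^sup>p)\<^sup>2 + 2 (|a| |b|)\<^sup>p\<^sup>-\<^sup>1 (|a| |b| - a \<bullet> b)\<close> for \<open>F a = |a|\<^sup>p\<^sup>-\<^sup>1 a\<close>, and
  each summand dominates the one in the same formula for \<open>p = 1\<close>.\<close>

lemma grad_phase_separation:
  fixes M s :: real
  assumes s: "s > 1" and M: "M \<ge> 1"
  obtains c where "c > 0"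
    "\<And>R (a::'a::euclidean_space) b. R > 0 \<Longrightarrow> R \<le> norm a \<Longrightarrow> norm a \<le> M * R \<Longrightarrow> R \<le> norm b \<Longrightarrow> norm b \<le> M * R \<Longrightarrow>
       c * (R powr (s - 2) * norm (a - b)) \<le> norm (grad_phase s a - grad_phase s b)"
proof -
  define L where "L = M powr (- \<bar>s - 2\<bar>)"
  \<comment> \<open>The radial summand contributes the derivative (s - 1) z^(s-2) of z^(s-1), the
    angular one the factor z^(s-2); \<open>L\<close> compares z^(s-2) with R^(s-2).\<close>
  define c where "c = min 1 (s - 1) * L"
  have L: "L > 0" using M by (simp add: L_def)
  have c: "c > 0" "c \<le> (s - 1) * L" "c \<le> L" using s L by (auto simp: c_def min_def mult_le_cancel_right1)
  show thesis
  proof (rule that[of "s * c"])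
    show "s * c > 0" using c s by simp
    fix R :: real and a b :: 'a
    assume R: "R > 0" and a: "R \<le> norm a" "norm a \<le> M * R" and b: "R \<le> norm b" "norm b \<le> M * R"
    define x y where "x = norm a" and "y = norm b"
    have x: "x > 0" and y: "y > 0" using a b R by (auto simp: x_def y_def)
    have lb: "L * R powr (s - 2) \<le> u powr (s - 2)" if "R \<le> u" "u \<le> M * R" for u
    proof -
      have "1 / M \<le> 1" using M by simp
      also have "1 \<le> u / R" using that R by simp
      finally have "L \<le> (u / R) powr (s - 2)"
        unfolding L_def using that R M by (intro powr_bounds) (auto simp: field_simps)
      then show ?thesis using that R by (simp add: powr_divide field_simps)
    qed
    define E where "E = R powr (s - 2)"
    have E: "E > 0" using R by (simp add: E_def)
    have mvt: "c * E * (v - u) \<le> v powr (s - 1) - u powr (s - 1)" if "R \<le> u" "u < v" "v \<le> M * R" for u v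
    proof -
      have "\<exists>z>u. z < v \<and> v powr (s - 1) - u powr (s - 1) = (v - u) * ((s - 1) * z powr (s - 1 - 1))"
        using that R by (intro MVT2 has_real_derivative_powr) auto
      then obtain z where z: "u < z" "z < v"
        "v powr (s - 1) - u powr (s - 1) = (v - u) * ((s - 1) * z powr (s - 2))" by auto
      have "c * E \<le> ((s - 1) * L) * E" using c E by (intro mult_right_mono) auto
      also have "\<dots> = (s - 1) * (L * E)" by simp
      also have "\<dots> \<le> (s - 1) * z powr (s - 2)"
        unfolding E_def using lb[of z] z that s by (intro mult_left_mono) auto
      finally have "(v - u) * (c * E) \<le> (v - u) * ((s - 1) * z powr (s - 2))"
        using that by (intro mult_left_mono) auto
      then show ?thesis using z by (simp add: mult_ac)
    qed
    have rad: "(c * E)\<^sup>2 * (x - y)\<^sup>2 \<le> (x powr (s - 1) - y powr (s - 1))\<^sup>2"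
    proof -
      have "c * E * \<bar>x - y\<bar> \<le> \<bar>x powr (s - 1) - y powr (s - 1)\<bar>"
        using mvt[of x y] mvt[of y x] a b by (cases x y rule: linorder_cases) (auto simp: x_def y_def)
      then have "(c * E * \<bar>x - y\<bar>)\<^sup>2 \<le> \<bar>x powr (s - 1) - y powr (s - 1)\<bar>\<^sup>2"
        using c E by (intro power_mono) auto
      then show ?thesis by (simp add: power_mult_distrib)
    qed
    have "a \<bullet> b \<le> x * y" unfolding x_def y_def by (rule norm_cauchy_schwarz)
    moreover have "(c * E)\<^sup>2 \<le> x powr (s - 2) * y powr (s - 2)"
    proof -
      have "c * E \<le> L * E" using c E by (intro mult_right_mono) auto
      then have "c * E \<le> x powr (s - 2)" "c * E \<le> y powr (s - 2)"
        using lb[of x] lb[of y] a b by (auto simp: x_def y_def E_def)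
      then show ?thesis using c E unfolding power2_eq_square by (intro mult_mono) auto
    qed
    ultimately have ang: "(c * E)\<^sup>2 * (2 * (x * y - a \<bullet> b)) \<le> x powr (s - 2) * y powr (s - 2) * (2 * (x * y - a \<bullet> b))"
      by (intro mult_right_mono) auto
    have xx: "x powr (s - 1) = x powr (s - 2) * x" "y powr (s - 1) = y powr (s - 2) * y"
      using x y powr_add[of x "s - 2" 1] powr_add[of y "s - 2" 1] by auto
    have id: "(norm (u *\<^sub>R a - v *\<^sub>R b))\<^sup>2 = (u * x - v * y)\<^sup>2 + u * v * (2 * (x * y - a \<bullet> b))" for u v
    proof -
      have "a \<bullet> a = x * x" "b \<bullet> b = y * y"
        by (simp_all add: x_def y_def power2_eq_square flip: power2_norm_eq_inner)
      then show ?thesis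
        unfolding power2_norm_eq_inner
        by (simp add: inner_diff_left inner_diff_right inner_commute power2_eq_square algebra_simps)
    qed
    have "(c * (E * norm (a - b)))\<^sup>2 = (c * E)\<^sup>2 * (x - y)\<^sup>2 + (c * E)\<^sup>2 * (2 * (x * y - a \<bullet> b))"
      using id[of 1 1] by (simp add: power_mult_distrib distrib_left)
    also have "\<dots> \<le> (x powr (s - 1) - y powr (s - 1))\<^sup>2 + x powr (s - 2) * y powr (s - 2) * (2 * (x * y - a \<bullet> b))"
      using rad ang by linarith
    also have "\<dots> = (norm (x powr (s - 2) *\<^sub>R a - y powr (s - 2) *\<^sub>R b))\<^sup>2"
      unfolding id xx by simp
    finally have "c * (E * norm (a - b)) \<le> norm (x powr (s - 2) *\<^sub>R a - y powr (s - 2) *\<^sub>R b)"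
      by (rule power2_le_imp_le) simp
    then have "s * (c * (E * norm (a - b))) \<le> s * norm (x powr (s - 2) *\<^sub>R a - y powr (s - 2) *\<^sub>R b)"
      using s by (intro mult_left_mono) auto
    also have "\<dots> = norm (s *\<^sub>R (x powr (s - 2) *\<^sub>R a - y powr (s - 2) *\<^sub>R b))" using s by simp
    also have "s *\<^sub>R (x powr (s - 2) *\<^sub>R a - y powr (s - 2) *\<^sub>R b) = grad_phase s a - grad_phase s b"
      by (simp add: grad_phase_def x_def y_def scaleR_diff_right)
    finally show "s * c * (R powr (s - 2) * norm (a - b)) \<le> norm (grad_phase s a - grad_phase s b)"
      by (simp add: E_def mult_ac)
  qed
qed

section \<open>Sums of separated packets\<close>

lemma has_bochner_integral_gauss_prod:
  fixes v u :: "'a::euclidean_space"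
  assumes "A > 0" "B > 0"
  shows "has_bochner_integral lborel (\<lambda>(\<xi>, \<eta>). gauss A v \<xi> * gauss B u \<eta>)
     ((sqrt (2 * pi) * A) ^ DIM('a) * (sqrt (2 * pi) * B) ^ DIM('a))"
proof -
  note A = has_bochner_integral_gauss[OF \<open>A > 0\<close>, of v] and B = has_bochner_integral_gauss[OF \<open>B > 0\<close>, of u]
  have int: "integrable (lborel \<Otimes>\<^sub>M lborel) (\<lambda>(\<xi>, \<eta>). gauss A v \<xi> * gauss B u \<eta>)"
  proof (rule lborel_pair.Fubini_integrable)
    show "(\<lambda>(\<xi>, \<eta>). gauss A v \<xi> * gauss B u \<eta>) \<in> borel_measurable (lborel \<Otimes>\<^sub>M lborel)"
      by measurable
    show "integrable lborel (\<lambda>x. LINT y|lborel. norm (case (x, y) of (\<xi>, \<eta>) \<Rightarrow> gauss A v \<xi> * gauss B u \<eta>))"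
      using A by (simp add: abs_mult abs_of_nonneg gauss_nonneg has_bochner_integral_iff)
    show "AE x in lborel. integrable lborel (\<lambda>y. case (x, y) of (\<xi>, \<eta>) \<Rightarrow> gauss A v \<xi> * gauss B u \<eta>)"
      using B by (simp add: has_bochner_integral_iff)
  qed
  have "(LINT z|(lborel \<Otimes>\<^sub>M lborel). (case z of (\<xi>, \<eta>) \<Rightarrow> gauss A v \<xi> * gauss B u \<eta>))
     = (LINT \<xi>|lborel. (LINT \<eta>|lborel. gauss A v \<xi> * gauss B u \<eta>))"
    using lborel_pair.integral_fst'[OF int] by simp
  also have "\<dots> = (sqrt (2 * pi) * A) ^ DIM('a) * (sqrt (2 * pi) * B) ^ DIM('a)"
    using A B by (simp add: has_bochner_integral_iff)
  finally show ?thesis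
    using int unfolding has_bochner_integral_iff lborel_prod[symmetric] by blast
qed

text \<open>Only the packets whose centre is close to \<open>x\<close> contribute: if \<open>p k\<^sub>0\<close> is the centre nearest to \<open>x\<close>,
  then \<open>|p k - p k\<^sub>0| \<le> 2 |x - p k|\<close>.\<close>

lemma separated_gauss_sum_bound:
  fixes p :: "('a::euclidean_space \<Rightarrow> nat) \<Rightarrow> 'a"
  assumes W: "W > 0" and c: "c > 0"
    and sep: "\<And>k l. k \<in> lattice K \<Longrightarrow> l \<in> lattice K \<Longrightarrow>
      (c * W)\<^sup>2 * (\<Sum>i\<in>Basis. (real (k i) - real (l i))\<^sup>2) \<le> (norm (p k - p l))\<^sup>2"
  shows "(\<Sum>k\<in>lattice K. gauss W (p k) x) \<le> (4 * (1 + sqrt 8 / c)) ^ DIM('a)"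
proof (cases "lattice K = ({} :: ('a \<Rightarrow> nat) set)")
  case True
  then show ?thesis using c by simp
next
  case False
  define k0 where "k0 = arg_min_on (\<lambda>k. norm (x - p k)) (lattice K)"
  have k0: "k0 \<in> lattice K" "\<And>k. k \<in> lattice K \<Longrightarrow> norm (x - p k0) \<le> norm (x - p k)"
    unfolding k0_def using False arg_min_if_finite(1)[of "lattice K" "\<lambda>k. norm (x - p k)"]
      arg_min_least[of "lattice K" _ "\<lambda>k. norm (x - p k)"] by auto
  have "gauss W (p k) x \<le> exp (- (c / sqrt 8)\<^sup>2 * (\<Sum>i\<in>(Basis::'a set). (real (k i) - real (k0 i))\<^sup>2))"
    if k: "k \<in> lattice K" for k
  proof -
    define S where "S = (\<Sum>i\<in>(Basis::'a set). (real (k i) - real (k0 i))\<^sup>2)"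
    have "norm (p k - p k0) \<le> norm (x - p k0) + norm (x - p k)"
      using norm_triangle_ineq4[of "x - p k0" "x - p k"] by simp
    also have "\<dots> \<le> 2 * norm (x - p k)" using k0(2)[OF k] by simp
    finally have "(norm (p k - p k0))\<^sup>2 \<le> (2 * norm (x - p k))\<^sup>2" by (intro power_mono) auto
    then have "(c * W)\<^sup>2 * S \<le> 4 * (norm (x - p k))\<^sup>2"
      using sep[OF k k0(1)] by (simp add: S_def power_mult_distrib)
    \<comment> \<open>8 = 4 * 2: the 4 comes from doubling the distance, the 2 from the exponent of
      the Gaussian.\<close>
    then have "c\<^sup>2 / 8 * S \<le> (norm (x - p k))\<^sup>2 / (2 * W\<^sup>2)"
      using W by (simp add: power_mult_distrib field_simps)
    then show ?thesis by (simp add: gauss_def power_divide S_def)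
  qed
  then have "(\<Sum>k\<in>lattice K. gauss W (p k) x)
     \<le> (\<Sum>k\<in>lattice K. exp (- (c / sqrt 8)\<^sup>2 * (\<Sum>i\<in>(Basis::'a set). (real (k i) - real (k0 i))\<^sup>2)))"
    by (intro sum_mono)
  also have "\<dots> \<le> (4 * (1 + 1 / (c / sqrt 8))) ^ DIM('a)"
    using c by (intro lattice_gauss_sum_bound) simp
  finally show ?thesis by simp
qed

text \<open>\<open>c\<close> counts the copies of the phase that a packet has to cancel: by the
  choice of its centre and constant, the Fourier transform of the packet of index k carries -c times
  the first-order Taylor polynomial of \<open>phase s\<close> at \<open>N k\<close>. The values 2, 1
  and 0 occur.\<close>

definition wave :: "real \<Rightarrow> real \<Rightarrow> real \<Rightarrow> (('a::euclidean_space \<Rightarrow> nat) \<Rightarrow> 'a) \<Rightarrow> nat \<Rightarrow> 'a \<Rightarrow> complex" where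
  "wave s c W N K x = (\<Sum>k\<in>lattice K. packet W (c *\<^sub>R grad_phase s (N k)) (N k) (- (c * phase s (N k))) x)"

lemma borel_measurable_wave [measurable]: "wave s c W N K \<in> borel_measurable borel"
  unfolding wave_def by measurable

lemma wave_schwartz: "W > 0 \<Longrightarrow> K > 0 \<Longrightarrow> wave s c W N K \<in> schwartz"
proof -
  assume "W > 0" "K > 0"
  have "lattice K \<noteq> ({} :: ('a \<Rightarrow> nat) set)" using \<open>K > 0\<close> by (auto simp: lattice_def PiE_eq_empty_iff)
  then show ?thesis
    unfolding wave_def using \<open>W > 0\<close> by (intro gauss_poly_schwartz gauss_poly_sum) (auto intro: gauss_poly.packet)
qed

lemma fourier_wave:
  fixes \<xi> :: "'a::euclidean_space"
  assumes "W > 0"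
  shows "fourier (wave s c W N K) \<xi> = complex_of_real ((sqrt (2 * pi) * W) ^ DIM('a)) *
     (\<Sum>k\<in>lattice K. complex_of_real (gauss (1 / W) (N k) \<xi>) * cis (- (c * (phase s (N k) + grad_phase s (N k) \<bullet> (\<xi> - N k)))))"
proof -
  have "fourier (wave s c W N K) \<xi> = (LINT x|lborel. (\<Sum>k\<in>lattice K. cis (- (\<xi> \<bullet> x)) *
       packet W (c *\<^sub>R grad_phase s (N k)) (N k) (- (c * phase s (N k))) x))"
    by (subst fourier_eq_lborel) (auto simp: wave_def sum_distrib_left)
  also have "\<dots> = (\<Sum>k\<in>lattice K. complex_of_real ((sqrt (2 * pi) * W) ^ DIM('a) * gauss (1 / W) (N k) \<xi>) *
       cis (- (c * phase s (N k)) - (\<xi> - N k) \<bullet> (c *\<^sub>R grad_phase s (N k))))"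
    by (intro has_bochner_integral_integral_eq has_bochner_integral_sum has_bochner_integral_packet_fourier assms)
  also have "\<dots> = complex_of_real ((sqrt (2 * pi) * W) ^ DIM('a)) *
     (\<Sum>k\<in>lattice K. complex_of_real (gauss (1 / W) (N k) \<xi>) * cis (- (c * (phase s (N k) + grad_phase s (N k) \<bullet> (\<xi> - N k)))))"
    by (simp add: sum_distrib_left mult.assoc inner_commute distrib_left)
  finally show ?thesis .
qed

lemma Linf_norm_le:
  assumes "f \<in> borel_measurable borel" "\<And>x. norm (f x) \<le> C"
  shows "Linf_norm f \<le> ennreal C"
proof -
  have m: "f \<in> borel_measurable lebesgue" using assms(1) by (intro measurable_completion) simp
  show ?thesis
    unfolding Linf_norm_def using m assms(2) by (auto intro!: esssup_I AE_I2 ennreal_leI)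
qed

lemma norm_packet: "norm (packet W p v \<theta> x) = gauss W p x"
  by (simp add: packet_def norm_mult gauss_nonneg)

text \<open>The relation between \<open>R\<close>, \<open>K\<close> and \<open>W\<close> makes the spacing of the packets in space comparable to their width.\<close>

lemma wave_bound:
  assumes s: "s > 1" and c: "c > 0"
  obtains C where "C > 0"
    "\<And>R W K (\<epsilon>::real) x::'a::euclidean_space. R > 0 \<Longrightarrow> W > 0 \<Longrightarrow> K > 0 \<Longrightarrow> \<bar>\<epsilon>\<bar> = 1 \<Longrightarrow> R powr (s - 2) * (R / real K) = W \<Longrightarrow>
       norm (wave s c W (\<lambda>k. \<epsilon> *\<^sub>R freq R K k) K x) \<le> C"
proof -
  have "2 * real DIM('a) \<ge> 1" using DIM_positive[where 'a='a] by linarith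
  then obtain c0 where c0: "c0 > 0"
    "\<And>R (a::'a::euclidean_space) b. R > 0 \<Longrightarrow> R \<le> norm a \<Longrightarrow> norm a \<le> 2 * real DIM('a) * R \<Longrightarrow> R \<le> norm b \<Longrightarrow>
        norm b \<le> 2 * real DIM('a) * R \<Longrightarrow>
       c0 * (R powr (s - 2) * norm (a - b)) \<le> norm (grad_phase s a - grad_phase s b)"
    using grad_phase_separation[OF s] by metis
  show thesis
  proof (rule that[of "(4 * (1 + sqrt 8 / (c * c0))) ^ DIM('a)"])
    show "(4 * (1 + sqrt 8 / (c * c0))) ^ DIM('a) > 0"
      using c c0 by (intro zero_less_power mult_pos_pos add_pos_nonneg) auto
    fix R W K and \<epsilon> :: real and x :: 'a
    assume R: "R > 0" and W: "W > 0" and K: "K > 0" and e: "\<bar>\<epsilon>\<bar> = 1" and eq: "R powr (s - 2) * (R / real K) = W"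
    \<comment> \<open>The sign gives the reflected lattice needed for the second factor of the
      bilinear test; norms and distances are unchanged.\<close>
    define N :: "('a \<Rightarrow> nat) \<Rightarrow> 'a" where "N = (\<lambda>k. \<epsilon> *\<^sub>R freq R K k)"
    have N: "R \<le> norm (N k)" "norm (N k) \<le> 2 * real DIM('a) * R" if "k \<in> lattice K" for k
      using norm_freq[OF that R] e by (auto simp: N_def)
    have "norm (wave s c W N K x) \<le> (\<Sum>k\<in>lattice K. gauss W (c *\<^sub>R grad_phase s (N k)) x)"
      unfolding wave_def by (rule order_trans[OF norm_sum]) (simp add: norm_packet)
    also have "\<dots> \<le> (4 * (1 + sqrt 8 / (c * c0))) ^ DIM('a)"
    proof (rule separated_gauss_sum_bound[OF W])
      show "c * c0 > 0" using c c0 by simp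
      fix k l :: "'a \<Rightarrow> nat" assume kl: "k \<in> lattice K" "l \<in> lattice K"
      define S where "S = (\<Sum>i\<in>(Basis::'a set). (real (k i) - real (l i))\<^sup>2)"
      have "(norm (N k - N l))\<^sup>2 = (norm (freq R K k - freq R K l))\<^sup>2"
        using e by (simp add: N_def flip: scaleR_diff_right)
      then have "(norm (N k - N l))\<^sup>2 = (R / real K)\<^sup>2 * S" by (simp add: norm_freq_diff S_def)
      then have "(R powr (s - 2) * norm (N k - N l))\<^sup>2 = W\<^sup>2 * S"
        unfolding eq[symmetric] by (simp only: power_mult_distrib mult.assoc)
      then have "(c * c0 * W)\<^sup>2 * S = (c * (c0 * (R powr (s - 2) * norm (N k - N l))))\<^sup>2"
        by (simp add: power_mult_distrib)
      also have "\<dots> \<le> (c * norm (grad_phase s (N k) - grad_phase s (N l)))\<^sup>2"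
        using c c0 kl N R by (intro power_mono mult_left_mono c0(2)) auto
      also have "\<dots> = (norm (c *\<^sub>R grad_phase s (N k) - c *\<^sub>R grad_phase s (N l)))\<^sup>2"
        using c by (simp flip: scaleR_diff_right)
      finally show "(c * c0 * W)\<^sup>2 * (\<Sum>i\<in>Basis. (real (k i) - real (l i))\<^sup>2)
          \<le> (norm (c *\<^sub>R grad_phase s (N k) - c *\<^sub>R grad_phase s (N l)))\<^sup>2"
        by (simp add: S_def)
    qed
    finally show "norm (wave s c W (\<lambda>k. \<epsilon> *\<^sub>R freq R K k) K x) \<le> (4 * (1 + sqrt 8 / (c * c0))) ^ DIM('a)"
      by (simp add: N_def)
  qed
qed

section \<open>Pairs of packets\<close>

definition elliptic :: "real \<Rightarrow> 'a::euclidean_space \<times> 'a \<Rightarrow> real" where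
  "elliptic m z = (1 + (norm z)\<^sup>2) powr (m / 2)"

lemma elliptic_nonneg: "0 \<le> elliptic m z" by (simp add: elliptic_def)

lemma elliptic_le_1: "m \<le> 0 \<Longrightarrow> elliptic m z \<le> 1"
  unfolding elliptic_def using powr_mono2'[of "m / 2" 1 "1 + (norm z)\<^sup>2"] by simp

lemma borel_measurable_elliptic [measurable]: "elliptic m \<in> borel_measurable borel"
  unfolding elliptic_def by measurable

text \<open>If |\<xi>| \<ge> R/2 the symbol is at most a multiple of R^m. Otherwise only the bound 1
  is available, but then 2 W |\<xi> - v| \<ge> W R \<ge> R^(s/2), and \<open>k\<close> is chosen
  with s k / 2 \<ge> |m|, so that the polynomial factor compensates R^m. The Gaussian absorbs this
  factor later.\<close>

lemma elliptic_upper: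
  fixes m s :: real
  assumes m: "m \<le> 0" and s: "s > 0"
  obtains C k where "C > 0"
    "\<And>R W (v::'a::euclidean_space) \<xi> \<eta>. 1 \<le> R \<Longrightarrow> 0 < W \<Longrightarrow> R \<le> norm v \<Longrightarrow> R powr (s / 2) \<le> W * R \<Longrightarrow>
       elliptic m (\<xi>, \<eta>) \<le> C * R powr m * (1 + 2 * (W * norm (\<xi> - v))) ^ k"
proof -
  define k where "k = nat \<lceil>2 * \<bar>m\<bar> / s\<rceil>"
  have k: "2 * \<bar>m\<bar> / s \<le> real k" unfolding k_def by linarith
  show thesis
  proof (rule that[of "2 powr (- m)" k])
    show "(2::real) powr (- m) > 0" by simp
    fix R W :: real and v \<xi> \<eta> :: 'a
    assume R: "1 \<le> R" and W: "0 < W" and v: "R \<le> norm v" and WR: "R powr (s / 2) \<le> W * R"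
    define t where "t = W * norm (\<xi> - v)"
    have t: "t \<ge> 0" using W by (simp add: t_def)
    then have t1: "1 \<le> (1 + 2 * t) ^ k" by (intro one_le_power) simp
    have "elliptic m (\<xi>, \<eta>) \<le> 2 powr (- m) * R powr m * (1 + 2 * t) ^ k"
    proof (cases "R / 2 \<le> norm \<xi>")
      case True
      have "(R / 2)\<^sup>2 \<le> (norm \<xi>)\<^sup>2" using True R by (intro power_mono) auto
      also have "\<dots> \<le> 1 + (norm (\<xi>, \<eta>))\<^sup>2" by (simp add: norm_prod_def)
      finally have "elliptic m (\<xi>, \<eta>) \<le> ((R / 2)\<^sup>2) powr (m / 2)"
        unfolding elliptic_def using R m by (intro powr_mono2') auto
      also have "\<dots> = 2 powr (- m) * R powr m"
        using R by (simp add: powr_powr powr_divide powr_minus_divide flip: powr_numeral)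
      also have "\<dots> \<le> 2 powr (- m) * R powr m * (1 + 2 * t) ^ k"
        using mult_left_mono[OF t1, of "2 powr (- m) * R powr m"] by simp
      finally show ?thesis .
    next
      case False
      have "norm v \<le> norm \<xi> + norm (\<xi> - v)" using norm_triangle_sub[of v \<xi>] by (simp add: norm_minus_commute)
      then have "R \<le> 2 * norm (\<xi> - v)" using False v by simp
      then have "W * R \<le> W * (2 * norm (\<xi> - v))" using W by (intro mult_left_mono) auto
      then have "R powr (s / 2) \<le> 1 + 2 * t" using WR by (simp add: t_def)
      moreover have "R powr (s / 2) \<ge> 1" using R s by (simp add: ge_one_powr_ge_zero)
      ultimately have "(R powr (s / 2)) powr real k \<le> (1 + 2 * t) ^ k"
        by (subst powr_realpow) (auto intro!: power_mono)
      moreover have "R powr \<bar>m\<bar> \<le> R powr (s / 2 * real k)"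
        using R s k by (intro powr_mono) (auto simp: field_simps)
      ultimately have "R powr (- m) \<le> (1 + 2 * t) ^ k" using m by (simp add: powr_powr)
      then have "R powr m * R powr (- m) \<le> R powr m * (1 + 2 * t) ^ k" by (intro mult_left_mono) auto
      then have "1 \<le> R powr m * (1 + 2 * t) ^ k" using R by (simp add: powr_minus)
      also have "\<dots> \<le> 2 powr (- m) * (R powr m * (1 + 2 * t) ^ k)"
        using mult_right_mono[of 1 "2 powr (- m)" "R powr m * (1 + 2 * t) ^ k"] m t
        by (simp add: ge_one_powr_ge_zero)
      finally show ?thesis using elliptic_le_1[OF m, of "(\<xi>, \<eta>)"] by simp
    qed
    then show "elliptic m (\<xi>, \<eta>) \<le> 2 powr (- m) * R powr m * (1 + 2 * (W * norm (\<xi> - v))) ^ k"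
      by (simp add: t_def)
  qed
qed

text \<open>Budget for the exponent t^2 / 2 of a packet: t^2 / 8 is granted to the hypothesis on
  \<open>dev\<close> in \<open>pair_estimate\<close>, t^2 / 4 absorbs the polynomials, and t^2 / 8
  remains, which is a Gaussian of twice the width.\<close>

lemma poly_gauss_bound:
  fixes t :: real
  assumes t: "t \<ge> 0"
  shows "(1 + 2 * t) ^ k * (1 + t\<^sup>2) * exp (t\<^sup>2 / 8) * exp (- t\<^sup>2 / 2) \<le> fact (k + 2) * exp 5 * exp (- t\<^sup>2 / 8)"
proof -
  have "1 + t\<^sup>2 \<le> (1 + 2 * t)\<^sup>2" using t by (simp add: power2_eq_square algebra_simps)
  then have "(1 + 2 * t) ^ k * (1 + t\<^sup>2) \<le> (1 + 2 * t) ^ k * (1 + 2 * t)\<^sup>2"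
    using t by (intro mult_left_mono) auto
  also have "\<dots> = (1 + 2 * t) ^ (k + 2)" by (simp only: power_add)
  also have "\<dots> \<le> fact (k + 2) * exp (1 + 2 * t)" using t by (intro power_le_fact_exp) auto
  also have "\<dots> \<le> fact (k + 2) * exp (5 + t\<^sup>2 / 4)"
  proof -
    have "0 \<le> (t / 2 - 2)\<^sup>2" by simp
    then have "1 + 2 * t \<le> 5 + t\<^sup>2 / 4" by (simp add: power2_eq_square field_simps)
    then show ?thesis by (intro mult_left_mono) auto
  qed
  finally have "(1 + 2 * t) ^ k * (1 + t\<^sup>2) * (exp (t\<^sup>2 / 8) * exp (- t\<^sup>2 / 2))
      \<le> fact (k + 2) * exp (5 + t\<^sup>2 / 4) * (exp (t\<^sup>2 / 8) * exp (- t\<^sup>2 / 2))"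
    by (intro mult_right_mono) auto
  also have "\<dots> = fact (k + 2) * exp (5 + t\<^sup>2 / 4 + (t\<^sup>2 / 8 + - t\<^sup>2 / 2))" by (simp only: exp_add mult.assoc)
  also have "5 + t\<^sup>2 / 4 + (t\<^sup>2 / 8 + - t\<^sup>2 / 2) = 5 + - t\<^sup>2 / 8" by simp
  finally show ?thesis by (simp only: exp_add mult.assoc)
qed

lemma elliptic_lower:
  fixes m M :: real
  assumes m: "m \<le> 0" and M: "M \<ge> 1"
  obtains c where "c > 0"
    "\<And>R (\<xi>::'a::euclidean_space) \<eta>. 1 \<le> R \<Longrightarrow> norm \<xi> \<le> (M + 1) * R \<Longrightarrow> norm \<eta> \<le> (M + 1) * R \<Longrightarrow> c * R powr m \<le> elliptic m (\<xi>, \<eta>)"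
proof (rule that[of "(1 + 2 * (M + 1)\<^sup>2) powr (m / 2)"])
  show "(1 + 2 * (M + 1)\<^sup>2) powr (m / 2) > 0" using M by (simp add: add_pos_nonneg less_imp_neq[symmetric])
  fix R :: real and \<xi> \<eta> :: 'a
  assume R: "1 \<le> R" and x: "norm \<xi> \<le> (M + 1) * R" and y: "norm \<eta> \<le> (M + 1) * R"
  have "(norm \<xi>)\<^sup>2 \<le> ((M + 1) * R)\<^sup>2" "(norm \<eta>)\<^sup>2 \<le> ((M + 1) * R)\<^sup>2" "1 \<le> R\<^sup>2"
    using x y R by (auto intro!: power_mono simp: one_le_power)
  then have "1 + ((norm \<xi>)\<^sup>2 + (norm \<eta>)\<^sup>2) \<le> R\<^sup>2 + 2 * ((M + 1) * R)\<^sup>2" by linarith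
  also have "\<dots> = (1 + 2 * (M + 1)\<^sup>2) * R\<^sup>2"
    using distrib_right[of 1 "2 * (M + 1)\<^sup>2" "R\<^sup>2"] power_mult_distrib[of "M + 1" R 2] by simp
  finally have "1 + (norm (\<xi>, \<eta>))\<^sup>2 \<le> (1 + 2 * (M + 1)\<^sup>2) * R\<^sup>2" by (simp add: norm_prod_def)
  then have "((1 + 2 * (M + 1)\<^sup>2) * R\<^sup>2) powr (m / 2) \<le> elliptic m (\<xi>, \<eta>)"
    unfolding elliptic_def using m by (intro powr_mono2') (auto simp: add_pos_nonneg)
  moreover have "((1 + 2 * (M + 1)\<^sup>2) * R\<^sup>2) powr (m / 2) = (1 + 2 * (M + 1)\<^sup>2) powr (m / 2) * R powr m"
    using R by (simp add: powr_mult powr_powr flip: powr_numeral)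
  ultimately show "(1 + 2 * (M + 1)\<^sup>2) powr (m / 2) * R powr m \<le> elliptic m (\<xi>, \<eta>)" by simp
qed

lemma gauss_ge_on_cball:
  assumes "W > 0" "norm (\<xi> - v) \<le> 1 / W"
  shows "exp (- 1 / 2) \<le> gauss (1 / W) v \<xi>"
proof -
  have "(norm (\<xi> - v))\<^sup>2 \<le> (1 / W)\<^sup>2" using assms by (intro power_mono) auto
  then have "(norm (\<xi> - v))\<^sup>2 / (1 / W)\<^sup>2 \<le> 1" using assms by (subst divide_le_eq_1_pos) auto
  then show ?thesis unfolding gauss_def by simp
qed

lemma integral_ge_cball_prod:
  fixes f :: "'a::euclidean_space \<times> 'a \<Rightarrow> real"
  assumes f: "integrable lborel f" and nn: "\<And>z. 0 \<le> f z" and r: "r \<ge> 0" "r' \<ge> 0"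
    and b: "\<And>\<xi> \<eta>. norm (\<xi> - v) \<le> r \<Longrightarrow> norm (\<eta> - u) \<le> r' \<Longrightarrow> b \<le> f (\<xi>, \<eta>)"
  shows "b * (unit_ball_vol (real DIM('a)))\<^sup>2 * r ^ DIM('a) * r' ^ DIM('a) \<le> (LINT z|lborel. f z)"
proof -
  define S where "S = cball v r \<times> cball u r'"
  have "emeasure lborel S = emeasure lborel (cball v r) * emeasure lborel (cball u r')"
    unfolding S_def lborel_prod[symmetric] by (intro lborel.emeasure_pair_measure_Times) auto
  also have "\<dots> = ennreal ((unit_ball_vol (real DIM('a)))\<^sup>2 * r ^ DIM('a) * r' ^ DIM('a))"
    using r by (simp add: emeasure_cball power2_eq_square mult_ac flip: ennreal_mult)
  finally have e: "emeasure lborel S = ennreal ((unit_ball_vol (real DIM('a)))\<^sup>2 * r ^ DIM('a) * r' ^ DIM('a))" .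
  have S: "S \<in> sets lborel" by (simp add: S_def borel_closed closed_Times)
  have mS: "measure lborel S = (unit_ball_vol (real DIM('a)))\<^sup>2 * r ^ DIM('a) * r' ^ DIM('a)"
    using e r by (simp add: measure_def)
  have "b * measure lborel S = (LINT z|lborel. indicator S z * b)"
    using S by simp
  also have "\<dots> \<le> (LINT z|lborel. f z)"
  proof (rule integral_mono[OF _ f])
    show "integrable lborel (\<lambda>z. indicator S z * b)" using S e by simp
    show "indicator S z * b \<le> f z" for z
      using nn[of z] b[of "fst z" "snd z"]
      by (cases z) (auto split: split_indicator simp: S_def dist_norm norm_minus_commute)
  qed
  finally show ?thesis by (simp add: mS mult.assoc)
qed

text \<open>The hypothesis on \<open>dev\<close> bounds the weighted deviation of the
  phase factor from \<open>1\<close> in the coordinates \<open>W (\<xi> - v)\<close> and \<open>V (\<eta> - u)\<close>.\<close>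

lemma pair_estimate:
  fixes m s M :: real
  assumes m: "m \<le> 0" and s: "s > 0" and M: "M \<ge> 1"
  obtains c C where "c > 0" "C > 0"
    "\<And>R W V (v::'a::euclidean_space) u \<Theta> w q w0.
      1 \<le> R \<Longrightarrow> 0 < W \<Longrightarrow> 0 < V \<Longrightarrow> R \<le> norm v \<Longrightarrow> norm v \<le> M * R \<Longrightarrow> norm u \<le> M * R \<Longrightarrow>
      R powr (s / 2) \<le> W * R \<Longrightarrow> 1 \<le> V * R \<Longrightarrow>
      \<Theta> \<in> borel_measurable borel \<Longrightarrow> w \<in> borel_measurable borel \<Longrightarrow>
      (\<And>z. 0 \<le> w z) \<Longrightarrow> (\<And>z. w z \<le> 1) \<Longrightarrow> 0 \<le> q \<Longrightarrow> 0 \<le> w0 \<Longrightarrow>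
      (\<And>\<xi> \<eta>. w (\<xi>, \<eta>) * dev (\<Theta> (\<xi>, \<eta>)) \<le> q * ((1 + (W * norm (\<xi> - v))\<^sup>2) * exp ((W * norm (\<xi> - v))\<^sup>2 / 8) *
          ((1 + (V * norm (\<eta> - u))\<^sup>2) * exp ((V * norm (\<eta> - u))\<^sup>2 / 8)))) \<Longrightarrow>
      (\<And>\<xi> \<eta>. norm (\<xi> - v) \<le> 1 / W \<Longrightarrow> norm (\<eta> - u) \<le> 1 / V \<Longrightarrow> w0 \<le> w (\<xi>, \<eta>)) \<Longrightarrow>
      integrable lborel (\<lambda>z. cis (\<Theta> z) * complex_of_real (w z * elliptic m z * (gauss (1 / W) v (fst z) * gauss (1 / V) u (snd z)))) \<and>
      (c * w0 - C * q) * R powr m / (W ^ DIM('a) * V ^ DIM('a)) \<le>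
        Re (LINT z|lborel. cis (\<Theta> z) * complex_of_real (w z * elliptic m z * (gauss (1 / W) v (fst z) * gauss (1 / V) u (snd z))))"
proof -
  obtain C1 k where C1: "C1 > 0" and up:
    "\<And>R W (v::'a::euclidean_space) \<xi> \<eta>. 1 \<le> R \<Longrightarrow> 0 < W \<Longrightarrow> R \<le> norm v \<Longrightarrow> R powr (s / 2) \<le> W * R \<Longrightarrow>
       elliptic m (\<xi>, \<eta>) \<le> C1 * R powr m * (1 + 2 * (W * norm (\<xi> - v))) ^ k"
    using elliptic_upper[OF m s] by metis
  obtain c1 where c1: "c1 > 0" and low:
    "\<And>R (\<xi>::'a::euclidean_space) \<eta>. 1 \<le> R \<Longrightarrow> norm \<xi> \<le> (M + 1) * R \<Longrightarrow> norm \<eta> \<le> (M + 1) * R \<Longrightarrow> c1 * R powr m \<le> elliptic m (\<xi>, \<eta>)"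
    using elliptic_lower[OF m M] by metis
  define n where "n = DIM('a)"
  define F0 :: real where "F0 = fact (k + 2) * exp 5"
  define F1 :: real where "F1 = fact (0 + 2) * exp 5"
  \<comment> \<open>\<open>c\<close> comes from the size of the integrand on balls of radius 1/W and
    1/V, where each Gaussian is at least exp (- 1/2); \<open>C\<close> carries the mass of the
    dominating Gaussians of twice the width.\<close>
  define c where "c = c1 * (exp (- 1 / 2))\<^sup>2 * (unit_ball_vol (real DIM('a)))\<^sup>2"
  define C where "C = C1 * F0 * F1 * ((sqrt (2 * pi) * 2) ^ n)\<^sup>2"
  show thesis
  proof (rule that[of c C])
    show "c > 0" using c1 unit_ball_vol_pos[of "real DIM('a)"] unfolding c_def by (intro mult_pos_pos zero_less_power) auto
    show "C > 0" using C1 by (simp add: C_def F0_def F1_def)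
    \<comment> \<open>Two regimes are foreseen: \<open>w = 1\<close> with \<open>w0 = 1\<close>, and
      a Gaussian window \<open>w\<close> in \<xi> + \<eta>, with \<open>w0 = 0\<close> for pairs of
      packets that the window hardly sees.\<close>
    fix R W V :: real and v u :: 'a and \<Theta> w :: "'a \<times> 'a \<Rightarrow> real" and q w0 :: real
    assume R: "1 \<le> R" and W: "0 < W" and V: "0 < V" and v: "R \<le> norm v" "norm v \<le> M * R" and u: "norm u \<le> M * R"
      and WR: "R powr (s / 2) \<le> W * R" and VR: "1 \<le> V * R"
      and [measurable]: "\<Theta> \<in> borel_measurable borel" "w \<in> borel_measurable borel"
      and w: "\<And>z. 0 \<le> w z" "\<And>z. w z \<le> 1" and q: "0 \<le> q" and w0: "0 \<le> w0"
      and devb: "\<And>\<xi> \<eta>. w (\<xi>, \<eta>) * dev (\<Theta> (\<xi>, \<eta>)) \<le> q * ((1 + (W * norm (\<xi> - v))\<^sup>2) * exp ((W * norm (\<xi> - v))\<^sup>2 / 8) *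
          ((1 + (V * norm (\<eta> - u))\<^sup>2) * exp ((V * norm (\<eta> - u))\<^sup>2 / 8)))"
      and wl: "\<And>\<xi> \<eta>. norm (\<xi> - v) \<le> 1 / W \<Longrightarrow> norm (\<eta> - u) \<le> 1 / V \<Longrightarrow> w0 \<le> w (\<xi>, \<eta>)"
    define P where "P = (\<lambda>z. gauss (1 / W) v (fst z) * gauss (1 / V) u (snd z))"
    define G where "G = (\<lambda>z. w z * elliptic m z * P z)"
    define H where "H = (\<lambda>z. q * (C1 * R powr m) * F0 * F1 * (gauss (2 / W) v (fst z) * gauss (2 / V) u (snd z)))"
    have [measurable]: "P \<in> borel_measurable borel" unfolding P_def borel_prod[symmetric] by measurable
    have [measurable]: "G \<in> borel_measurable borel" unfolding G_def by measurable
    have Pn: "0 \<le> P z" for z by (simp add: P_def gauss_nonneg)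
    have Gn: "0 \<le> G z" for z using w Pn by (simp add: G_def elliptic_nonneg)
    have iP: "integrable lborel P"
      using has_bochner_integral_gauss_prod[of "1 / W" "1 / V" v u] W V
      by (simp add: has_bochner_integral_iff P_def case_prod_beta')
    have GP: "G z \<le> P z" for z
    proof -
      have "w z * elliptic m z \<le> 1"
        by (rule mult_le_one[OF w(2) elliptic_nonneg elliptic_le_1[OF m]])
      then show ?thesis unfolding G_def using mult_right_mono[OF _ Pn[of z], of _ 1] by simp
    qed
    have iG: "integrable lborel G"
      by (rule Bochner_Integration.integrable_bound[OF iP]) (use Gn GP Pn in \<open>auto simp: abs_of_nonneg\<close>)
    have icis: "integrable lborel (\<lambda>z. cis (\<Theta> z) * complex_of_real (G z))"
      by (rule Bochner_Integration.integrable_bound[OF iG]) (auto simp: norm_mult)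
    have hH: "has_bochner_integral lborel H (C * q * R powr m / (W ^ n * V ^ n))"
    proof -
      have "has_bochner_integral lborel H (q * (C1 * R powr m) * F0 * F1 * ((sqrt (2 * pi) * (2 / W)) ^ n * (sqrt (2 * pi) * (2 / V)) ^ n))"
        unfolding H_def n_def using has_bochner_integral_gauss_prod[of "2 / W" "2 / V" v u] W V
        by (intro has_bochner_integral_mult_right) (simp add: case_prod_beta')
      then show ?thesis
        by (simp add: C_def power_mult_distrib power_divide power2_eq_square mult_ac)
    qed
    have GH: "G z * dev (\<Theta> z) \<le> H z" for z
    proof -
      define \<xi> \<eta> where "\<xi> = fst z" and "\<eta> = snd z"
      have z: "z = (\<xi>, \<eta>)" by (simp add: \<xi>_def \<eta>_def)
      define a b where "a = W * norm (\<xi> - v)" and "b = V * norm (\<eta> - u)"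
      have ab: "a \<ge> 0" "b \<ge> 0" using W V by (auto simp: a_def b_def)
      have ga: "gauss (1 / W) v \<xi> = exp (- a\<^sup>2 / 2)" "gauss (2 / W) v \<xi> = exp (- a\<^sup>2 / 8)"
        using W by (simp_all add: gauss_def a_def power_divide power_mult_distrib field_simps)
      have gb: "gauss (1 / V) u \<eta> = exp (- b\<^sup>2 / 2)" "gauss (2 / V) u \<eta> = exp (- b\<^sup>2 / 8)"
        using V by (simp_all add: gauss_def b_def power_divide power_mult_distrib field_simps)
      have "G z * dev (\<Theta> z) = (w (\<xi>, \<eta>) * dev (\<Theta> (\<xi>, \<eta>))) * elliptic m (\<xi>, \<eta>) * (exp (- a\<^sup>2 / 2) * exp (- b\<^sup>2 / 2))"
        by (simp add: G_def P_def z ga gb mult_ac)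
      also have "\<dots> \<le> (q * ((1 + a\<^sup>2) * exp (a\<^sup>2 / 8) * ((1 + b\<^sup>2) * exp (b\<^sup>2 / 8)))) * (C1 * R powr m * (1 + 2 * a) ^ k)
            * (exp (- a\<^sup>2 / 2) * exp (- b\<^sup>2 / 2))"
        by (intro mult_right_mono[OF mult_mono[OF devb[of \<xi> \<eta>, folded a_def b_def] up[OF R W v(1) WR, of \<xi> \<eta>, folded a_def]]])
           (use q in \<open>auto simp: elliptic_nonneg\<close>)
      also have "\<dots> = q * (C1 * R powr m) * ((1 + 2 * a) ^ k * (1 + a\<^sup>2) * exp (a\<^sup>2 / 8) * exp (- a\<^sup>2 / 2)) *
            ((1 + 2 * b) ^ 0 * (1 + b\<^sup>2) * exp (b\<^sup>2 / 8) * exp (- b\<^sup>2 / 2))"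
        by (simp add: mult_ac)
      also have "\<dots> \<le> q * (C1 * R powr m) * (F0 * exp (- a\<^sup>2 / 8)) * (F1 * exp (- b\<^sup>2 / 8))"
        unfolding F0_def F1_def
        by (intro mult_mono[OF mult_left_mono[OF poly_gauss_bound[OF ab(1)]] poly_gauss_bound[OF ab(2)]])
           (use q C1 ab in auto)
      also have "\<dots> = H z" by (simp add: H_def z ga gb mult_ac)
      finally show ?thesis .
    qed
    \<comment> \<open>The gain: only the product of the two balls is kept, and there |\<xi>| and
      |\<eta>| are at most (M + 1) R because both radii are at most R.\<close>
    have "c * w0 * R powr m / (W ^ n * V ^ n) \<le> (LINT z|lborel. G z)"
    proof -
      have 1: "1 / W \<le> R" "1 / V \<le> R"
      proof -
        have "1 \<le> R powr (s / 2)" using R s by (simp add: ge_one_powr_ge_zero)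
        then show "1 / W \<le> R" "1 / V \<le> R" using WR VR W V by (auto simp: field_simps)
      qed
      have "w0 * (c1 * R powr m) * (exp (- 1 / 2) * exp (- 1 / 2)) \<le> G (\<xi>, \<eta>)"
        if "norm (\<xi> - v) \<le> 1 / W" "norm (\<eta> - u) \<le> 1 / V" for \<xi> \<eta>
      proof -
        have "norm \<xi> \<le> (M + 1) * R" "norm \<eta> \<le> (M + 1) * R"
          using norm_triangle_sub[of \<xi> v] norm_triangle_sub[of \<eta> u] that v u 1 by (auto simp: algebra_simps)
        then have "c1 * R powr m \<le> elliptic m (\<xi>, \<eta>)" using low R by blast
        then show ?thesis
          unfolding G_def P_def using wl[OF that] gauss_ge_on_cball[OF W that(1)] gauss_ge_on_cball[OF V that(2)] w0 c1 w
          by (auto intro!: mult_mono mult_nonneg_nonneg simp: gauss_nonneg elliptic_nonneg)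
      qed
      then have "w0 * (c1 * R powr m) * (exp (- 1 / 2) * exp (- 1 / 2)) * (unit_ball_vol (real DIM('a)))\<^sup>2 * (1 / W) ^ DIM('a) * (1 / V) ^ DIM('a)
          \<le> (LINT z|lborel. G z)"
        using W V by (intro integral_ge_cball_prod[OF iG Gn]) auto
      then show ?thesis
        by (simp add: c_def n_def power_divide power2_eq_square mult_ac)
    qed
    moreover have "(LINT z|lborel. G z) - (LINT z|lborel. H z) \<le> Re (LINT z|lborel. cis (\<Theta> z) * complex_of_real (G z))"
    proof -
      have "(LINT z|lborel. G z) - (LINT z|lborel. H z) = (LINT z|lborel. G z - H z)"
        using iG hH by (intro Bochner_Integration.integral_diff[symmetric]) (auto simp: has_bochner_integral_iff)
      also have "\<dots> \<le> (LINT z|lborel. Re (cis (\<Theta> z) * complex_of_real (G z)))"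
      proof (rule integral_mono)
        show "integrable lborel (\<lambda>z. G z - H z)" using iG hH by (auto simp: has_bochner_integral_iff)
        show "integrable lborel (\<lambda>z. Re (cis (\<Theta> z) * complex_of_real (G z)))" by (intro integrable_Re icis)
        show "G z - H z \<le> Re (cis (\<Theta> z) * complex_of_real (G z))" for z
          using GH[of z] mult_left_mono[OF Re_cis_ge[of "\<Theta> z"] Gn[of z]] by (simp add: algebra_simps)
      qed
      also have "\<dots> = Re (LINT z|lborel. cis (\<Theta> z) * complex_of_real (G z))" by (rule integral_Re[OF icis])
      finally show ?thesis .
    qed
    ultimately have "(c * w0 - C * q) * R powr m / (W ^ n * V ^ n) \<le> Re (LINT z|lborel. cis (\<Theta> z) * complex_of_real (G z))"
      using hH by (simp add: has_bochner_integral_iff left_diff_distrib diff_divide_distrib)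
    with icis show "integrable lborel (\<lambda>z. cis (\<Theta> z) * complex_of_real (w z * elliptic m z * (gauss (1 / W) v (fst z) * gauss (1 / V) u (snd z)))) \<and>
      (c * w0 - C * q) * R powr m / (W ^ DIM('a) * V ^ DIM('a)) \<le>
        Re (LINT z|lborel. cis (\<Theta> z) * complex_of_real (w z * elliptic m z * (gauss (1 / W) v (fst z) * gauss (1 / V) u (snd z))))"
      by (simp add: G_def P_def n_def)
  qed
qed

section \<open>The bilinear operator on pairs of waves, and auxiliary estimates for the two
  tests\<close>

definition symb :: "real \<Rightarrow> real \<Rightarrow> 'a::euclidean_space \<times> 'a \<Rightarrow> complex" where
  "symb s m = (\<lambda>(\<xi>, \<eta>). exp (\<i> * complex_of_real (norm \<xi> powr s + norm \<eta> powr s + norm (\<xi> + \<eta>) powr s))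
                    * complex_of_real (elliptic m (\<xi>, \<eta>)))"

lemma borel_measurable_phase [measurable]: "phase s \<in> borel_measurable borel"
  unfolding phase_def by measurable

text \<open>The phase of the integrand of \<open>T(f, g)(0)\<close> for a packet of \<open>f\<close> with frequency \<open>v\<close> and a packet of \<open>g\<close> with
  frequency \<open>u\<close>.\<close>

definition pair_phase :: "real \<Rightarrow> real \<Rightarrow> real \<Rightarrow> 'a::euclidean_space \<Rightarrow> 'a \<Rightarrow> 'a \<times> 'a \<Rightarrow> real" where
  "pair_phase s c c' v u z = phase s (fst z) + phase s (snd z) + phase s (fst z + snd z)
     - c * (phase s v + grad_phase s v \<bullet> (fst z - v)) - c' * (phase s u + grad_phase s u \<bullet> (snd z - u))"

lemma borel_measurable_pair_phase [measurable]: "pair_phase s c c' v u \<in> borel_measurable borel"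
  unfolding pair_phase_def borel_prod[symmetric] by measurable

lemma borel_measurable_gauss_pair [measurable]: "(\<lambda>z. gauss A v (fst z) * gauss B u (snd z)) \<in> borel_measurable borel"
  unfolding borel_prod[symmetric] by measurable

lemma bilinear_wave:
  fixes x :: "'a::euclidean_space"
  assumes W: "W > 0" and V: "V > 0"
  shows "bilinear_op (symb s m) (wave s c W N K) (wave s c' V N' K') x =
    complex_of_real ((sqrt (2 * pi) * W) ^ DIM('a) * (sqrt (2 * pi) * V) ^ DIM('a) / (2 * pi) ^ (2 * DIM('a))) *
    (LINT z|lborel. (\<Sum>k\<in>lattice K. \<Sum>l\<in>lattice K'.
       cis (x \<bullet> (fst z + snd z) + pair_phase s c c' (N k) (N' l) z) *
       complex_of_real (elliptic m z * (gauss (1 / W) (N k) (fst z) * gauss (1 / V) (N' l) (snd z)))))"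
proof -
  let ?G = "complex_of_real ((sqrt (2 * pi) * W) ^ DIM('a))" and ?H = "complex_of_real ((sqrt (2 * pi) * V) ^ DIM('a))"
  define I where "I = (\<lambda>z::'a \<times> 'a. \<Sum>k\<in>lattice K. \<Sum>l\<in>lattice K'.
       cis (x \<bullet> (fst z + snd z) + pair_phase s c c' (N k) (N' l) z) *
       complex_of_real (elliptic m z * (gauss (1 / W) (N k) (fst z) * gauss (1 / V) (N' l) (snd z))))"
  have x: "(\<lambda>z::'a \<times> 'a. x \<bullet> (fst z + snd z)) \<in> borel_measurable borel"
    unfolding borel_prod[symmetric] by measurable
  have mI: "I \<in> borel_measurable borel"
    unfolding I_def
  proof (intro borel_measurable_sum)
    fix k l
    note [measurable] = x
    have g [measurable]: "(\<lambda>z. gauss (1 / W) (N k) (fst z) * gauss (1 / V) (N' l) (snd z)) \<in> borel_measurable borel"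
      by (rule borel_measurable_gauss_pair)
    show "(\<lambda>z. cis (x \<bullet> (fst z + snd z) + pair_phase s c c' (N k) (N' l) z) *
       complex_of_real (elliptic m z * (gauss (1 / W) (N k) (fst z) * gauss (1 / V) (N' l) (snd z)))) \<in> borel_measurable borel"
      by (rule borel_measurable_times[OF _ measurable_compose[OF borel_measurable_times[OF _ g] borel_measurable_of_real]]) measurable
  qed
  have pair: "exp (\<i> * complex_of_real (x \<bullet> (\<xi> + \<eta>))) * symb s m (\<xi>, \<eta>) *
       (complex_of_real g * cis (- (c * (phase s v + grad_phase s v \<bullet> (\<xi> - v))))) *
       (complex_of_real h * cis (- (c' * (phase s u + grad_phase s u \<bullet> (\<eta> - u)))))
     = cis (x \<bullet> (\<xi> + \<eta>) + pair_phase s c c' v u (\<xi>, \<eta>)) * complex_of_real (elliptic m (\<xi>, \<eta>) * (g * h))" for \<xi> \<eta> v u g h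
  proof -
    have "cis (x \<bullet> (\<xi> + \<eta>) + pair_phase s c c' v u (\<xi>, \<eta>))
       = cis (x \<bullet> (\<xi> + \<eta>)) * cis (norm \<xi> powr s + norm \<eta> powr s + norm (\<xi> + \<eta>) powr s) *
         cis (- (c * (phase s v + grad_phase s v \<bullet> (\<xi> - v)))) * cis (- (c' * (phase s u + grad_phase s u \<bullet> (\<eta> - u))))"
      unfolding cis_mult pair_phase_def phase_def by (simp add: algebra_simps)
    then show ?thesis unfolding symb_def prod.case cis_conv_exp[symmetric] by (simp add: mult_ac)
  qed
  have "exp (\<i> * complex_of_real (x \<bullet> (\<xi> + \<eta>))) * symb s m (\<xi>, \<eta>) * fourier (wave s c W N K) \<xi> * fourier (wave s c' V N' K') \<eta>
     = ?G * ?H * I (\<xi>, \<eta>)" for \<xi> \<eta>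
  proof -
    let ?E = "exp (\<i> * complex_of_real (x \<bullet> (\<xi> + \<eta>))) * symb s m (\<xi>, \<eta>)"
    let ?a = "\<lambda>k. complex_of_real (gauss (1 / W) (N k) \<xi>) * cis (- (c * (phase s (N k) + grad_phase s (N k) \<bullet> (\<xi> - N k))))"
    let ?b = "\<lambda>l. complex_of_real (gauss (1 / V) (N' l) \<eta>) * cis (- (c' * (phase s (N' l) + grad_phase s (N' l) \<bullet> (\<eta> - N' l))))"
    have "?E * fourier (wave s c W N K) \<xi> * fourier (wave s c' V N' K') \<eta>
        = ?G * ?H * (?E * (sum ?a (lattice K) * sum ?b (lattice K')))"
      unfolding fourier_wave[OF W] fourier_wave[OF V] by (simp only: mult_ac)
    also have "?E * (sum ?a (lattice K) * sum ?b (lattice K')) = (\<Sum>k\<in>lattice K. \<Sum>l\<in>lattice K'. ?E * ?a k * ?b l)"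
      unfolding sum_product unfolding sum_distrib_left by (simp only: mult.assoc)
    also have "\<dots> = I (\<xi>, \<eta>)"
      unfolding I_def pair by simp
    finally show ?thesis .
  qed
  then have "bilinear_op (symb s m) (wave s c W N K) (wave s c' V N' K') x =
     complex_of_real (1 / (2 * pi) ^ (2 * DIM('a))) * (LINT z|lebesgue. ?G * ?H * I z)"
    unfolding bilinear_op_def by (simp add: case_prod_beta')
  also have "(LINT z|lebesgue. ?G * ?H * I z) = ?G * ?H * (LINT z|lborel. I z)"
    using mI by (subst integral_completion) auto
  finally show ?thesis unfolding I_def by simp
qed

lemma powr_ln_contradiction:
  fixes e P D1 D2 :: real
  assumes e: "e > 0" and P: "P > 0" and b: "\<And>K::nat. K \<ge> K0 \<Longrightarrow> P * real K powr e \<le> D1 + D2 * ln (real K)"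
  shows False
proof -
  have "filterlim (\<lambda>K::nat. P * real K powr e - D1 - D2 * ln (real K)) at_top sequentially"
    using e P by real_asymp
  then have "eventually (\<lambda>K::nat. P * real K powr e - D1 - D2 * ln (real K) > 0) sequentially"
    unfolding filterlim_at_top_dense by blast
  then have "eventually (\<lambda>K::nat. P * real K powr e - D1 - D2 * ln (real K) > 0 \<and> K \<ge> K0) sequentially"
    using eventually_ge_at_top[of K0] by (rule eventually_conj)
  then obtain K :: nat where "K \<ge> K0" "P * real K powr e - D1 - D2 * ln (real K) > 0"
    unfolding eventually_sequentially by blast
  then show False using b[of K] by linarith
qed

text \<open>The wide Gaussian of the linear test is a wave with a single packet of frequency 0, so
  that \<open>bilinear_wave\<close> covers both tests.\<close>

lemma wave_single:
  assumes "s > 0"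
  shows "wave s c V (\<lambda>_. 0) 1 x = complex_of_real (gauss V 0 (x::'a::euclidean_space))"
proof -
  have "lattice 1 = {\<lambda>b::'a. if b \<in> Basis then 0 else undefined}"
    unfolding lattice_def by (auto simp: fun_eq_iff PiE_iff extensional_def lessThan_Suc)
  then show ?thesis using assms by (simp add: wave_def packet_def grad_phase_def phase_def)
qed

lemma norm_le_of_dyadic_cube:
  fixes x :: "'a::euclidean_space"
  assumes "x \<in> cbox 0 (r *\<^sub>R One)"
  shows "norm x \<le> real DIM('a) * r"
proof -
  have "norm x \<le> (\<Sum>b\<in>Basis. \<bar>x \<bullet> b\<bar>)" by (rule norm_le_l1)
  also have "\<dots> \<le> (\<Sum>b\<in>(Basis::'a set). r)"
    using assms by (intro sum_mono) (auto simp: mem_box)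
  finally show ?thesis by simp
qed

text \<open>Both weights are at least 1, so each quadratic error is bounded by their product; this
  brings a sum of errors into the shape that \<open>pair_estimate\<close> expects.\<close>

lemma exp_factor_le:
  fixes a b p1 p2 :: real
  assumes "p1 \<ge> 0" "p2 \<ge> 0" "p1 + p2 \<le> q"
  shows "p1 * (1 + a\<^sup>2) + p2 * (1 + b\<^sup>2) \<le> q * ((1 + a\<^sup>2) * exp (a\<^sup>2 / 8) * ((1 + b\<^sup>2) * exp (b\<^sup>2 / 8)))"
proof -
  define x y where "x = (1 + a\<^sup>2) * exp (a\<^sup>2 / 8)" and "y = (1 + b\<^sup>2) * exp (b\<^sup>2 / 8)"
  have x: "1 + a\<^sup>2 \<le> x" "1 + b\<^sup>2 \<le> y"
    using mult_left_mono[of 1 "exp (a\<^sup>2 / 8)" "1 + a\<^sup>2"] mult_left_mono[of 1 "exp (b\<^sup>2 / 8)" "1 + b\<^sup>2"]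
    by (simp_all add: x_def y_def)
  then have x1: "1 \<le> x" "1 \<le> y" using zero_le_power2[of a] zero_le_power2[of b] by linarith+
  have "x * 1 \<le> x * y" "1 * y \<le> x * y" using x1 by (intro mult_left_mono mult_right_mono; simp)+
  then have "1 + a\<^sup>2 \<le> x * y" "1 + b\<^sup>2 \<le> x * y" using x by linarith+
  then have "p1 * (1 + a\<^sup>2) \<le> p1 * (x * y)" "p2 * (1 + b\<^sup>2) \<le> p2 * (x * y)"
    using assms by (intro mult_left_mono; simp)+
  moreover have "(p1 + p2) * (x * y) \<le> q * (x * y)"
    using assms x1 by (intro mult_right_mono) auto
  ultimately show ?thesis unfolding x_def[symmetric] y_def[symmetric] by (simp add: algebra_simps)
qed

text \<open>The factor W^n V^n is exactly the denominator in \<open>pair_estimate\<close>. A pair of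
  packets thus contributes a multiple of R^m whatever its widths are, and V can be taken as large as
  desired.\<close>

lemma gauss_constant:
  fixes W V :: real
  shows "(sqrt (2 * pi) * W) ^ n * (sqrt (2 * pi) * V) ^ n / (2 * pi) ^ (2 * n) = (1 / (2 * pi)) ^ n * (W ^ n * V ^ n)"
proof -
  have rr: "sqrt (2 * pi) * sqrt (2 * pi) = 2 * pi" by simp
  have "(sqrt (2 * pi) * W) ^ n * (sqrt (2 * pi) * V) ^ n = ((sqrt (2 * pi) * sqrt (2 * pi)) * (W * V)) ^ n"
    unfolding power_mult_distrib[symmetric] by (simp only: mult_ac)
  also have "\<dots> = (2 * pi) ^ n * (W ^ n * V ^ n)"
    unfolding rr power_mult_distrib[of "2 * pi" "W * V"] power_mult_distrib[of W V] ..
  finally have e: "(sqrt (2 * pi) * W) ^ n * (sqrt (2 * pi) * V) ^ n = (2 * pi) ^ n * (W ^ n * V ^ n)" .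
  have "(2 * pi) ^ (2 * n) = (2 * pi) ^ n * (2 * pi) ^ n" by (simp only: mult_2 power_add)
  then show ?thesis unfolding e by (simp add: power_one_over)
qed

text \<open>Integrating in x before z turns the test Gaussian of width \<open>L\<close> into a
  Gaussian window of width 1/L in the output frequency \<xi> + \<eta>.\<close>

lemma gauss_pairing_fubini:
  fixes E \<psi> :: "'a::euclidean_space \<times> 'a \<Rightarrow> real"
  assumes L: "L > 0" and E: "integrable lborel E" "\<And>z. 0 \<le> E z" and \<psi> [measurable]: "\<psi> \<in> borel_measurable borel"
  shows "has_bochner_integral lborel
      (\<lambda>x. complex_of_real (gauss L 0 x) * (LINT z|lborel. cis (x \<bullet> (fst z + snd z) + \<psi> z) * complex_of_real (E z)))
      (complex_of_real ((sqrt (2 * pi) * L) ^ DIM('a)) *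
        (LINT z|lborel. cis (\<psi> z) * complex_of_real (gauss (1 / L) 0 (fst z + snd z) * E z)))"
proof -
  have [measurable]: "E \<in> borel_measurable borel" using E(1) by auto
  define F where "F = (\<lambda>x z. complex_of_real (gauss L 0 x) * (cis (x \<bullet> (fst z + snd z) + \<psi> z) * complex_of_real (E z)))"
  have nF: "norm (F x z) = gauss L 0 x * E z" for x z
    using E(2) by (simp add: F_def norm_mult gauss_nonneg)
  have mF: "case_prod F \<in> borel_measurable (lborel \<Otimes>\<^sub>M lborel)"
  proof -
    have i: "(\<lambda>p::'a \<times> 'a \<times> 'a. fst p \<bullet> (fst (snd p) + snd (snd p))) \<in> borel_measurable (borel \<Otimes>\<^sub>M borel)"
      unfolding borel_prod by (intro borel_measurable_continuous_onI continuous_intros)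
    have [measurable]: "(\<lambda>p::'a \<times> 'a \<times> 'a. fst p \<bullet> (fst (snd p) + snd (snd p))) \<in> borel_measurable (lborel \<Otimes>\<^sub>M lborel)"
      using i by (simp cong: measurable_cong_sets sets_pair_measure_cong)
    show ?thesis unfolding F_def case_prod_beta' by measurable
  qed
  have iF: "integrable (lborel \<Otimes>\<^sub>M lborel) (case_prod F)"
  proof (rule lborel_pair.Fubini_integrable[OF mF])
    show "integrable lborel (\<lambda>x. LINT z|lborel. norm (case (x, z) of (x, z) \<Rightarrow> F x z))"
      using has_bochner_integral_gauss[OF L, of "0::'a"] by (simp add: nF has_bochner_integral_iff)
    show "AE x in lborel. integrable lborel (\<lambda>z. case (x, z) of (x, z) \<Rightarrow> F x z)"
    proof (intro AE_I2)
      fix x :: 'a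
      have [measurable]: "(\<lambda>z::'a \<times> 'a. x \<bullet> (fst z + snd z)) \<in> borel_measurable borel"
        unfolding borel_prod[symmetric] by measurable
      have m: "(\<lambda>z. F x z) \<in> borel_measurable lborel" unfolding F_def by measurable
      have "integrable lborel (\<lambda>z. gauss L 0 x * E z)" using E by simp
      then show "integrable lborel (\<lambda>z. case (x, z) of (x, z) \<Rightarrow> F x z)"
        by (rule Bochner_Integration.integrable_bound) (use m in \<open>auto simp: nF\<close>)
    qed
  qed
  have inner: "(LINT x|lborel. F x z) = complex_of_real ((sqrt (2 * pi) * L) ^ DIM('a)) *
      (cis (\<psi> z) * complex_of_real (gauss (1 / L) 0 (fst z + snd z) * E z))" for z
  proof -
    have "has_bochner_integral lborel (\<lambda>x::'a. (cis (\<psi> z) * complex_of_real (E z)) * (complex_of_real (gauss L 0 x) * cis ((fst z + snd z) \<bullet> x)))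
       ((cis (\<psi> z) * complex_of_real (E z)) * (complex_of_real ((sqrt (2 * pi) * L) ^ DIM('a) * gauss (1 / L) 0 (fst z + snd z)) * cis ((fst z + snd z) \<bullet> 0)))"
      by (intro has_bochner_integral_mult_right has_bochner_integral_gauss_cis[OF L])
    moreover have "(\<lambda>x::'a. (cis (\<psi> z) * complex_of_real (E z)) * (complex_of_real (gauss L 0 x) * cis ((fst z + snd z) \<bullet> x))) = (\<lambda>x. F x z)"
      unfolding F_def by (auto simp: fun_eq_iff inner_commute cis_mult[symmetric])
    ultimately have "has_bochner_integral lborel (\<lambda>x. F x z)
       ((cis (\<psi> z) * complex_of_real (E z)) * (complex_of_real ((sqrt (2 * pi) * L) ^ DIM('a) * gauss (1 / L) 0 (fst z + snd z)) * cis ((fst z + snd z) \<bullet> 0)))"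
      by (simp only:)
    from has_bochner_integral_integral_eq[OF this] show ?thesis by (simp add: mult_ac)
  qed
  have "integrable lborel (\<lambda>x. LINT z|lborel. F x z)"
    using lborel_pair.integrable_fst[OF iF] .
  moreover have "(LINT x|lborel. (LINT z|lborel. F x z)) = (LINT z|lborel. (LINT x|lborel. F x z))"
    using lborel_pair.Fubini_integral[OF iF] by simp
  moreover have "(LINT z|lborel. F x z) = complex_of_real (gauss L 0 x) * (LINT z|lborel. cis (x \<bullet> (fst z + snd z) + \<psi> z) * complex_of_real (E z))" for x
    unfolding F_def by simp
  ultimately show ?thesis
    unfolding has_bochner_integral_iff inner by simp
qed

lemma integrable_elliptic_gauss:
  fixes v u :: "'a::euclidean_space"
  assumes "m \<le> 0" "A > 0" "B > 0"
  shows "integrable lborel (\<lambda>z. elliptic m z * (gauss A v (fst z) * gauss B u (snd z)))"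
proof (rule Bochner_Integration.integrable_bound)
  show "integrable lborel (\<lambda>z. gauss A v (fst z) * gauss B u (snd z))"
    using has_bochner_integral_gauss_prod[OF assms(2,3), of v u] by (simp add: has_bochner_integral_iff case_prod_beta')
  have g [measurable]: "(\<lambda>z. gauss A v (fst z) * gauss B u (snd z)) \<in> borel_measurable borel"
    by (rule borel_measurable_gauss_pair)
  show "(\<lambda>z. elliptic m z * (gauss A v (fst z) * gauss B u (snd z))) \<in> borel_measurable lborel" by measurable
  show "AE z in lborel. norm (elliptic m z * (gauss A v (fst z) * gauss B u (snd z))) \<le> norm (gauss A v (fst z) * gauss B u (snd z))"
  proof (intro AE_I2)
    fix z :: "'a \<times> 'a"
    have "elliptic m z * (gauss A v (fst z) * gauss B u (snd z)) \<le> 1 * (gauss A v (fst z) * gauss B u (snd z))"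
      by (intro mult_right_mono elliptic_le_1 assms mult_nonneg_nonneg gauss_nonneg)
    then show "norm (elliptic m z * (gauss A v (fst z) * gauss B u (snd z))) \<le> norm (gauss A v (fst z) * gauss B u (snd z))"
      by (simp add: abs_mult gauss_nonneg abs_of_nonneg[OF elliptic_nonneg])
  qed
qed

text \<open>The second packet has frequency -v'. With t = |\<xi> + \<eta>| / \<kappa> the window exp
  (- t^2 / 2) is split into two equal factors. One absorbs the t in the bound 2 \<kappa> t for the
  uncancelled phase of \<xi> + \<eta>. The other yields the decay in |v - v'|, which is at most
  |\<xi> + \<eta>| + |\<xi> - v| + |\<eta> + v'|; the last two terms cost exponential factors that
  \<open>pair_estimate\<close> tolerates, because \<kappa> W \<ge> 2. Here 12 = 3 * 4: three terms
  are squared, and half the window has exponent t^2 / 4.\<close>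

lemma window_dev_bound:
  fixes \<xi> \<eta> v v' :: "'a::euclidean_space" and \<kappa> W s D :: real
  assumes \<kappa>: "\<kappa> > 0" and W: "W > 0" and \<kappa>W: "2 \<le> \<kappa> * W" and s: "s \<ge> 1" and D: "D \<ge> 0"
    and dv: "dev \<alpha> \<le> D * (W * norm (\<xi> - v))\<^sup>2" "dev \<beta> \<le> D * (W * norm (\<eta> + v'))\<^sup>2"
  shows "gauss \<kappa> 0 (\<xi> + \<eta>) * dev (\<alpha> + (\<beta> + phase s (\<xi> + \<eta>))) \<le>
     ((D + 2 * \<kappa>) * exp (- (norm (v - v'))\<^sup>2 / (12 * \<kappa>\<^sup>2))) * ((1 + (W * norm (\<xi> - v))\<^sup>2) * exp ((W * norm (\<xi> - v))\<^sup>2 / 8) *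
          ((1 + (W * norm (\<eta> + v'))\<^sup>2) * exp ((W * norm (\<eta> + v'))\<^sup>2 / 8)))"
proof -
  define a b r where "a = W * norm (\<xi> - v)" and "b = W * norm (\<eta> + v')" and "r = norm (\<xi> + \<eta>)"
  have r: "r \<ge> 0" by (simp add: r_def)
  define t where "t = r / \<kappa>"
  have t: "t \<ge> 0" "r = \<kappa> * t" using r \<kappa> by (auto simp: t_def)
  have w: "gauss \<kappa> 0 (\<xi> + \<eta>) = exp (- t\<^sup>2 / 4) * exp (- t\<^sup>2 / 4)"
    unfolding gauss_def by (simp add: t_def r_def power_divide flip: exp_add)
  have "t \<le> 1 + t\<^sup>2 / 4" using zero_le_power2[of "t / 2 - 1"] by (simp add: power2_diff power_divide)
  also have "\<dots> \<le> exp (t\<^sup>2 / 4)" by (rule exp_ge_add_one_self)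
  finally have te: "t * exp (- t\<^sup>2 / 4) \<le> 1" by (simp add: exp_minus field_simps)
  have e1: "exp (- t\<^sup>2 / 4) \<le> 1" by simp
  have "dev (\<alpha> + (\<beta> + phase s (\<xi> + \<eta>))) \<le> dev \<alpha> + (dev \<beta> + dev (phase s (\<xi> + \<eta>)))"
    by (intro order_trans[OF dev_add] add_left_mono order_refl)
  also have "\<dots> \<le> D * a\<^sup>2 + (D * b\<^sup>2 + 2 * r)"
    using dv dev_powr_le[of r s] r s by (intro add_mono) (auto simp: a_def b_def r_def phase_def)
  finally have dd: "dev (\<alpha> + (\<beta> + phase s (\<xi> + \<eta>))) \<le> D * (a\<^sup>2 + b\<^sup>2) + 2 * r" by (simp add: distrib_left)
  have "exp (- t\<^sup>2 / 4) * dev (\<alpha> + (\<beta> + phase s (\<xi> + \<eta>))) \<le> exp (- t\<^sup>2 / 4) * (D * (a\<^sup>2 + b\<^sup>2) + 2 * r)"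
    by (intro mult_left_mono dd) auto
  also have "\<dots> = exp (- t\<^sup>2 / 4) * (D * (a\<^sup>2 + b\<^sup>2)) + 2 * \<kappa> * (t * exp (- t\<^sup>2 / 4))"
    by (simp add: t(2) algebra_simps)
  also have "\<dots> \<le> 1 * (D * (a\<^sup>2 + b\<^sup>2)) + 2 * \<kappa> * 1"
    using D \<kappa> te e1 by (intro add_mono mult_mono) (auto simp: t(1))
  also have "\<dots> \<le> (D + 2 * \<kappa>) * ((1 + a\<^sup>2) * (1 + b\<^sup>2))"
  proof -
    have X: "a\<^sup>2 + b\<^sup>2 \<le> (1 + a\<^sup>2) * (1 + b\<^sup>2)" "1 \<le> (1 + a\<^sup>2) * (1 + b\<^sup>2)"
      by (simp_all add: distrib_left distrib_right add_nonneg_nonneg)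
    have "D * (a\<^sup>2 + b\<^sup>2) \<le> D * ((1 + a\<^sup>2) * (1 + b\<^sup>2))" "2 * \<kappa> * 1 \<le> 2 * \<kappa> * ((1 + a\<^sup>2) * (1 + b\<^sup>2))"
      using X D \<kappa> by (auto intro: mult_left_mono)
    then show ?thesis by (simp only: distrib_right mult_1)
  qed
  finally have 1: "exp (- t\<^sup>2 / 4) * dev (\<alpha> + (\<beta> + phase s (\<xi> + \<eta>))) \<le> (D + 2 * \<kappa>) * ((1 + a\<^sup>2) * (1 + b\<^sup>2))" .
  have 2: "exp (- t\<^sup>2 / 4) \<le> exp (- (norm (v - v'))\<^sup>2 / (12 * \<kappa>\<^sup>2)) * (exp (a\<^sup>2 / 8) * exp (b\<^sup>2 / 8))"
  proof -
    define x y where "x = norm (\<xi> - v)" and "y = norm (\<eta> + v')"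
    have "v - v' = (\<xi> + \<eta>) - (\<xi> - v) - (\<eta> + v')" by simp
    then have "norm (v - v') \<le> r + x + y"
      using norm_triangle_ineq4[of "(\<xi> + \<eta>) - (\<xi> - v)" "\<eta> + v'"] norm_triangle_ineq4[of "\<xi> + \<eta>" "\<xi> - v"]
      by (simp add: r_def x_def y_def)
    then have "(norm (v - v'))\<^sup>2 \<le> (r + x + y)\<^sup>2" by (intro power_mono) auto
    also have "\<dots> \<le> 3 * (r\<^sup>2 + x\<^sup>2 + y\<^sup>2)"
      using zero_le_power2[of "r - x"] zero_le_power2[of "r - y"] zero_le_power2[of "x - y"]
      by (simp add: power2_eq_square algebra_simps)
    finally have "(norm (v - v'))\<^sup>2 / (12 * \<kappa>\<^sup>2) \<le> 3 * (r\<^sup>2 + x\<^sup>2 + y\<^sup>2) / (12 * \<kappa>\<^sup>2)"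
      by (intro divide_right_mono) auto
    also have "\<dots> = t\<^sup>2 / 4 + (x\<^sup>2 / (4 * \<kappa>\<^sup>2) + y\<^sup>2 / (4 * \<kappa>\<^sup>2))"
      using \<kappa> by (simp add: t_def power_divide field_simps)
    also have "\<dots> \<le> t\<^sup>2 / 4 + (a\<^sup>2 / 8 + b\<^sup>2 / 8)"
    proof -
      have "(2::real)\<^sup>2 \<le> (\<kappa> * W)\<^sup>2" using \<kappa>W by (intro power_mono) auto
      then have k: "4 \<le> \<kappa>\<^sup>2 * W\<^sup>2" by (simp add: power_mult_distrib)
      have "x\<^sup>2 / (4 * \<kappa>\<^sup>2) \<le> a\<^sup>2 / 8" "y\<^sup>2 / (4 * \<kappa>\<^sup>2) \<le> b\<^sup>2 / 8"
        using mult_right_mono[of 2 "\<kappa>\<^sup>2 * W\<^sup>2" "x\<^sup>2"] mult_right_mono[of 2 "\<kappa>\<^sup>2 * W\<^sup>2" "y\<^sup>2"] k \<kappa>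
        by (auto simp: a_def b_def x_def[symmetric] y_def[symmetric] power_mult_distrib field_simps)
      then show ?thesis by simp
    qed
    finally have "- t\<^sup>2 / 4 \<le> - (norm (v - v'))\<^sup>2 / (12 * \<kappa>\<^sup>2) + (a\<^sup>2 / 8 + b\<^sup>2 / 8)" by simp
    then show ?thesis by (simp flip: exp_add)
  qed
  have "gauss \<kappa> 0 (\<xi> + \<eta>) * dev (\<alpha> + (\<beta> + phase s (\<xi> + \<eta>)))
      = exp (- t\<^sup>2 / 4) * (exp (- t\<^sup>2 / 4) * dev (\<alpha> + (\<beta> + phase s (\<xi> + \<eta>))))"
    by (simp add: w)
  also have "\<dots> \<le> (exp (- (norm (v - v'))\<^sup>2 / (12 * \<kappa>\<^sup>2)) * (exp (a\<^sup>2 / 8) * exp (b\<^sup>2 / 8))) * ((D + 2 * \<kappa>) * ((1 + a\<^sup>2) * (1 + b\<^sup>2)))"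
    by (intro mult_mono 1 2) (auto simp: dev_nonneg)
  also have "\<dots> = ((D + 2 * \<kappa>) * exp (- (norm (v - v'))\<^sup>2 / (12 * \<kappa>\<^sup>2))) * ((1 + a\<^sup>2) * exp (a\<^sup>2 / 8) * ((1 + b\<^sup>2) * exp (b\<^sup>2 / 8)))"
    by (simp only: mult_ac)
  finally show ?thesis by (simp only: a_def b_def)
qed

text \<open>The integer \<open>K\<close> is the parameter and R is derived from it, so that the
  relation required by \<open>wave_bound\<close> holds without rounding. The identity for
  \<open>R powr (s - 2)\<close> converts Taylor errors into squares of W |\<xi> - v| with the gain 1
  / A^2.\<close>

lemma scales:
  fixes A s :: real and K :: nat
  assumes A: "A \<ge> 1" and s: "s > 1" and K: "K \<ge> 1"
  defines "R \<equiv> (A * real K) powr (2 / s)" and "W \<equiv> A * ((A * real K) powr (2 / s)) powr (s / 2 - 1)"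
  shows "1 \<le> R" "R powr (s / 2) = A * real K" "0 < W" "R powr (s / 2) \<le> W * R" "1 \<le> W * R"
    "R powr (s - 2) = W\<^sup>2 / A\<^sup>2" "R powr (s - 2) * (R / real K) = W"
    "R powr e = A powr (2 * e / s) * real K powr (2 * e / s)"
proof -
  have "1 * 1 \<le> A * real K" using A K by (intro mult_mono) auto
  then have AK: "A * real K \<ge> 1" by simp
  show R1: "1 \<le> R" using AK s by (simp add: R_def ge_one_powr_ge_zero)
  show Rs: "R powr (s / 2) = A * real K" using AK s by (simp add: R_def powr_powr)
  have W: "W = A * R powr (s / 2 - 1)" by (simp add: W_def R_def)
  show "0 < W" using A R1 by (simp add: W)
  have WR: "W * R = A * R powr (s / 2)" using R1 by (simp add: W powr_diff)
  then show WR2: "R powr (s / 2) \<le> W * R" using A mult_right_mono[of 1 A "R powr (s / 2)"] by simp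
  show "1 \<le> W * R" using AK Rs WR2 by simp
  have "(R powr (s / 2 - 1))\<^sup>2 = R powr (s - 2)" by (simp add: power2_eq_square flip: powr_add)
  then show "R powr (s - 2) = W\<^sup>2 / A\<^sup>2" using A by (simp add: W power_mult_distrib)
  have "R powr (s - 2) * R = R powr (s / 2 - 1) * R powr (s / 2)"
    using R1 powr_add[of R "s - 2" 1] powr_add[of R "s / 2 - 1" "s / 2"] by simp
  then show "R powr (s - 2) * (R / real K) = W" using K by (simp add: Rs W)
  show "R powr e = A powr (2 * e / s) * real K powr (2 * e / s)"
    using A by (simp add: R_def powr_powr powr_mult mult.commute)
qed

section \<open>The two necessary conditions\<close>

text \<open>The condition m \<le> 0 makes the symbol bounded and its modulus decreasing in |\<xi>|
  and |\<eta>| in the weak sense; it is arranged in the final theorem.\<close>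

locale multiplier =
  fixes s m :: real and T :: "'a::euclidean_space itself"
  assumes s: "s > 1" and m: "m \<le> 0"
    and mult: "bilinear_multiplier Linf_norm Linf_norm bmo_norm (symb s m :: 'a \<times> 'a \<Rightarrow> complex)"
begin

lemma bmo_bound:
  obtains A where "A > 0"
    "\<And>(f :: 'a \<Rightarrow> complex) g Cf Cg. f \<in> schwartz \<Longrightarrow> g \<in> schwartz \<Longrightarrow> f \<in> borel_measurable borel \<Longrightarrow> g \<in> borel_measurable borel \<Longrightarrow>
       (\<And>x. norm (f x) \<le> Cf) \<Longrightarrow> (\<And>x. norm (g x) \<le> Cg) \<Longrightarrow>
       bmo_norm (bilinear_op (symb s m) f g) \<le> ennreal (A * Cf * Cg)"
proof -
  obtain A where A: "A > 0" and
    b: "\<And>(f :: 'a \<Rightarrow> complex) g. f \<in> schwartz \<Longrightarrow> g \<in> schwartz \<Longrightarrow> Linf_norm f < \<infinity> \<Longrightarrow> Linf_norm g < \<infinity> \<Longrightarrow>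
        bmo_norm (bilinear_op (symb s m) f g) \<le> ennreal A * Linf_norm f * Linf_norm g"
    using mult unfolding bilinear_multiplier_def by blast
  show thesis
  proof (rule that[OF A])
    fix f g :: "'a \<Rightarrow> complex" and Cf Cg
    assume f: "f \<in> schwartz" "f \<in> borel_measurable borel" "\<And>x. norm (f x) \<le> Cf"
      and g: "g \<in> schwartz" "g \<in> borel_measurable borel" "\<And>x. norm (g x) \<le> Cg"
    have C: "Cf \<ge> 0" "Cg \<ge> 0" using f(3)[of 0] g(3)[of 0] norm_ge_zero order_trans by blast+
    have lf: "Linf_norm f \<le> ennreal Cf" and lg: "Linf_norm g \<le> ennreal Cg"
      using f g by (auto intro: Linf_norm_le)
    have "bmo_norm (bilinear_op (symb s m) f g) \<le> ennreal A * Linf_norm f * Linf_norm g"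
      by (rule b[OF f(1) g(1)]) (use lf lg in \<open>auto intro: le_less_trans[OF _ ennreal_less_top]\<close>)
    also have "\<dots> \<le> ennreal A * ennreal Cf * ennreal Cg"
      by (intro mult_mono lf lg) auto
    also have "\<dots> = ennreal (A * Cf * Cg)" using A C by (simp add: ennreal_mult)
    finally show "bmo_norm (bilinear_op (symb s m) f g) \<le> ennreal (A * Cf * Cg)" .
  qed
qed

text \<open>Testing with \<open>g\<close> a very wide Gaussian, so that the operator acts on \<open>f\<close> almost like the linear multiplier
  \<open>exp (2 i |\<xi>|^s) (1 + |\<xi>|^2)^(m/2)\<close>, which focuses all packets of \<open>f\<close> at the origin.\<close>

lemma order_le_linear: "m \<le> - (real DIM('a) * s / 2)"
proof (rule ccontr)
  assume neg: "\<not> m \<le> - (real DIM('a) * s / 2)"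
  define n where "n = DIM('a)"
  have n: "n \<ge> 1" using DIM_positive[where 'a='a] by (simp add: n_def)
  define M where "M = 2 * real n"
  have M: "M \<ge> 1" using n by (simp add: M_def)
  have s0: "s > 0" using s by simp
  show False
  proof (rule pair_estimate[OF m s0 M, where 'a='a], goal_cases)
    case (1 c C)
    note c = 1(1) and C = 1(2) and pe = 1(3)
  obtain CT where CT: "CT > 0" and taylor:
    "\<And>R (v::'a::euclidean_space) \<xi>. 1 \<le> R \<Longrightarrow> R \<le> norm v \<Longrightarrow> norm v \<le> M * R \<Longrightarrow>
       dev (phase s \<xi> - phase s v - grad_phase s v \<bullet> (\<xi> - v)) \<le> CT * (R powr (s - 2) * (norm (\<xi> - v))\<^sup>2)"
    using dev_phase_taylor[OF s0 M, where 'a='a] by blast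
  obtain Cf where Cf: "Cf > 0" and wb:
    "\<And>R W K (\<epsilon>::real) x::'a::euclidean_space. R > 0 \<Longrightarrow> W > 0 \<Longrightarrow> K > 0 \<Longrightarrow> \<bar>\<epsilon>\<bar> = 1 \<Longrightarrow> R powr (s - 2) * (R / real K) = W \<Longrightarrow>
       norm (wave s 2 W (\<lambda>k. \<epsilon> *\<^sub>R freq R K k) K x) \<le> Cf"
    using wave_bound[OF s, of 2, where 'a='a] by (metis zero_less_numeral)
  obtain B where B: "B > 0" and bb: "\<And>(f :: 'a \<Rightarrow> complex) g Cf Cg. f \<in> schwartz \<Longrightarrow> g \<in> schwartz \<Longrightarrow> f \<in> borel_measurable borel \<Longrightarrow> g \<in> borel_measurable borel \<Longrightarrow>
       (\<And>x. norm (f x) \<le> Cf) \<Longrightarrow> (\<And>x. norm (g x) \<le> Cg) \<Longrightarrow>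
       bmo_norm (bilinear_op (symb s m) f g) \<le> ennreal (B * Cf * Cg)"
    using bmo_bound by metis
  \<comment> \<open>Half of the gain survives: c - C q = c / 2. The budget q is shared equally by
    the errors in \<xi> and those in \<eta>.\<close>
  define q where "q = c / (2 * C)"
  have q: "q > 0" using c C by (simp add: q_def)
  \<comment> \<open>The Taylor errors at \<xi> and at \<xi> + \<eta> contribute 3 CT / A^2 times the
    square of W |\<xi> - v|: 1 from the former, 2 from the latter by (a + b)^2 \<le> 2 a^2 + 2 b^2.
    The 12 makes this coefficient at most q/4.\<close>
  define A where "A = 1 + 12 * CT / q"
  have A1: "A \<ge> 1" using CT q by (simp add: A_def)
  have A2: "3 * CT / A\<^sup>2 \<le> q / 4"
  proof -
    have "12 * CT / q \<le> A" by (simp add: A_def)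
    also have "A \<le> A\<^sup>2" using A1 by (simp add: power2_eq_square)
    finally show ?thesis using q A1 by (simp add: field_simps)
  qed
  \<comment> \<open>For |x| R \<le> \<delta> the translation phase x \<bullet> (\<xi> + \<eta>)
    costs at most the other q/4 in the \<xi> variable.\<close>
  define \<delta> where "\<delta> = min 1 (q / (4 * (M + 1)))"
  have \<delta>: "\<delta> > 0" "\<delta> \<le> 1" "\<delta> * (M + 1) \<le> q / 4"
  proof -
    have "\<delta> \<le> q / (4 * (M + 1))" by (simp add: \<delta>_def)
    then show "\<delta> * (M + 1) \<le> q / 4" using M by (simp add: field_simps)
  qed (use q M in \<open>auto simp: \<delta>_def\<close>)
  define P where "P = (1 / (2 * pi)) ^ n * (c / 2) * A powr (2 * m / s)"
  \<comment> \<open>K^n packets, each worth R^m, where R is a multiple of K^(2/s).\<close>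
  define e where "e = real n + 2 * m / s"
  have e: "e > 0" using neg s by (simp add: e_def n_def field_simps)
  have P: "P > 0" using c A1 by (simp add: P_def)
  define D where "D = B * Cf"
  have main: "P * real K powr e \<le> (1 + 2 ^ n * (log 2 (real n / \<delta>) + 2 / s * log 2 A + 1)) * D + (2 ^ n * (2 / s) / ln 2 * D) * ln (real K)"
    if K: "K \<ge> 1" for K :: nat
  proof -
    define R where "R = (A * real K) powr (2 / s)"
    define W where "W = A * ((A * real K) powr (2 / s)) powr (s / 2 - 1)"
    have R1: "1 \<le> R" and W: "0 < W" and WR2: "R powr (s / 2) \<le> W * R" and WR1: "1 \<le> W * R"
      and RW: "R powr (s - 2) = W\<^sup>2 / A\<^sup>2" and hW: "R powr (s - 2) * (R / real K) = W"
      and Rm: "R powr m = A powr (2 * m / s) * real K powr (2 * m / s)"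
      unfolding R_def W_def by (rule scales[OF A1 s K])+
    \<comment> \<open>The coefficients of all errors that involve \<eta>: 1 from x \<bullet> \<eta>,
      2 from \<open>dev_powr_le\<close> for |\<eta>|^s, the gradient of the phase at v, and the
      Taylor error. They may grow with R, so V is chosen after R.\<close>
    define S where "S = 3 + s * (M * R) powr (s - 1) + 2 * CT * R powr (s - 2)"
    have S: "S \<ge> 3" using s CT by (simp add: S_def)
    define V where "V = 1 + 2 * S / q"
    have V1: "V \<ge> 1" using S q by (simp add: V_def)
    have VS: "S / V \<le> q / 2"
    proof -
      have "2 * S / q \<le> V" by (simp add: V_def)
      then show ?thesis using q V1 by (simp add: field_simps)
    qed
    define N :: "('a \<Rightarrow> nat) \<Rightarrow> 'a" where "N = (\<lambda>k. 1 *\<^sub>R freq R K k)"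
    have N: "R \<le> norm (N k)" "norm (N k) \<le> M * R" if "k \<in> lattice K" for k
      using norm_freq[OF that, of R] R1 by (auto simp: N_def M_def n_def)
    define h where "h = bilinear_op (symb s m) (wave s 2 W N K) (wave s 0 V (\<lambda>_. 0) 1 :: 'a \<Rightarrow> complex)"
    have hb: "bmo_norm h \<le> ennreal D"
    proof -
      have "bmo_norm h \<le> ennreal (B * Cf * 1)"
        unfolding h_def
      proof (rule bb)
        show "norm (wave s 2 W N K x) \<le> Cf" for x
          unfolding N_def using R1 W K hW by (intro wb) auto
        show "norm (wave s 0 V (\<lambda>_. 0) 1 (x::'a)) \<le> 1" for x
          unfolding wave_single[OF s0] by (simp add: gauss_nonneg gauss_le_1)
      qed (use W V1 K in \<open>auto intro: wave_schwartz\<close>)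
      then show ?thesis by (simp add: D_def)
    qed
    \<comment> \<open>On the cube of side 2^(-j) one has |x| R \<le> \<delta>, and j is of order log
      R; this is where the logarithm arises.\<close>
    define j where "j = nat \<lceil>log 2 (real n * R / \<delta>)\<rceil>"
    have nR: "1 \<le> real n * R / \<delta>"
    proof -
      have "1 * 1 \<le> real n * R" using n R1 by (intro mult_mono) auto
      then show ?thesis using \<delta> by (simp add: field_simps)
    qed
    have j2: "real n * R / \<delta> \<le> 2 ^ j"
    proof -
      have "log 2 (real n * R / \<delta>) \<le> real j" unfolding j_def by linarith
      then have "real n * R / \<delta> \<le> 2 powr real j" using nR by (subst (asm) log_le_iff) auto
      then show ?thesis by (simp add: powr_realpow)
    qed
    have jle: "real j \<le> log 2 (real n / \<delta>) + 2 / s * (log 2 A + log 2 (real K)) + 1"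
    proof -
      have "0 \<le> log 2 (real n * R / \<delta>)" using nR by simp
      then have "real j \<le> log 2 (real n * R / \<delta>) + 1" unfolding j_def by linarith
      also have "log 2 (real n * R / \<delta>) = log 2 (real n / \<delta>) + log 2 R"
        using n R1 \<delta> by (simp add: log_mult log_divide)
      also have "log 2 R = 2 / s * (log 2 A + log 2 (real K))"
        using A1 K by (simp add: R_def log_powr log_mult)
      finally show ?thesis .
    qed
    have low: "(1 / (2 * pi)) ^ n * (c / 2) * real K ^ n * R powr m \<le> Re (h x)"
      if x: "x \<in> cbox 0 ((1 / 2 ^ j) *\<^sub>R One)" for x :: 'a
    proof -
      have xR: "norm x * R \<le> \<delta>"
      proof -
        have "norm x \<le> real n * (1 / 2 ^ j)" using norm_le_of_dyadic_cube[OF x] by (simp add: n_def)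
        also have "\<dots> * R \<le> \<delta>" using j2 \<delta> by (simp add: field_simps)
        finally show ?thesis using R1 by (meson mult_right_mono order_trans zero_le_one)
      qed
      have x1: "norm x \<le> 1" using xR R1 \<delta> mult_left_mono[of 1 R "norm x"] by simp
      define \<Theta> where "\<Theta> = (\<lambda>k z. x \<bullet> (fst z + snd z) + pair_phase s 2 0 (N k) 0 z)"
      have m\<Theta>: "\<Theta> k \<in> borel_measurable borel" for k
      proof -
        have [measurable]: "(\<lambda>z::'a \<times> 'a. x \<bullet> (fst z + snd z)) \<in> borel_measurable borel"
          unfolding borel_prod[symmetric] by measurable
        show ?thesis unfolding \<Theta>_def by measurable
      qed
      have est: "integrable lborel (\<lambda>z. cis (\<Theta> k z) * complex_of_real (1 * elliptic m z * (gauss (1 / W) (N k) (fst z) * gauss (1 / V) 0 (snd z)))) \<and>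
        (c * 1 - C * q) * R powr m / (W ^ DIM('a) * V ^ DIM('a)) \<le>
        Re (LINT z|lborel. cis (\<Theta> k z) * complex_of_real (1 * elliptic m z * (gauss (1 / W) (N k) (fst z) * gauss (1 / V) 0 (snd z))))"
        if k: "k \<in> lattice K" for k
      proof (rule pe)
        show "1 \<le> R" "0 < W" "0 < V" "R \<le> norm (N k)" "norm (N k) \<le> M * R" "norm (0::'a) \<le> M * R" "R powr (s / 2) \<le> W * R"
          using R1 W V1 N[OF k] WR2 M by auto
        show "1 \<le> V * R" using mult_mono[of 1 V 1 R] V1 R1 by simp
        fix \<xi> \<eta> :: 'a
        define v where "v = N k"
        define a where "a = W * norm (\<xi> - v)"
        define b where "b = V * norm (\<eta> - 0)"
        have ab: "a \<ge> 0" "b \<ge> 0" using W V1 by (auto simp: a_def b_def)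
        have na: "norm (\<xi> - v) = a / W" and nb: "norm \<eta> = b / V" using W V1 by (auto simp: a_def b_def)
        \<comment> \<open>Both |\<xi>|^s and |\<xi> + \<eta>|^s are expanded at v, which is why c =
          2; writing \<xi> - v = (\<xi> + \<eta> - v) - \<eta> in the second expansion leaves the
          gradient paired with \<eta>.\<close>
        have \<Theta>_eq: "\<Theta> k (\<xi>, \<eta>) = x \<bullet> (\<xi> + \<eta>) + ((phase s \<xi> - phase s v - grad_phase s v \<bullet> (\<xi> - v)) + (phase s \<eta> +
            ((phase s (\<xi> + \<eta>) - phase s v - grad_phase s v \<bullet> (\<xi> + \<eta> - v)) + grad_phase s v \<bullet> \<eta>)))"
          by (simp add: \<Theta>_def pair_phase_def v_def inner_add_right inner_diff_right algebra_simps)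
        have "dev (\<Theta> k (\<xi>, \<eta>)) \<le> dev (x \<bullet> (\<xi> + \<eta>)) + (dev (phase s \<xi> - phase s v - grad_phase s v \<bullet> (\<xi> - v)) + (dev (phase s \<eta>) +
            (dev (phase s (\<xi> + \<eta>) - phase s v - grad_phase s v \<bullet> (\<xi> + \<eta> - v)) + dev (grad_phase s v \<bullet> \<eta>))))"
          unfolding \<Theta>_eq by (intro order_trans[OF dev_add] add_left_mono order_refl)
        also have "\<dots> \<le> (\<delta> * M + \<delta> * a + b / V) + (CT * (a\<^sup>2 / A\<^sup>2) + (2 * (b / V) +
            (CT * (2 * a\<^sup>2 / A\<^sup>2 + 2 * R powr (s - 2) * (b / V)\<^sup>2) + s * (M * R) powr (s - 1) * (b / V))))"
        proof (intro add_mono)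
          have "dev (x \<bullet> (\<xi> + \<eta>)) \<le> norm x * norm (\<xi> + \<eta>)"
            using dev_le_abs Cauchy_Schwarz_ineq2 order_trans by blast
          also have "norm (\<xi> + \<eta>) \<le> norm v + norm (\<xi> - v) + norm \<eta>"
            using norm_triangle_ineq[of \<xi> \<eta>] norm_triangle_sub[of \<xi> v] by linarith
          also have "norm x * (norm v + norm (\<xi> - v) + norm \<eta>) \<le> \<delta> * M + \<delta> * a + b / V"
          proof -
            have "norm x * norm v \<le> norm x * (M * R)" using N[OF k] by (intro mult_left_mono) (auto simp: v_def)
            also have "\<dots> = (norm x * R) * M" by simp
            also have "\<dots> \<le> \<delta> * M" using xR M by (intro mult_right_mono) auto
            finally have 1: "norm x * norm v \<le> \<delta> * M" .
            have "norm x * norm (\<xi> - v) = (norm x * R) * (a / (W * R))" using R1 by (simp add: na)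
            also have "\<dots> \<le> \<delta> * a"
              using xR \<delta> ab WR1 divide_left_mono[of 1 "W * R" a] W R1 by (intro mult_mono) auto
            finally have 2: "norm x * norm (\<xi> - v) \<le> \<delta> * a" .
            have "norm x * norm \<eta> \<le> 1 * norm \<eta>" using x1 by (intro mult_right_mono) auto
            then have 3: "norm x * norm \<eta> \<le> b / V" using nb by simp
            show ?thesis using 1 2 3 by (simp add: distrib_left)
          qed
          finally show "dev (x \<bullet> (\<xi> + \<eta>)) \<le> \<delta> * M + \<delta> * a + b / V" by (simp add: mult_left_mono)
          have "dev (phase s \<xi> - phase s v - grad_phase s v \<bullet> (\<xi> - v)) \<le> CT * (R powr (s - 2) * (norm (\<xi> - v))\<^sup>2)"
            unfolding v_def by (rule taylor) (use R1 N[OF k] in auto)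
          also have "\<dots> = CT * (a\<^sup>2 / A\<^sup>2)" unfolding RW na using W by (simp add: power_divide)
          finally show "dev (phase s \<xi> - phase s v - grad_phase s v \<bullet> (\<xi> - v)) \<le> CT * (a\<^sup>2 / A\<^sup>2)" .
          show "dev (phase s \<eta>) \<le> 2 * (b / V)"
            unfolding phase_def nb[symmetric] using s by (intro dev_powr_le) auto
          have "dev (phase s (\<xi> + \<eta>) - phase s v - grad_phase s v \<bullet> (\<xi> + \<eta> - v)) \<le> CT * (R powr (s - 2) * (norm (\<xi> + \<eta> - v))\<^sup>2)"
            unfolding v_def by (rule taylor) (use R1 N[OF k] in auto)
          also have "\<dots> \<le> CT * (R powr (s - 2) * (2 * (a / W)\<^sup>2 + 2 * (b / V)\<^sup>2))"
          proof -
            have "norm (\<xi> + \<eta> - v) \<le> a / W + b / V"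
              using norm_triangle_ineq[of "\<xi> - v" \<eta>] by (simp add: na[symmetric] nb[symmetric] algebra_simps)
            then have "(norm (\<xi> + \<eta> - v))\<^sup>2 \<le> (a / W + b / V)\<^sup>2" by (intro power_mono) auto
            also have "\<dots> \<le> 2 * (a / W)\<^sup>2 + 2 * (b / V)\<^sup>2"
              using zero_le_power2[of "a / W - b / V"] unfolding power2_sum power2_diff by linarith
            finally show ?thesis using CT by (intro mult_left_mono) auto
          qed
          also have "\<dots> = CT * (2 * a\<^sup>2 / A\<^sup>2 + 2 * R powr (s - 2) * (b / V)\<^sup>2)"
            unfolding distrib_left RW using W by (simp add: power_divide)
          finally show "dev (phase s (\<xi> + \<eta>) - phase s v - grad_phase s v \<bullet> (\<xi> + \<eta> - v)) \<le> CT * (2 * a\<^sup>2 / A\<^sup>2 + 2 * R powr (s - 2) * (b / V)\<^sup>2)" .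
          have "dev (grad_phase s v \<bullet> \<eta>) \<le> norm (grad_phase s v) * norm \<eta>"
            using dev_le_abs Cauchy_Schwarz_ineq2 order_trans by blast
          also have "norm (grad_phase s v) = s * norm v powr (s - 1)"
            using s R1 N(1)[OF k] powr_add[of "norm v" "s - 2" 1] by (auto simp: grad_phase_def v_def)
          also have "s * norm v powr (s - 1) * norm \<eta> \<le> s * (M * R) powr (s - 1) * norm \<eta>"
            using s N[OF k] by (intro mult_right_mono mult_left_mono powr_mono2) (auto simp: v_def)
          finally show "dev (grad_phase s v \<bullet> \<eta>) \<le> s * (M * R) powr (s - 1) * (b / V)" by (simp add: nb)
        qed
        also have "\<dots> = \<delta> * M + \<delta> * a + 3 * CT / A\<^sup>2 * a\<^sup>2 + (3 + s * (M * R) powr (s - 1)) * (b / V) + 2 * CT * R powr (s - 2) * (b / V)\<^sup>2"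
          by (simp add: algebra_simps add_divide_distrib)
        also have "\<dots> \<le> q / 2 * (1 + a\<^sup>2) + S / V * (1 + b\<^sup>2)"
        proof -
          have aa: "a \<le> 1 + a\<^sup>2" "b \<le> 1 + b\<^sup>2"
            using zero_le_power2[of "a - 1 / 2"] zero_le_power2[of "b - 1 / 2"] by (simp_all add: power2_diff algebra_simps power2_eq_square)
          have "\<delta> * M \<le> \<delta> * M * (1 + a\<^sup>2)" using \<delta> M mult_left_mono[of 1 "1 + a\<^sup>2" "\<delta> * M"] by simp
          moreover have "\<delta> * a \<le> \<delta> * (1 + a\<^sup>2)" using \<delta> aa by (intro mult_left_mono) auto
          moreover have "3 * CT / A\<^sup>2 * a\<^sup>2 \<le> q / 4 * (1 + a\<^sup>2)" using A2 CT q by (intro mult_mono) auto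
          moreover have "\<delta> * M * (1 + a\<^sup>2) + \<delta> * (1 + a\<^sup>2) \<le> q / 4 * (1 + a\<^sup>2)"
            using mult_right_mono[OF \<delta>(3), of "1 + a\<^sup>2"] by (simp add: algebra_simps)
          ultimately have 1: "\<delta> * M + \<delta> * a + 3 * CT / A\<^sup>2 * a\<^sup>2 \<le> q / 2 * (1 + a\<^sup>2)" by linarith
          have "(3 + s * (M * R) powr (s - 1)) * (b / V) \<le> (3 + s * (M * R) powr (s - 1)) * ((1 + b\<^sup>2) / V)"
            using s V1 aa by (intro mult_left_mono divide_right_mono) auto
          moreover have "2 * CT * R powr (s - 2) * (b / V)\<^sup>2 \<le> 2 * CT * R powr (s - 2) * ((1 + b\<^sup>2) / V)"
          proof (intro mult_left_mono)
            have "V * 1 \<le> V * V" using V1 by (intro mult_left_mono) auto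
            then have "b\<^sup>2 / (V * V) \<le> b\<^sup>2 / V" using V1 by (intro divide_left_mono) auto
            also have "\<dots> \<le> (1 + b\<^sup>2) / V" using V1 by (intro divide_right_mono) auto
            finally show "(b / V)\<^sup>2 \<le> (1 + b\<^sup>2) / V" by (simp add: power_divide power2_eq_square)
          qed (use CT in auto)
          moreover have "S / V * (1 + b\<^sup>2) = (3 + s * (M * R) powr (s - 1)) * ((1 + b\<^sup>2) / V) + 2 * CT * R powr (s - 2) * ((1 + b\<^sup>2) / V)"
          proof -
            have "S / V * (1 + b\<^sup>2) = S * ((1 + b\<^sup>2) / V)" by simp
            then show ?thesis unfolding S_def by (simp only: distrib_right)
          qed
          ultimately show ?thesis using 1 by linarith
        qed
        also have "\<dots> \<le> q * ((1 + a\<^sup>2) * exp (a\<^sup>2 / 8) * ((1 + b\<^sup>2) * exp (b\<^sup>2 / 8)))"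
        proof (rule exp_factor_le)
          show "q / 2 + S / V \<le> q" using VS by linarith
        qed (use q S V1 in auto)
        finally show "1 * dev (\<Theta> k (\<xi>, \<eta>)) \<le> q * ((1 + (W * norm (\<xi> - N k))\<^sup>2) * exp ((W * norm (\<xi> - N k))\<^sup>2 / 8) *
          ((1 + (V * norm (\<eta> - 0))\<^sup>2) * exp ((V * norm (\<eta> - 0))\<^sup>2 / 8)))"
          by (simp add: a_def b_def v_def)
      qed (use q m\<Theta> in auto)
      define G where "G = (sqrt (2 * pi) * W) ^ DIM('a) * (sqrt (2 * pi) * V) ^ DIM('a) / (2 * pi) ^ (2 * DIM('a))"
      have G: "G = (1 / (2 * pi)) ^ n * (W ^ n * V ^ n)"
        unfolding G_def n_def by (rule gauss_constant)
      let ?J = "\<lambda>k. (LINT z|lborel. cis (\<Theta> k z) * complex_of_real (elliptic m z * (gauss (1 / W) (N k) (fst z) * gauss (1 / V) 0 (snd z))))"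
      have "lattice 1 = {\<lambda>b::'a. if b \<in> Basis then 0 else undefined}"
        unfolding lattice_def by (auto simp: fun_eq_iff PiE_iff extensional_def lessThan_Suc)
      then have "h x = complex_of_real G * (LINT z|lborel. (\<Sum>k\<in>lattice K.
          cis (\<Theta> k z) * complex_of_real (elliptic m z * (gauss (1 / W) (N k) (fst z) * gauss (1 / V) 0 (snd z)))))"
        unfolding h_def using W V1 by (subst bilinear_wave) (auto simp: G_def \<Theta>_def)
      also have "(LINT z|lborel. (\<Sum>k\<in>lattice K.
          cis (\<Theta> k z) * complex_of_real (elliptic m z * (gauss (1 / W) (N k) (fst z) * gauss (1 / V) 0 (snd z))))) = (\<Sum>k\<in>lattice K. ?J k)"
        using est by (intro Bochner_Integration.integral_sum) simp
      finally have hx: "Re (h x) = G * (\<Sum>k\<in>lattice K. Re (?J k))" by (simp add: Re_sum)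
      have le: "(\<Sum>k\<in>(lattice K :: ('a \<Rightarrow> nat) set). c / 2 * R powr m / (W ^ n * V ^ n)) \<le> (\<Sum>k\<in>lattice K. Re (?J k))"
      proof (rule sum_mono)
        fix k :: "'a \<Rightarrow> nat" assume "k \<in> lattice K"
        moreover have "c * 1 - C * q = c / 2" using C by (simp add: q_def field_simps)
        ultimately show "c / 2 * R powr m / (W ^ n * V ^ n) \<le> Re (?J k)" using est[of k] by (simp add: n_def)
      qed
      have G0: "G \<ge> 0" unfolding G using W V1 by simp
      have *: "G * (\<Sum>k\<in>(lattice K :: ('a \<Rightarrow> nat) set). c / 2 * R powr m / (W ^ n * V ^ n)) \<le> Re (h x)"
        unfolding hx by (rule mult_left_mono[OF le G0])
      have "G * (\<Sum>k\<in>(lattice K :: ('a \<Rightarrow> nat) set). c / 2 * R powr m / (W ^ n * V ^ n))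
          = (1 / (2 * pi)) ^ n * (c / 2) * real K ^ n * R powr m"
      proof -
        have Z: "W ^ n * V ^ n \<noteq> 0" using W V1 by simp
        have "(\<Sum>k\<in>(lattice K :: ('a \<Rightarrow> nat) set). c / 2 * R powr m / (W ^ n * V ^ n)) = real K ^ n * (c / 2 * R powr m / (W ^ n * V ^ n))"
          unfolding sum_constant card_lattice n_def by simp
        also have "G * \<dots> = (1 / (2 * pi)) ^ n * real K ^ n * (c / 2 * R powr m) * ((W ^ n * V ^ n) / (W ^ n * V ^ n))"
        proof -
          have "(a * X) * (b * (y / X)) = a * b * y * (X / X)" for a b X y :: real by simp
          then show ?thesis unfolding G .
        qed
        also have "\<dots> = (1 / (2 * pi)) ^ n * (c / 2) * real K ^ n * R powr m"
          unfolding divide_self[OF Z] by (simp only: mult_ac mult_1_right mult_1)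
        finally show ?thesis .
      qed
      with * show ?thesis by (simp only:)
    qed
    have "(1 / (2 * pi)) ^ n * (c / 2) * real K ^ n * R powr m \<le> (1 + 2 ^ n * real j) * D"
      unfolding n_def by (rule bmo_norm_dyadic_lower[OF hb _ low[unfolded n_def]]) (use B Cf in \<open>auto simp: D_def\<close>)
    moreover have "(1 / (2 * pi)) ^ n * (c / 2) * real K ^ n * R powr m = P * real K powr e"
    proof -
      show ?thesis using K by (simp add: Rm P_def e_def powr_add powr_realpow mult_ac)
    qed
    moreover have "(1 + 2 ^ n * real j) * D \<le> (1 + 2 ^ n * (log 2 (real n / \<delta>) + 2 / s * (log 2 A + log 2 (real K)) + 1)) * D"
      using jle B Cf by (intro mult_right_mono add_left_mono mult_left_mono) (auto simp: D_def)
    moreover have "\<dots> = (1 + 2 ^ n * (log 2 (real n / \<delta>) + 2 / s * log 2 A + 1)) * D + (2 ^ n * (2 / s) / ln 2 * D) * ln (real K)"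
      by (simp add: log_def[of 2 "real K"] algebra_simps)
    ultimately show ?thesis by linarith
  qed
  show ?case by (rule powr_ln_contradiction[OF e P main])
  qed
qed

text \<open>Testing with packets at opposite frequencies: after the operator has focused them, \<open>T(f, g)\<close> resembles \<open>|F|\<^sup>2\<close> for
  a function \<open>F\<close> concentrated near the origin, and its low frequencies are seen by a Gaussian of fixed width.\<close>

lemma order_le_bilinear:
  assumes s2: "s > 2"
  shows "m \<le> - (real DIM('a) * (s - 1))"
proof (rule ccontr)
  assume neg: "\<not> m \<le> - (real DIM('a) * (s - 1))"
  define n where "n = DIM('a)"
  have n: "n \<ge> 1" using DIM_positive[where 'a='a] by (simp add: n_def)
  define M where "M = 2 * real n"
  have M: "M \<ge> 1" using n by (simp add: M_def)
  have s0: "s > 0" using s by simp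
  show False
  proof (rule pair_estimate[OF m s0 M, where 'a='a], goal_cases)
    case (1 c C)
    note c = 1(1) and C = 1(2) and pe = 1(3)
  obtain CT where CT: "CT > 0" and taylor:
    "\<And>R (v::'a::euclidean_space) \<xi>. 1 \<le> R \<Longrightarrow> R \<le> norm v \<Longrightarrow> norm v \<le> M * R \<Longrightarrow>
       dev (phase s \<xi> - phase s v - grad_phase s v \<bullet> (\<xi> - v)) \<le> CT * (R powr (s - 2) * (norm (\<xi> - v))\<^sup>2)"
    using dev_phase_taylor[OF s0 M, where 'a='a] by blast
  obtain Cf where Cf: "Cf > 0" and wb:
    "\<And>R W K (\<epsilon>::real) x::'a::euclidean_space. R > 0 \<Longrightarrow> W > 0 \<Longrightarrow> K > 0 \<Longrightarrow> \<bar>\<epsilon>\<bar> = 1 \<Longrightarrow> R powr (s - 2) * (R / real K) = W \<Longrightarrow>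
       norm (wave s 1 W (\<lambda>k. \<epsilon> *\<^sub>R freq R K k) K x) \<le> Cf"
    using wave_bound[OF s, of 1, where 'a='a] by (metis zero_less_one)
  obtain B where B: "B > 0" and bb: "\<And>(f :: 'a \<Rightarrow> complex) g Cf Cg. f \<in> schwartz \<Longrightarrow> g \<in> schwartz \<Longrightarrow> f \<in> borel_measurable borel \<Longrightarrow> g \<in> borel_measurable borel \<Longrightarrow>
       (\<And>x. norm (f x) \<le> Cf) \<Longrightarrow> (\<And>x. norm (g x) \<le> Cg) \<Longrightarrow>
       bmo_norm (bilinear_op (symb s m) f g) \<le> ennreal (B * Cf * Cg)"
    using bmo_bound by metis
  \<comment> \<open>The value of the window at |\<xi> + \<eta>| = (n + 1) \<kappa>: n \<kappa>
    bounds the frequency difference of near packets, and \<kappa> accounts for their two frequency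
    widths.\<close>
  define \<omega> where "\<omega> = exp (- (real n + 1)\<^sup>2 / 2)"
  have \<omega>: "\<omega> > 0" by (simp add: \<omega>_def)
  \<comment> \<open>For each packet of the first factor the gain is at least c \<omega> J^n and the
    loss at most C q (36 J)^n; this q makes the loss half the gain.\<close>
  define q where "q = c * \<omega> / (2 * (C * 36 ^ n))"
  have q: "q > 0" using c C \<omega> by (simp add: q_def)
  \<comment> \<open>2 \<kappa> is the cost of |\<xi> + \<eta>|^s, which neither packet cancels; it
    is kept small by looking at low output frequencies only. The bound \<kappa> \<le> 1 gives J
    \<le> K below.\<close>
  define \<kappa> where "\<kappa> = min 1 (q / 4)"
  have \<kappa>: "\<kappa> > 0" "\<kappa> \<le> 1" "2 * \<kappa> \<le> q / 2" using q by (auto simp: \<kappa>_def)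
  define A where "A = 1 + 2 * CT / q"
  have A1: "A \<ge> 1" using CT q by (simp add: A_def)
  define D where "D = CT / A\<^sup>2"
  have D: "D \<ge> 0" "D + 2 * \<kappa> \<le> q"
  proof -
    have "2 * CT / q \<le> A" by (simp add: A_def)
    also have "A \<le> A\<^sup>2" using A1 by (simp add: power2_eq_square)
    finally have "CT / A\<^sup>2 \<le> q / 2" using q A1 by (simp add: field_simps)
    then show "D + 2 * \<kappa> \<le> q" using \<kappa> unfolding D_def by linarith
  qed (use CT in \<open>simp add: D_def\<close>)
  \<comment> \<open>Chosen so that the window produced by \<open>gauss_pairing_fubini\<close> has
    width \<kappa>.\<close>
  define L where "L = 1 / \<kappa>"
  have L: "L > 0" "1 / L = \<kappa>" using \<kappa> by (auto simp: L_def)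
  obtain CL where CL: "CL > 0" and pairing: "\<And>(h :: 'a::euclidean_space \<Rightarrow> complex) B. bmo_norm h \<le> ennreal B \<Longrightarrow> B \<ge> 0 \<Longrightarrow>
     (\<integral>\<^sup>+x. ennreal (norm (h x) * gauss L 0 x) \<partial>lebesgue) \<le> ennreal (CL * B)"
    using bmo_norm_gauss_pairing[OF L(1), where 'a='a] by blast
  \<comment> \<open>K^n J^n pairs, each worth R^m, where J is comparable to K/R and R to
    K^(2/s).\<close>
  define e where "e = 2 * real n + 2 * (m - real n) / s"
  have e: "e > 0"
  proof -
    have "0 < 2 * (real n * s + m - real n) / s" using neg s by (simp add: n_def algebra_simps)
    also have "\<dots> = e" using s by (simp add: e_def field_simps)
    finally show ?thesis .
  qed
  define Z where "Z = (1 / (2 * pi)) ^ n * (sqrt (2 * pi) * L) ^ n"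
  have Z: "Z > 0" using L by (simp add: Z_def)
  define P where "P = Z * (c * \<omega> / 2) * (\<kappa> / 2) ^ n * A powr (2 * (m - real n) / s)"
  have P: "P > 0" using c \<omega> A1 Z \<kappa> by (simp add: P_def)
  \<comment> \<open>Here s > 2 enters: W tends to infinity with K, so that the frequency width 1/W
    and the spacing A^2 / W both drop below \<kappa>.\<close>
  obtain K0 where K0: "\<And>K. K \<ge> K0 \<Longrightarrow> 2 * A\<^sup>2 / \<kappa> \<le> A * ((A * real K) powr (2 / s)) powr (s / 2 - 1)"
  proof -
    define p where "p = 2 / s * (s / 2 - 1)"
    have p: "p > 0" using s2 by (simp add: p_def)
    have "A > 0" using A1 by simp
    then have "filterlim (\<lambda>K::nat. A * (A * real K) powr p) at_top sequentially"
      using p by real_asymp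
    then have "eventually (\<lambda>K::nat. 2 * A\<^sup>2 / \<kappa> \<le> A * (A * real K) powr p) sequentially"
      unfolding filterlim_at_top by blast
    then show thesis using that unfolding eventually_sequentially p_def powr_powr by blast
  qed
  define DD where "DD = B * Cf * Cf"
  have DD: "DD \<ge> 0" using B Cf by (simp add: DD_def)
  have main: "P * real K powr e \<le> CL * DD + 0 * ln (real K)" if "K \<ge> max 1 K0" for K :: nat
  proof -
    have K: "K \<ge> 1" and KK0: "K \<ge> K0" using that by auto
    define R where "R = (A * real K) powr (2 / s)"
    define W where "W = A * ((A * real K) powr (2 / s)) powr (s / 2 - 1)"

    have sc: "1 \<le> R" "R powr (s / 2) = A * real K" "0 < W" "R powr (s / 2) \<le> W * R" "1 \<le> W * R"
      "R powr (s - 2) = W\<^sup>2 / A\<^sup>2" "R powr (s - 2) * (R / real K) = W"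
      "\<And>e. R powr e = A powr (2 * e / s) * real K powr (2 * e / s)"
      unfolding R_def W_def by (rule scales[OF A1 s K])+
    have Wbig: "2 * A\<^sup>2 / \<kappa> \<le> W" unfolding W_def by (rule K0[OF KK0])
    have \<kappa>W: "2 * A\<^sup>2 \<le> \<kappa> * W" using Wbig \<kappa> by (simp add: field_simps)
    moreover have "1 \<le> A\<^sup>2" using A1 by (simp add: one_le_power)
    ultimately have \<kappa>W2: "2 \<le> \<kappa> * W" by linarith
    define h where "h = R / real K"
    have h: "h > 0" using sc(1) K by (simp add: h_def)
    have "W * (W * h) = W * A\<^sup>2"
      using sc(7)[folded h_def] sc(6) A1 sc(3) by (simp add: field_simps power2_eq_square)
    then have hA: "W * h = A\<^sup>2" using sc(3) by simp
    have \<kappa>h: "2 * h \<le> \<kappa>"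
    proof -
      have "W * (2 * h) \<le> W * \<kappa>" using \<kappa>W hA by (simp add: mult.commute)
      then show ?thesis using sc(3) by simp
    qed
    \<comment> \<open>The number of lattice steps within \<kappa> in one coordinate; rounding down
      loses at most a factor 2 because \<kappa> / h \<ge> 2.\<close>
    define J where "J = nat \<lfloor>\<kappa> / h\<rfloor>"
    have kh2: "2 \<le> \<kappa> / h" using \<kappa>h h by (simp add: field_simps)
    have J: "real J \<le> \<kappa> / h" "\<kappa> / h \<le> 2 * real J" "1 \<le> real J"
      using kh2 unfolding J_def by linarith+
    have JK: "J \<le> K"
    proof -
      have "\<kappa> / h \<le> 1 / h" using \<kappa> h by (intro divide_right_mono) auto
      also have "\<dots> \<le> real K" using sc(1) K by (simp add: h_def field_simps)
      finally show ?thesis using J(1) by simp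
    qed
    define F :: "('a \<Rightarrow> nat) \<Rightarrow> 'a" where "F = freq R K"
    define N where "N = (\<lambda>k. 1 *\<^sub>R F k)"
    \<comment> \<open>The gradient of the phase is odd, so reflecting the frequencies reflects the
      centres as well: the second factor is the reflection of the first.\<close>
    define N' where "N' = (\<lambda>k. (- 1) *\<^sub>R F k)"
    have F: "R \<le> norm (F k)" "norm (F k) \<le> M * R" if "k \<in> lattice K" for k
      using norm_freq[OF that, of R] sc(1) by (auto simp: F_def M_def n_def)
    have Fd: "(norm (F k - F l))\<^sup>2 = h\<^sup>2 * (\<Sum>i\<in>Basis. (real (k i) - real (l i))\<^sup>2)" for k l
      unfolding F_def h_def by (rule norm_freq_diff)
    define T where "T = bilinear_op (symb s m) (wave s 1 W N K) (wave s 1 W N' K)"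
    have Tb: "bmo_norm T \<le> ennreal DD"
      unfolding T_def DD_def
    proof (rule bb)
      show "norm (wave s 1 W N K x) \<le> Cf" for x
        unfolding N_def F_def using sc K by (intro wb) auto
      show "norm (wave s 1 W N' K x) \<le> Cf" for x
        unfolding N'_def F_def using sc K by (intro wb) auto
    qed (use sc K in \<open>auto intro: wave_schwartz\<close>)
    define E where "E = (\<lambda>k l z. elliptic m z * (gauss (1 / W) (N k) (fst z) * gauss (1 / W) (N' l) (snd z)))"
    define \<Theta> where "\<Theta> = (\<lambda>k l. pair_phase s 1 1 (N k) (N' l))"
    define w where "w = (\<lambda>z::'a \<times> 'a. gauss \<kappa> 0 (fst z + snd z))"
    define I where "I = (\<lambda>k l. LINT z|lborel. cis (\<Theta> k l z) * complex_of_real (w z * E k l z))"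
    define G where "G = (sqrt (2 * pi) * W) ^ DIM('a) * (sqrt (2 * pi) * W) ^ DIM('a) / (2 * pi) ^ (2 * DIM('a))"
    have G: "G = (1 / (2 * pi)) ^ n * (W ^ n * W ^ n)"
      unfolding G_def n_def by (rule gauss_constant)
    have iE: "integrable lborel (E k l)" for k l
      unfolding E_def using sc m by (intro integrable_elliptic_gauss) auto
    have nE: "0 \<le> E k l z" for k l z
      unfolding E_def by (intro mult_nonneg_nonneg elliptic_nonneg gauss_nonneg)
    have m\<Theta> [measurable]: "\<Theta> k l \<in> borel_measurable borel" for k l unfolding \<Theta>_def by measurable
    have mw: "w \<in> borel_measurable borel" unfolding w_def borel_prod[symmetric] by measurable
    have Tx: "T x = complex_of_real G * (\<Sum>k\<in>lattice K. \<Sum>l\<in>lattice K. (LINT z|lborel. cis (x \<bullet> (fst z + snd z) + \<Theta> k l z) * complex_of_real (E k l z)))" for x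
    proof -
      have i: "integrable lborel (\<lambda>z. cis (x \<bullet> (fst z + snd z) + \<Theta> k l z) * complex_of_real (E k l z))" for k l
      proof (rule Bochner_Integration.integrable_bound[OF iE[of k l]])
        have [measurable]: "(\<lambda>z::'a \<times> 'a. x \<bullet> (fst z + snd z)) \<in> borel_measurable borel"
          unfolding borel_prod[symmetric] by measurable
        have [measurable]: "E k l \<in> borel_measurable borel" using iE[of k l] by auto
        show "(\<lambda>z. cis (x \<bullet> (fst z + snd z) + \<Theta> k l z) * complex_of_real (E k l z)) \<in> borel_measurable lborel" by measurable
      qed (auto simp: norm_mult)
      have "T x = complex_of_real G * (LINT z|lborel. (\<Sum>k\<in>lattice K. \<Sum>l\<in>lattice K. cis (x \<bullet> (fst z + snd z) + \<Theta> k l z) * complex_of_real (E k l z)))"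
        unfolding T_def bilinear_wave[OF sc(3) sc(3)] by (simp only: G_def \<Theta>_def E_def)
      also have "(LINT z|lborel. (\<Sum>k\<in>lattice K. \<Sum>l\<in>lattice K. cis (x \<bullet> (fst z + snd z) + \<Theta> k l z) * complex_of_real (E k l z)))
          = (\<Sum>k\<in>lattice K. \<Sum>l\<in>lattice K. (LINT z|lborel. cis (x \<bullet> (fst z + snd z) + \<Theta> k l z) * complex_of_real (E k l z)))"
        by (subst Bochner_Integration.integral_sum, intro Bochner_Integration.integrable_sum i,
            intro sum.cong refl Bochner_Integration.integral_sum i)
      finally show ?thesis .
    qed
    have bi: "has_bochner_integral lborel (\<lambda>x. complex_of_real (gauss L 0 x) * T x)
       (complex_of_real G * (\<Sum>k\<in>lattice K. \<Sum>l\<in>lattice K. complex_of_real ((sqrt (2 * pi) * L) ^ n) * I k l))"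
    proof -
      have "has_bochner_integral lborel (\<lambda>x. complex_of_real G * (\<Sum>k\<in>lattice K. \<Sum>l\<in>lattice K.
           complex_of_real (gauss L 0 x) * (LINT z|lborel. cis (x \<bullet> (fst z + snd z) + \<Theta> k l z) * complex_of_real (E k l z))))
         (complex_of_real G * (\<Sum>k\<in>lattice K. \<Sum>l\<in>lattice K. complex_of_real ((sqrt (2 * pi) * L) ^ n) * I k l))"
        unfolding I_def w_def n_def L(2)[symmetric]
        by (intro has_bochner_integral_mult_right has_bochner_integral_sum gauss_pairing_fubini L iE nE m\<Theta>)
      moreover have "(\<lambda>x. complex_of_real G * (\<Sum>k\<in>lattice K. \<Sum>l\<in>lattice K.
           complex_of_real (gauss L 0 x) * (LINT z|lborel. cis (x \<bullet> (fst z + snd z) + \<Theta> k l z) * complex_of_real (E k l z))))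
         = (\<lambda>x. complex_of_real (gauss L 0 x) * T x)"
        unfolding Tx by (simp only: sum_distrib_left mult.left_commute)
      ultimately show ?thesis by (simp only:)
    qed
    have up: "norm (LINT x|lborel. complex_of_real (gauss L 0 x) * T x) \<le> CL * DD"
    proof -
      have "ennreal (norm (LINT x|lborel. complex_of_real (gauss L 0 x) * T x))
          \<le> (\<integral>\<^sup>+x. norm (complex_of_real (gauss L 0 x) * T x) \<partial>lborel)"
        using bi by (intro integral_norm_bound_ennreal) (simp add: has_bochner_integral_iff)
      also have "\<dots> = (\<integral>\<^sup>+x. ennreal (norm (T x) * gauss L 0 x) \<partial>lebesgue)"
        by (simp add: nn_integral_completion norm_mult gauss_nonneg mult.commute)
      also have "\<dots> \<le> ennreal (CL * DD)" by (rule pairing[OF Tb DD])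
      finally show ?thesis using CL DD by simp
    qed
    define near where "near = (\<lambda>k l. \<forall>i\<in>(Basis::'a set). \<bar>real (l i) - real (k i)\<bar> < real J)"
    define g where "g = (\<lambda>k l. exp (- (norm (F k - F l))\<^sup>2 / (12 * \<kappa>\<^sup>2)))"
    define Q where "Q = R powr m / (W ^ n * W ^ n)"
    have Q: "Q \<ge> 0" using sc(3) by (simp add: Q_def)
    \<comment> \<open>A pair that is not near is credited with no gain; its loss decays with the
      distance of the frequencies.\<close>
    have est: "(c * (if near k l then \<omega> else 0) - C * ((D + 2 * \<kappa>) * g k l)) * Q \<le> Re (I k l)"
      if k: "k \<in> lattice K" and l: "l \<in> lattice K" for k l
    proof -
      have "(c * (if near k l then \<omega> else 0) - C * ((D + 2 * \<kappa>) * g k l)) * R powr m / (W ^ DIM('a) * W ^ DIM('a)) \<le>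
        Re (LINT z|lborel. cis (\<Theta> k l z) * complex_of_real (w z * elliptic m z * (gauss (1 / W) (N k) (fst z) * gauss (1 / W) (N' l) (snd z))))"
      proof (rule conjunct2[OF pe])
        show "1 \<le> R" "0 < W" "0 < W" "R \<le> norm (N k)" "norm (N k) \<le> M * R" "norm (N' l) \<le> M * R" "R powr (s / 2) \<le> W * R" "1 \<le> W * R"
          using sc F[OF k] F[OF l] by (auto simp: N_def N'_def)
        show "w \<in> borel_measurable borel" by (rule mw)
        show "0 \<le> w z" "w z \<le> 1" for z by (auto simp: w_def gauss_nonneg gauss_le_1)
        show "0 \<le> (D + 2 * \<kappa>) * g k l" using D \<kappa> by (simp add: g_def)
        fix \<xi> \<eta> :: 'a
        have \<Theta>_eq: "\<Theta> k l (\<xi>, \<eta>) = (phase s \<xi> - phase s (N k) - grad_phase s (N k) \<bullet> (\<xi> - N k)) +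
            ((phase s \<eta> - phase s (N' l) - grad_phase s (N' l) \<bullet> (\<eta> - N' l)) + phase s (\<xi> + \<eta>))"
          by (simp add: \<Theta>_def pair_phase_def)
        have tay: "dev (phase s x - phase s v - grad_phase s v \<bullet> (x - v)) \<le> D * (W * norm (x - v))\<^sup>2"
          if "R \<le> norm v" "norm v \<le> M * R" for x v :: 'a
          using taylor[OF sc(1) that, of x] unfolding sc(6) by (simp add: D_def power_mult_distrib)
        have "w (\<xi>, \<eta>) * dev (\<Theta> k l (\<xi>, \<eta>)) \<le> ((D + 2 * \<kappa>) * exp (- (norm (N k - F l))\<^sup>2 / (12 * \<kappa>\<^sup>2))) *
          ((1 + (W * norm (\<xi> - N k))\<^sup>2) * exp ((W * norm (\<xi> - N k))\<^sup>2 / 8) *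
          ((1 + (W * norm (\<eta> + F l))\<^sup>2) * exp ((W * norm (\<eta> + F l))\<^sup>2 / 8)))"
          unfolding w_def \<Theta>_eq fst_conv snd_conv
        proof (rule window_dev_bound)
          show "dev (phase s \<xi> - phase s (N k) - grad_phase s (N k) \<bullet> (\<xi> - N k)) \<le> D * (W * norm (\<xi> - N k))\<^sup>2"
            using F[OF k] by (intro tay) (auto simp: N_def)
          have "dev (phase s \<eta> - phase s (N' l) - grad_phase s (N' l) \<bullet> (\<eta> - N' l)) \<le> D * (W * norm (\<eta> - N' l))\<^sup>2"
            using F[OF l] by (intro tay) (auto simp: N'_def)
          then show "dev (phase s \<eta> - phase s (N' l) - grad_phase s (N' l) \<bullet> (\<eta> - N' l)) \<le> D * (W * norm (\<eta> + F l))\<^sup>2"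
            by (simp add: N'_def)
        qed (use \<kappa> sc \<kappa>W2 s D in auto)
        then show "w (\<xi>, \<eta>) * dev (\<Theta> k l (\<xi>, \<eta>)) \<le> (D + 2 * \<kappa>) * g k l *
          ((1 + (W * norm (\<xi> - N k))\<^sup>2) * exp ((W * norm (\<xi> - N k))\<^sup>2 / 8) *
          ((1 + (W * norm (\<eta> - N' l))\<^sup>2) * exp ((W * norm (\<eta> - N' l))\<^sup>2 / 8)))"
          by (simp add: g_def N_def N'_def)
        assume near1: "norm (\<xi> - N k) \<le> 1 / W" "norm (\<eta> - N' l) \<le> 1 / W"
        show "(if near k l then \<omega> else 0) \<le> w (\<xi>, \<eta>)"
        proof (cases "near k l")
          case True
          have "(\<Sum>i\<in>(Basis::'a set). (real (k i) - real (l i))\<^sup>2) \<le> (\<Sum>i\<in>(Basis::'a set). (real J)\<^sup>2)"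
          proof (rule sum_mono)
            fix i :: 'a assume "i \<in> Basis"
            then have "\<bar>real (k i) - real (l i)\<bar> \<le> \<bar>real J\<bar>" using True by (force simp: near_def abs_minus_commute)
            then show "(real (k i) - real (l i))\<^sup>2 \<le> (real J)\<^sup>2" by (simp only: abs_le_square_iff)
          qed
          then have "(norm (F k - F l))\<^sup>2 \<le> h\<^sup>2 * (real n * (real J)\<^sup>2)"
            unfolding Fd by (intro mult_left_mono) (auto simp: n_def)
          also have "\<dots> = real n * (h * real J)\<^sup>2" by (simp add: power_mult_distrib)
          also have "\<dots> \<le> real n * \<kappa>\<^sup>2"
            using J(1) h by (intro mult_left_mono power_mono) (auto simp: field_simps)
          also have "\<dots> \<le> (real n)\<^sup>2 * \<kappa>\<^sup>2" using n by (intro mult_right_mono) (auto simp: power2_eq_square)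
          finally have "(norm (F k - F l))\<^sup>2 \<le> (real n * \<kappa>)\<^sup>2" by (simp add: power_mult_distrib)
          then have 1: "norm (F k - F l) \<le> real n * \<kappa>" by (rule power2_le_imp_le) (use \<kappa> in simp)
          have eq: "\<xi> + \<eta> = (\<xi> - N k) + (\<eta> - N' l) + (F k - F l)" by (simp add: N_def N'_def)
          have "norm (\<xi> + \<eta>) \<le> norm ((\<xi> - N k) + (\<eta> - N' l)) + norm (F k - F l)"
            by (subst eq) (rule norm_triangle_ineq)
          then have "norm (\<xi> + \<eta>) \<le> 1 / W + 1 / W + real n * \<kappa>"
            using norm_triangle_ineq[of "\<xi> - N k" "\<eta> - N' l"] near1 1 by linarith
          also have "1 / W + 1 / W \<le> \<kappa>" using \<kappa>W2 sc(3) by (simp add: field_simps)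
          finally have "norm (\<xi> + \<eta>) \<le> (real n + 1) * \<kappa>" by (simp add: algebra_simps)
          then have "(norm (\<xi> + \<eta>))\<^sup>2 \<le> ((real n + 1) * \<kappa>)\<^sup>2" by (intro power_mono) auto
          then have "(norm (\<xi> + \<eta>))\<^sup>2 / (2 * \<kappa>\<^sup>2) \<le> ((real n + 1) * \<kappa>)\<^sup>2 / (2 * \<kappa>\<^sup>2)" by (intro divide_right_mono) auto
          also have "\<dots> = (real n + 1)\<^sup>2 / 2" using \<kappa> by (simp add: power_mult_distrib)
          finally show ?thesis using True by (simp add: w_def gauss_def \<omega>_def)
        qed (simp add: w_def gauss_nonneg)
      qed (use \<omega> m\<Theta> in auto)
      then show ?thesis by (simp add: I_def E_def Q_def n_def mult.assoc)
    qed
    \<comment> \<open>The losses sum to the same order J^n as the number of near partners, so that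
      the choice of q decides.\<close>
    have sum_l: "c * \<omega> / 2 * real J ^ n \<le> (\<Sum>l\<in>lattice K. c * (if near k l then \<omega> else 0) - C * ((D + 2 * \<kappa>) * g k l))"
      if k: "k \<in> lattice K" for k
    proof -
      have "(\<Sum>l\<in>lattice K. if near k l then \<omega> else 0) = (\<Sum>l\<in>{l \<in> lattice K. near k l}. \<omega>)"
        by (rule sum.inter_filter[symmetric]) simp
      also have "\<dots> = real (card {l \<in> lattice K. near k l}) * \<omega>" by simp
      also have "real J ^ n * \<omega> \<le> \<dots>"
      proof -
        have "J ^ n \<le> card {l \<in> lattice K. near k l}"
          using card_lattice_near[OF JK k] by (simp add: near_def n_def)
        then have "real (J ^ n) \<le> real (card {l \<in> lattice K. near k l})" by (simp only: of_nat_le_iff)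
        then show ?thesis using \<omega> by (intro mult_right_mono) auto
      qed
      finally have 1: "c * (real J ^ n * \<omega>) \<le> c * (\<Sum>l\<in>lattice K. if near k l then \<omega> else 0)"
        using c by (intro mult_left_mono) auto
      have "(\<Sum>l\<in>lattice K. g k l) \<le> (36 * real J) ^ n"
      proof -
        define b where "b = h / (sqrt 12 * \<kappa>)"
        have b: "b > 0" using h \<kappa> by (simp add: b_def)
        have "g k l = exp (- b\<^sup>2 * (\<Sum>i\<in>(Basis::'a set). (real (l i) - real (k i))\<^sup>2))" for l
          unfolding g_def Fd b_def by (simp add: power_divide power_mult_distrib power2_commute)
        then have "(\<Sum>l\<in>lattice K. g k l) \<le> (4 * (1 + 1 / b)) ^ n"
          unfolding n_def by (simp only:) (rule lattice_gauss_sum_bound[OF b])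
        also have "\<dots> \<le> (36 * real J) ^ n"
        proof (rule power_mono)
          \<comment> \<open>From \<kappa> / h \<le> 2 J one gets 1 / b \<le> 8 J, and 4 + 32 J \<le>
            36 J as J \<ge> 1; this is the origin of the 36 in \<open>q\<close>.\<close>
          have "sqrt 12 \<le> (4::real)" by (rule real_le_lsqrt) auto
          then have "sqrt 12 * (\<kappa> / h) \<le> 4 * (2 * real J)" using J \<kappa> h by (intro mult_mono) auto
          then show "4 * (1 + 1 / b) \<le> 36 * real J" using J(3) by (simp add: b_def)
        qed (use b in simp)
        finally show ?thesis .
      qed
      then have "(D + 2 * \<kappa>) * (\<Sum>l\<in>lattice K. g k l) \<le> q * (36 * real J) ^ n"
        using D \<kappa> q by (intro mult_mono sum_nonneg) (auto simp: g_def)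
      then have "C * ((D + 2 * \<kappa>) * (\<Sum>l\<in>lattice K. g k l)) \<le> C * (q * (36 * real J) ^ n)"
        using C by (intro mult_left_mono) auto
      also have "\<dots> = c * \<omega> / 2 * real J ^ n" using C by (simp add: q_def power_mult_distrib)
      finally have 2: "C * ((D + 2 * \<kappa>) * (\<Sum>l\<in>lattice K. g k l)) \<le> c * \<omega> / 2 * real J ^ n" .
      have "(\<Sum>l\<in>lattice K. c * (if near k l then \<omega> else 0) - C * ((D + 2 * \<kappa>) * g k l))
          = c * (\<Sum>l\<in>lattice K. if near k l then \<omega> else 0) - C * ((D + 2 * \<kappa>) * (\<Sum>l\<in>lattice K. g k l))"
        unfolding sum_subtractf sum_distrib_left ..
      moreover have "c * \<omega> / 2 * real J ^ n = c * (real J ^ n * \<omega>) - c * \<omega> / 2 * real J ^ n" by simp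
      ultimately show ?thesis using 1 2 by linarith
    qed
    have "real K ^ n * (c * \<omega> / 2 * real J ^ n * Q) \<le> (\<Sum>k\<in>lattice K. \<Sum>l\<in>lattice K. Re (I k l))"
    proof -
      have "real K ^ n * (c * \<omega> / 2 * real J ^ n * Q) = (\<Sum>k\<in>(lattice K :: ('a \<Rightarrow> nat) set). c * \<omega> / 2 * real J ^ n * Q)"
        unfolding sum_constant card_lattice n_def by simp
      also have "\<dots> \<le> (\<Sum>k\<in>lattice K. \<Sum>l\<in>lattice K. Re (I k l))"
      proof (rule sum_mono)
        fix k :: "'a \<Rightarrow> nat" assume k: "k \<in> lattice K"
        have "c * \<omega> / 2 * real J ^ n * Q \<le> (\<Sum>l\<in>lattice K. c * (if near k l then \<omega> else 0) - C * ((D + 2 * \<kappa>) * g k l)) * Q"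
          by (intro mult_right_mono sum_l k Q)
        also have "\<dots> = (\<Sum>l\<in>lattice K. (c * (if near k l then \<omega> else 0) - C * ((D + 2 * \<kappa>) * g k l)) * Q)"
          by (rule sum_distrib_right)
        also have "\<dots> \<le> (\<Sum>l\<in>lattice K. Re (I k l))" by (intro sum_mono est k)
        finally show "c * \<omega> / 2 * real J ^ n * Q \<le> (\<Sum>l\<in>lattice K. Re (I k l))" .
      qed
      finally show ?thesis .
    qed
    then have "G * ((sqrt (2 * pi) * L) ^ n * (real K ^ n * (c * \<omega> / 2 * real J ^ n * Q)))
        \<le> G * ((sqrt (2 * pi) * L) ^ n * (\<Sum>k\<in>lattice K. \<Sum>l\<in>lattice K. Re (I k l)))"
      using L sc(3) unfolding G by (intro mult_left_mono) auto
    also have "\<dots> = Re (complex_of_real G * (\<Sum>k\<in>lattice K. \<Sum>l\<in>lattice K. complex_of_real ((sqrt (2 * pi) * L) ^ n) * I k l))"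
    proof -
      have re: "Re (complex_of_real a * z) = a * Re z" for a z by simp
      show ?thesis by (simp only: re Re_sum sum_distrib_left)
    qed
    also have "\<dots> = Re (LINT x|lborel. complex_of_real (gauss L 0 x) * T x)"
      using bi by (simp only: has_bochner_integral_iff)
    also have "\<dots> \<le> CL * DD" using complex_Re_le_cmod up order_trans by blast
    finally have fin: "G * ((sqrt (2 * pi) * L) ^ n * (real K ^ n * (c * \<omega> / 2 * real J ^ n * Q))) \<le> CL * DD" .
    have "P * real K powr e \<le> G * ((sqrt (2 * pi) * L) ^ n * (real K ^ n * (c * \<omega> / 2 * real J ^ n * Q)))"
    proof -
      have GQ: "G * ((sqrt (2 * pi) * L) ^ n * (real K ^ n * (c * \<omega> / 2 * real J ^ n * Q)))
          = Z * (c * \<omega> / 2) * (real K ^ n * real J ^ n * R powr m)"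
      proof -
        have "(x * Y) * (y * (a * (t * b * (r / Y)))) = (x * y) * t * (a * b * r)" if "Y \<noteq> 0" for x y a b r t Y :: real
          using that by simp
        moreover have "W ^ n * W ^ n \<noteq> 0" using sc(3) by simp
        ultimately show ?thesis unfolding G Q_def Z_def by blast
      qed
      have "(\<kappa> / 2) * (real K / R) \<le> real J"
        using J(2) by (simp add: h_def field_simps)
      then have "((\<kappa> / 2) * (real K / R)) ^ n \<le> real J ^ n"
        using \<kappa> sc(1) by (intro power_mono) auto
      then have "real K ^ n * ((\<kappa> / 2) * (real K / R)) ^ n * R powr m \<le> real K ^ n * real J ^ n * R powr m"
        by (intro mult_right_mono mult_left_mono) auto
      moreover have "real K ^ n * ((\<kappa> / 2) * (real K / R)) ^ n * R powr m = (\<kappa> / 2) ^ n * A powr (2 * (m - real n) / s) * real K powr e"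
      proof -
        have "R powr m / R ^ n = R powr (m - real n)" using sc(1) by (simp add: powr_diff powr_realpow)
        also have "\<dots> = A powr (2 * (m - real n) / s) * real K powr (2 * (m - real n) / s)" by (rule sc(8))
        finally have r: "R powr m / R ^ n = A powr (2 * (m - real n) / s) * real K powr (2 * (m - real n) / s)" .
        have "real K powr e = real K ^ n * real K ^ n * real K powr (2 * (m - real n) / s)"
        proof -
          have "real K powr (2 * real n) = real K ^ (2 * n)" using K powr_realpow[of "real K" "2 * n"] by simp
          also have "\<dots> = real K ^ n * real K ^ n" by (simp only: mult_2 power_add)
          finally show ?thesis unfolding e_def powr_add by (simp only:)
        qed
        moreover have "real K ^ n * ((\<kappa> / 2) * (real K / R)) ^ n * R powr m = (\<kappa> / 2) ^ n * (real K ^ n * real K ^ n) * (R powr m / R ^ n)"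
          by (simp add: power_mult_distrib power_divide)
        ultimately show ?thesis unfolding r by (simp only: mult_ac)
      qed
      ultimately have "Z * (c * \<omega> / 2) * ((\<kappa> / 2) ^ n * A powr (2 * (m - real n) / s) * real K powr e) \<le> Z * (c * \<omega> / 2) * (real K ^ n * real J ^ n * R powr m)"
        using Z c \<omega> by (intro mult_left_mono) auto
      then show ?thesis unfolding GQ P_def by (simp only: mult.assoc)
    qed
    with fin show ?thesis by simp
  qed
  show ?case by (rule powr_ln_contradiction[OF e P main])
  qed
qed

end

section \<open>Reduction to nonpositive orders and conclusion\<close>

lemma symbol_class_mono:
  assumes "m' \<le> m"
  shows "symbol_class m' \<subseteq> symbol_class m"
proof
  fix \<sigma> :: "'a \<Rightarrow> complex" assume \<sigma>: "\<sigma> \<in> symbol_class m'"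
  have "\<exists>C. \<forall>\<zeta>. norm (iter_partial bs \<sigma> \<zeta>) \<le> C * (1 + norm \<zeta>) powr (m - real (length bs))"
    if bs: "bs \<in> lists Basis" for bs
  proof -
    obtain C where C: "\<And>\<zeta>. norm (iter_partial bs \<sigma> \<zeta>) \<le> C * (1 + norm \<zeta>) powr (m' - real (length bs))"
      using \<sigma> bs unfolding symbol_class_def by blast
    have "norm (iter_partial bs \<sigma> \<zeta>) \<le> \<bar>C\<bar> * (1 + norm \<zeta>) powr (m - real (length bs))" for \<zeta>
    proof -
      have "C * (1 + norm \<zeta>) powr (m' - real (length bs)) \<le> \<bar>C\<bar> * (1 + norm \<zeta>) powr (m - real (length bs))"
        using assms by (intro mult_mono powr_mono) auto
      with C[of \<zeta>] show ?thesis by linarith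
    qed
    then show ?thesis by blast
  qed
  with \<sigma> show "\<sigma> \<in> symbol_class m" unfolding symbol_class_def by blast
qed

theorem proposition4p3:
  fixes s m :: real
  assumes "1 < s"
    and "\<And>\<sigma> :: (real ^ 'n) \<times> (real ^ 'n) \<Rightarrow> complex. \<sigma> \<in> symbol_class m \<Longrightarrow>
      bilinear_multiplier Linf_norm Linf_norm bmo_norm
        (\<lambda>(\<xi>, \<eta>). exp (\<i> * complex_of_real (norm \<xi> powr s + norm \<eta> powr s + norm (\<xi> + \<eta>) powr s))
                    * \<sigma> (\<xi>, \<eta>))"
  shows "m \<le> critical_order CARD('n) s"
proof (rule ccontr)
  assume neg: "\<not> m \<le> critical_order CARD('n) s"
  define mc where "mc = critical_order CARD('n) s"
  have mc: "mc < 0" using assms(1) by (simp add: mc_def critical_order_def)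
  \<comment> \<open>The threshold \<open>mc\<close> is negative, so an order above it can be lowered
    to one that is at most 0 and still above it; the symbol of the lower order belongs to the given
    class.\<close>
  define m' where "m' = min m (mc / 2)"
  have m': "m' \<le> 0" "m' \<le> m" "mc < m'" using mc neg by (auto simp: m'_def mc_def)
  have "(\<lambda>z::(real ^ 'n) \<times> (real ^ 'n). complex_of_real (elliptic m' z)) \<in> symbol_class m"
    using bracket_symbol_class symbol_class_mono[OF m'(2)] unfolding elliptic_def by blast
  from assms(2)[OF this]
  interpret multiplier s m' "TYPE(real ^ 'n)"
    using assms(1) m'(1) by unfold_locales (simp_all add: symb_def)
  show False
  proof (cases "s \<le> 2")
    case True
    then show False using order_le_linear m'(3) by (simp add: mc_def critical_order_def)
  next
    case False
    then show False using order_le_bilinear m'(3) by (simp add: mc_def critical_order_def)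
  qed
qed

end
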